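(* Let $\Gamma\subset\mathbb{C}$ be a lattice, $\beta_0\in\Gamma^*$, $N=\#\Gamma^*_{\beta_0}$, and set $n=\frac N2-1$. Whenever $N>0$, the map $\mathbb{HP}^n\to\mathcal{M}(\Gamma,\beta_0)$ induced by the assignment $(w_1,\dots,w_{N/2})\mapsto x(\lambda)\mapsto f$ described in the context is a diffeomorphism.
   Context: **HSL tori.** $\mathbb{R}^4$ has its standard inner product and orthonormal basis $\varepsilon_1,\dots,\varepsilon_4$. $J,L\in SO(4)$ are given by $J\varepsilon_1=\varepsilon_2$, $J\varepsilon_2=-\varepsilon_1$, $J\varepsilon_3=\varepsilon_4$, $J\varepsilon_4=-\varepsilon_3$; $L\varepsilon_1=\varepsilon_3$, $L\varepsilon_3=-\varepsilon_1$, $L\varepsilon_2=-\varepsilon_4$, $L\varepsilon_4=\varepsilon_2$, extended complex linearly to $\mathbb{C}^4$. $G_0=\{g\in SO(4):gJ=Jg,\ gL=Lg\}\simeq SU(2)$ is the group of base point preserving symplectic isometries. On $\mathbb{C}$, $\langle z,w\rangle=\mathrm{Re}(z\bar w)$; $\Gamma^*=\{\gamma:\langle\gamma,z\rangle\in\mathbb{Z}\ \forall z\in\Gamma\}$; $\beta(z)=2\pi\langle\beta_0,z\rangle$. A weakly conformal Hamiltonian stationary Lagrangian (HSL) torus based at $f(0)=0$ with Maslov class $\beta_0$ is a non-constant smooth $f:\mathbb{C}/\Gamma\to\mathbb{R}^4$ with $f(0)=0$ and $e^{J\beta}L f_z=i f_z$. $\mathcal{M}(\Gamma,\beta_0)$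 is the set of all such $f$ modulo $\mathbb{R}^+\times G_0$ (dilations and base point preserving symplectic isometries), with the manifold structure inherited from the Banach space $C^2(S^1\times S^1,\mathbb{R}^4)$ (where $\mathbb{C}/\Gamma\cong S^1\times S^1$) with the norm of uniform convergence of derivatives up to second order. **Frequencies.** $\Gamma^*_{\beta_0}=\{\gamma\in\Gamma^*+\frac{\beta_0}{2}:|\gamma|=\frac{|\beta_0|}2,\ \gamma\ne\pm\frac{\beta_0}2\}=\{\gamma_1,\dots,\gamma_N\}$ ($N$ even), labelled with $\gamma_{j+N/2}=-\gamma_j$; $s_j=2\gamma_j/\beta_0$; $p(\lambda)=\prod_{j=1}^N(\lambda-s_j)$. **The map.** Identify $\mathbb{R}^4$ with the quaternions $\mathbb{H}$ by $\varepsilon_1,\varepsilon_2,\varepsilon_3,\varepsilon_4\mapsto 1,i,j,k$, so that $J$ and $L$ are left multiplication by $i$ and $j$; then $G_0$ acts as right multiplication by unit quaternions. $\mathbb{HP}^n$ is the quotient of $\mathbb{H}^{n+1}\setminus\{0\}$ by right multiplication by $\mathbb{H}^*$. Fix square roots $\sqrt{p(0)s_j^{N+1}}$, $1\le j\le N/2$. Given $(w_1,\dots,w_{N/2})\in\mathbb{H}^{N/2}\setminus\{0\}$, let $x(\lambda)$ be the unique $\mathbb{C}^4$-valued polynomial of degree at most $N$ with $x(0)=0$ and $x(s_j)=\sqrt{p(0)s_j^{N+1}}\,w_j$, $x(s_{j+N/2})=x(-s_j)=-iL\,x(s_j)$ for $1\le j\le N/2$. Let $x(\lambda,z)$ be the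 unique $\mathbb{C}^4$-valued polynomial in $\lambda$ of degree at most $N$ vanishing at $\lambda=0$ with $x(s_j,z)=\exp(-2\pi\langle\gamma_j,z\rangle J)x(s_j)$ for $1\le j\le N$. Then $$f(z)=\frac1{p(1)}\big(e^{J\beta(z)/2}x(1,z)-x(1,0)\big).$$ This assignment intertwines right multiplication by $\mathbb{H}^*$ with the action of $\mathbb{R}^+\times G_0$, so it descends to a map $\mathbb{HP}^n\to\mathcal{M}(\Gamma,\beta_0)$. *)

theory Defs
  imports "HOL-Analysis.Analysis" "HOL-Computational_Algebra.Polynomial"
begin

section \<open>Smooth maps and quotient manifolds\<close>

text \<open>
  Smoothness of a map on a set \<open>S\<close> that is (relatively) open in a finite-dimensional linear
  subspace \<open>V\<close> of a normed space; here \<open>V = span S\<close> as soon as \<open>S\<close> is nonempty.  Only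
  derivatives in the directions of \<open>V\<close> are meaningful, hence the restriction to \<open>v \<in> span S\<close>.
  For \<open>S\<close> open in a Euclidean space this is the usual notion of class \<open>C\<^sup>k\<close>.
\<close>

primrec Ck_on :: "nat \<Rightarrow> 'a::real_normed_vector set \<Rightarrow> ('a \<Rightarrow> 'b::real_normed_vector) \<Rightarrow> bool" where
  "Ck_on 0 S f \<longleftrightarrow> continuous_on S f"
| "Ck_on (Suc k) S f \<longleftrightarrow>
     (\<exists>D. (\<forall>x\<in>S. (f has_derivative D x) (at x within S)) \<and>
          (\<forall>v\<in>span S. Ck_on k S (\<lambda>x. D x v)))"

definition smooth_on :: "'a::real_normed_vector set \<Rightarrow> ('a \<Rightarrow> 'b::real_normed_vector) \<Rightarrow> bool" where
  "smooth_on S f \<longleftrightarrow> (\<forall>k. Ck_on k S f)"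

text \<open>
  A manifold is given by its topology and a set of charts \<open>(U, \<phi>)\<close>.  Charts take values in
  linear subspaces of a fixed Euclidean space (and not in the space itself) so that the
  dimension, including dimension 0, need not be fixed by a type.
\<close>

type_synonym ('q, 'e) manifold = "'q topology \<times> ('q set \<times> ('q \<Rightarrow> 'e)) set"

definition smooth_map ::
  "('p, 'd::euclidean_space) manifold \<Rightarrow> ('q, 'e::euclidean_space) manifold \<Rightarrow> ('p \<Rightarrow> 'q) \<Rightarrow> bool" where
  "smooth_map X Y F \<longleftrightarrow>
     (\<forall>p\<in>topspace (fst X). F p \<in> topspace (fst Y) \<and>
        (\<exists>(U, \<phi>)\<in>snd X. \<exists>(V, \<psi>)\<in>snd Y. p \<in> U \<and> F ` U \<subseteq> V \<and>
           smooth_on (\<phi> ` U) (\<psi> \<circ> F \<circ> inv_into U \<phi>)))"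

definition diffeomorphism ::
  "('p, 'd::euclidean_space) manifold \<Rightarrow> ('q, 'e::euclidean_space) manifold \<Rightarrow> ('p \<Rightarrow> 'q) \<Rightarrow> bool" where
  "diffeomorphism X Y F \<longleftrightarrow>
     bij_betw F (topspace (fst X)) (topspace (fst Y)) \<and>
     smooth_map X Y F \<and> smooth_map Y X (inv_into (topspace (fst X)) F)"

definition quotient_topology :: "'a::topological_space set \<Rightarrow> ('a \<Rightarrow> 'q) \<Rightarrow> 'q topology" where
  "quotient_topology S \<pi> =
     topology (\<lambda>U. U \<subseteq> \<pi> ` S \<and> openin (top_of_set S) {x \<in> S. \<pi> x \<in> U})"

lemma openin_quotient_topology:
  "openin (quotient_topology S \<pi>) U \<longleftrightarrow> U \<subseteq> \<pi> ` S \<and> openin (top_of_set S) {x \<in> S. \<pi> x \<in> U}"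
proof -
  let ?P = "\<lambda>U. U \<subseteq> \<pi> ` S \<and> openin (top_of_set S) {x \<in> S. \<pi> x \<in> U}"
  have "istopology ?P"
    unfolding istopology_def
  proof (intro conjI allI impI)
    fix A B assume A: "?P A" and B: "?P B"
    have "{x \<in> S. \<pi> x \<in> A \<inter> B} = {x \<in> S. \<pi> x \<in> A} \<inter> {x \<in> S. \<pi> x \<in> B}" by auto
    then show "openin (top_of_set S) {x \<in> S. \<pi> x \<in> A \<inter> B}" using A B by auto
    show "A \<inter> B \<subseteq> \<pi> ` S" using A by auto
  next
    fix K assume K: "\<forall>A\<in>K. ?P A"
    have "{x \<in> S. \<pi> x \<in> \<Union>K} = (\<Union>A\<in>K. {x \<in> S. \<pi> x \<in> A})" by auto
    then show "openin (top_of_set S) {x \<in> S. \<pi> x \<in> \<Union>K}" using K by auto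
    show "\<Union>K \<subseteq> \<pi> ` S" using K by auto
  qed
  then show ?thesis by (simp add: quotient_topology_def)
qed

lemma topspace_quotient_topology [simp]: "topspace (quotient_topology S \<pi>) = \<pi> ` S"
proof -
  have "{x \<in> S. \<pi> x \<in> \<pi> ` S} = S" by auto
  then have "openin (quotient_topology S \<pi>) (\<pi> ` S)"
    by (simp add: openin_quotient_topology)
  then show ?thesis
    using openin_quotient_topology[of S \<pi> "topspace (quotient_topology S \<pi>)"]
    by (auto dest: openin_subset)
qed

text \<open>
  The quotient of \<open>S\<close>, open in a finite-dimensional subspace \<open>span S\<close> of a normed space (and thus a
  submanifold of it with tangent spaces \<open>span S\<close>), by the fibres of \<open>\<pi>\<close>.  The charts are those of
  the maximal atlas for which \<open>\<pi>\<close> is a smooth submersion: the homeomorphisms \<open>\<phi>\<close> of open sets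
  \<open>U\<close> onto open sets of a finite-dimensional \<open>E\<close> for which \<open>\<phi> \<circ> \<pi>\<close> is smooth with derivative
  onto \<open>E\<close> at each point.
\<close>

definition quotient_charts ::
  "'a::real_normed_vector set \<Rightarrow> ('a \<Rightarrow> 'q) \<Rightarrow> ('q set \<times> ('q \<Rightarrow> 'e::euclidean_space)) set" where
  "quotient_charts S \<pi> =
     {(U, \<phi>). openin (quotient_topology S \<pi>) U \<and>
        (\<exists>E. subspace E \<and> openin (top_of_set E) (\<phi> ` U) \<and>
             homeomorphic_map (subtopology (quotient_topology S \<pi>) U) (top_of_set (\<phi> ` U)) \<phi> \<and>
             smooth_on {x \<in> S. \<pi> x \<in> U} (\<phi> \<circ> \<pi>) \<and>
             (\<forall>x\<in>S. \<pi> x \<in> U \<longrightarrow>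
                (\<exists>D. ((\<phi> \<circ> \<pi>) has_derivative D) (at x within {x \<in> S. \<pi> x \<in> U}) \<and>
                     D ` span S = E)))}"

definition quotient_manifold ::
  "'a::real_normed_vector set \<Rightarrow> ('a \<Rightarrow> 'q) \<Rightarrow> ('q, 'e::euclidean_space) manifold" where
  "quotient_manifold S \<pi> = (quotient_topology S \<pi>, quotient_charts S \<pi>)"


section \<open>Quaternions and quaternionic projective space\<close>

text \<open>\<open>\<epsilon>\<^sub>1, \<epsilon>\<^sub>2, \<epsilon>\<^sub>3, \<epsilon>\<^sub>4\<close> are identified with \<open>1, i, j, k\<close>.\<close>

type_synonym quat = "real^4"

definition qmult :: "quat \<Rightarrow> quat \<Rightarrow> quat" where
  "qmult a b = vector
     [a$1 * b$1 - a$2 * b$2 - a$3 * b$3 - a$4 * b$4,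
      a$1 * b$2 + a$2 * b$1 + a$3 * b$4 - a$4 * b$3,
      a$1 * b$3 - a$2 * b$4 + a$3 * b$1 + a$4 * b$2,
      a$1 * b$4 + a$2 * b$3 - a$3 * b$2 + a$4 * b$1]"

definition hp_class :: "quat^'m::finite \<Rightarrow> (quat^'m) set" where
  "hp_class w = {(\<chi> j. qmult (w $ j) q) | q. q \<noteq> 0}"

text \<open>\<open>\<bbbH>\<bbbP>\<^sup>n\<close> with \<open>n + 1 = CARD('m)\<close>.\<close>

definition HP :: "((quat^'m::finite) set, quat^'m) manifold" where
  "HP = quotient_manifold (- {0}) hp_class"


section \<open>Linear algebra in \<open>\<real>\<^sup>4\<close> and \<open>\<complex>\<^sup>4\<close>\<close>

definition J :: "real^4^4" where
  "J = vector [vector [0, -1, 0, 0],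
               vector [1,  0, 0, 0],
               vector [0,  0, 0, -1],
               vector [0,  0, 1, 0]]"

definition L :: "real^4^4" where
  "L = vector [vector [0,  0, -1, 0],
               vector [0,  0,  0, 1],
               vector [1,  0,  0, 0],
               vector [0, -1,  0, 0]]"

lemma vector_4 [simp]:
  "(vector [a, b, c, d] :: 'a::zero^4) $ 1 = a"
  "(vector [a, b, c, d] :: 'a::zero^4) $ 2 = b"
  "(vector [a, b, c, d] :: 'a::zero^4) $ 3 = c"
  "(vector [a, b, c, d] :: 'a::zero^4) $ 4 = d"
  by (simp_all add: vector_def)

lemma J_axis:
  "J *v axis 1 1 = axis 2 1" "J *v axis 2 1 = - axis 1 1"
  "J *v axis 3 1 = axis 4 1" "J *v axis 4 1 = - axis 3 1"
  by (simp_all add: vec_eq_iff forall_4 matrix_vector_mult_def sum_4 J_def axis_def)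

lemma L_axis:
  "L *v axis 1 1 = axis 3 1" "L *v axis 3 1 = - axis 1 1"
  "L *v axis 2 1 = - axis 4 1" "L *v axis 4 1 = axis 2 1"
  by (simp_all add: vec_eq_iff forall_4 matrix_vector_mult_def sum_4 L_def axis_def)

lemma J_eq_qmult: "J *v x = qmult (axis 2 1) x"
  by (simp add: vec_eq_iff forall_4 matrix_vector_mult_def sum_4 J_def qmult_def axis_def)

lemma L_eq_qmult: "L *v x = qmult (axis 3 1) x"
  by (simp add: vec_eq_iff forall_4 matrix_vector_mult_def sum_4 L_def qmult_def axis_def)

definition G0 :: "(real^4^4) set" where
  "G0 = {g. orthogonal_matrix g \<and> det g = 1 \<and> g ** J = J ** g \<and> g ** L = L ** g}"

definition mat_exp :: "real^'m^'m::finite \<Rightarrow> real^'m^'m" where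
  "mat_exp A = (\<Sum>k. (1 / fact k) *\<^sub>R (((**) A) ^^ k) (mat 1))"

text \<open>Inclusion \<open>\<real>\<^sup>4 \<subseteq> \<complex>\<^sup>4\<close> and complex linear extension of real matrices.\<close>

definition cvec :: "real^4 \<Rightarrow> complex^4" where
  "cvec x = (\<chi> k. complex_of_real (x $ k))"

definition cmat :: "real^4^4 \<Rightarrow> complex^4^4" where
  "cmat A = map_matrix complex_of_real A"


section \<open>The space of \<open>C\<^sup>2\<close> maps\<close>

abbreviation pd :: "complex \<Rightarrow> (complex \<Rightarrow> real^4) \<Rightarrow> complex \<Rightarrow> real^4" where
  "pd v f z \<equiv> frechet_derivative f (at z) v"

text \<open>
  The bounded \<open>C\<^sup>2\<close> maps \<open>\<complex> \<rightarrow> \<real>\<^sup>4\<close> with bounded derivatives up to second order.  For a lattice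
  \<open>\<Gamma>\<close>, its closed subspace of \<open>\<Gamma>\<close>-periodic maps is the Banach space of \<open>C\<^sup>2\<close> maps on the torus
  \<open>\<complex>/\<Gamma>\<close>, with the norm of uniform convergence of derivatives up to second order.
\<close>

definition jets :: "(complex \<Rightarrow> real^4) \<Rightarrow> (complex \<Rightarrow> real^4) list" where
  "jets f = [f, pd 1 f, pd \<i> f, pd 1 (pd 1 f), pd 1 (pd \<i> f), pd \<i> (pd \<i> f)]"

definition C2_bounded :: "(complex \<Rightarrow> real^4) \<Rightarrow> bool" where
  "C2_bounded f \<longleftrightarrow> Ck_on 2 UNIV f \<and> (\<forall>g\<in>set (jets f). bounded (range g))"

lemma Ck_on_const: "Ck_on k S (\<lambda>x. c)"
proof (induction k arbitrary: c)
  case (Suc k)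
  show ?case
    by (auto intro!: exI[of _ "\<lambda>x v. 0"] Suc)
qed auto

lemma Ck_on_add: "Ck_on k S f \<Longrightarrow> Ck_on k S g \<Longrightarrow> Ck_on k S (\<lambda>x. f x + g x)"
proof (induction k arbitrary: f g)
  case 0 then show ?case by (auto intro: continuous_on_add)
next
  case (Suc k)
  from Suc.prems obtain D E where
    "\<forall>x\<in>S. (f has_derivative D x) (at x within S)" "\<forall>v\<in>span S. Ck_on k S (\<lambda>x. D x v)"
    "\<forall>x\<in>S. (g has_derivative E x) (at x within S)" "\<forall>v\<in>span S. Ck_on k S (\<lambda>x. E x v)"
    by auto
  then show ?case
    by (auto intro!: exI[of _ "\<lambda>x v. D x v + E x v"] has_derivative_add Suc.IH)
qed

lemma Ck_on_scaleR: "Ck_on k S f \<Longrightarrow> Ck_on k S (\<lambda>x. c *\<^sub>R f x)"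
proof (induction k arbitrary: f)
  case 0 then show ?case by (auto intro: continuous_intros)
next
  case (Suc k)
  from Suc.prems obtain D where
    "\<forall>x\<in>S. (f has_derivative D x) (at x within S)" "\<forall>v\<in>span S. Ck_on k S (\<lambda>x. D x v)"
    by auto
  then show ?case
    by (auto intro!: exI[of _ "\<lambda>x v. c *\<^sub>R D x v"] has_derivative_scaleR_right Suc.IH)
qed

lemma Ck_on_Suc_UNIV:
  "Ck_on (Suc k) UNIV f \<longleftrightarrow>
     f differentiable_on UNIV \<and> (\<forall>v. Ck_on k UNIV (\<lambda>x. frechet_derivative f (at x) v))"
proof
  assume "Ck_on (Suc k) UNIV f"
  then obtain D where D: "\<And>x. (f has_derivative D x) (at x)" "\<And>v. Ck_on k UNIV (\<lambda>x. D x v)"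
    by auto
  have "frechet_derivative f (at x) = D x" for x
    using frechet_derivative_at[OF D(1)] by simp
  with D show "f differentiable_on UNIV \<and> (\<forall>v. Ck_on k UNIV (\<lambda>x. frechet_derivative f (at x) v))"
    by (auto simp: differentiable_on_def differentiable_def)
next
  assume "f differentiable_on UNIV \<and> (\<forall>v. Ck_on k UNIV (\<lambda>x. frechet_derivative f (at x) v))"
  then show "Ck_on (Suc k) UNIV f"
    by (auto intro!: exI[of _ "\<lambda>x. frechet_derivative f (at x)"]
             simp: differentiable_on_def frechet_derivative_works[symmetric])
qed

lemma Ck_on_UNIV_imp_continuous:
  assumes "Ck_on k UNIV f" shows "continuous_on UNIV f"
  using assms
proof (cases k)
  case (Suc m)
  then show ?thesis using assms
    by (metis Ck_on_Suc_UNIV differentiable_imp_continuous_on)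
qed auto

lemma pd_add:
  assumes "f differentiable_on UNIV" "g differentiable_on UNIV"
  shows "pd v (\<lambda>x. f x + g x) = (\<lambda>x. pd v f x + pd v g x)"
proof
  fix x
  have "((\<lambda>x. f x + g x) has_derivative (\<lambda>v. pd v f x + pd v g x)) (at x)"
    using assms
    by (auto intro!: has_derivative_add simp: differentiable_on_def frechet_derivative_works)
  from frechet_derivative_at[OF this] show "pd v (\<lambda>x. f x + g x) x = pd v f x + pd v g x"
    by (metis (no_types))
qed

lemma pd_scaleR:
  assumes "f differentiable_on UNIV"
  shows "pd v (\<lambda>x. c *\<^sub>R f x) = (\<lambda>x. c *\<^sub>R pd v f x)"
proof
  fix x
  have "((\<lambda>x. c *\<^sub>R f x) has_derivative (\<lambda>v. c *\<^sub>R pd v f x)) (at x)"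
    using assms
    by (auto intro!: has_derivative_scaleR_right simp: differentiable_on_def frechet_derivative_works)
  from frechet_derivative_at[OF this] show "pd v (\<lambda>x. c *\<^sub>R f x) x = c *\<^sub>R pd v f x"
    by (metis (no_types))
qed

lemma Ck_on_2D:
  assumes "Ck_on 2 UNIV f"
  shows "f differentiable_on UNIV" "pd v f differentiable_on UNIV"
    and "continuous_on UNIV f" "continuous_on UNIV (pd v f)" "continuous_on UNIV (pd u (pd v f))"
  using assms Ck_on_UNIV_imp_continuous[OF assms]
  by (auto simp: numeral_2_eq_2 Ck_on_Suc_UNIV simp del: Ck_on.simps(2)
      intro: differentiable_imp_continuous_on)

lemma jets_add:
  assumes "Ck_on 2 UNIV f" "Ck_on 2 UNIV g"
  shows "jets (\<lambda>x. f x + g x) = map2 (\<lambda>a b x. a x + b x) (jets f) (jets g)"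
  using assms by (simp add: jets_def pd_add Ck_on_2D)

lemma jets_scaleR:
  assumes "Ck_on 2 UNIV f"
  shows "jets (\<lambda>x. c *\<^sub>R f x) = map (\<lambda>a x. c *\<^sub>R a x) (jets f)"
  using assms by (simp add: jets_def pd_scaleR Ck_on_2D)

lemma bounded_range_add:
  fixes f g :: "'a \<Rightarrow> 'b::real_normed_vector"
  assumes "bounded (range f)" "bounded (range g)"
  shows "bounded (range (\<lambda>x. f x + g x))"
  using bounded_plus_comp[OF assms] .

lemma C2_bounded_add: "C2_bounded f \<Longrightarrow> C2_bounded g \<Longrightarrow> C2_bounded (\<lambda>x. f x + g x)"
  unfolding C2_bounded_def
  by (auto simp: jets_add Ck_on_add) (auto simp: jets_def intro!: bounded_range_add)

lemma C2_bounded_scaleR: "C2_bounded f \<Longrightarrow> C2_bounded (\<lambda>x. c *\<^sub>R f x)"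
  unfolding C2_bounded_def
  by (auto simp: jets_scaleR Ck_on_scaleR intro!: bounded_scaleR_comp)

lemma C2_bounded_0: "C2_bounded (\<lambda>x. 0)"
  unfolding C2_bounded_def jets_def by (auto simp: Ck_on_const image_constant_conv)

typedef c2map = "{f. C2_bounded f}"
  morphisms c2_apply Abs_c2map
  using C2_bounded_0 by blast

setup_lifting type_definition_c2map

instantiation c2map :: real_vector
begin
lift_definition zero_c2map :: c2map is "\<lambda>x. 0" by (rule C2_bounded_0)
lift_definition plus_c2map :: "c2map \<Rightarrow> c2map \<Rightarrow> c2map" is "\<lambda>f g x. f x + g x"
  by (rule C2_bounded_add)
lift_definition scaleR_c2map :: "real \<Rightarrow> c2map \<Rightarrow> c2map" is "\<lambda>c f x. c *\<^sub>R f x"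
  by (rule C2_bounded_scaleR)
definition uminus_c2map :: "c2map \<Rightarrow> c2map" where "uminus_c2map f = (-1) *\<^sub>R f"
definition minus_c2map :: "c2map \<Rightarrow> c2map \<Rightarrow> c2map" where "minus_c2map f g = f + (-1) *\<^sub>R g"
instance
proof
  fix f g h :: c2map and a b :: real
  show "f + g + h = f + (g + h)" by transfer (simp add: add.assoc)
  show "f + g = g + f" by transfer (simp add: add.commute)
  show "0 + f = f" by transfer simp
  show "- f + f = 0" unfolding uminus_c2map_def by transfer simp
  show "f - g = f + - g" by (simp only: uminus_c2map_def minus_c2map_def)
  show "a *\<^sub>R (f + g) = a *\<^sub>R f + a *\<^sub>R g" by transfer (simp add: scaleR_add_right)
  show "(a + b) *\<^sub>R f = a *\<^sub>R f + b *\<^sub>R f" by transfer (simp add: scaleR_add_left)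
  show "a *\<^sub>R b *\<^sub>R f = (a * b) *\<^sub>R f" by transfer simp
  show "1 *\<^sub>R f = f" by transfer simp
qed
end

definition jet_bc :: "nat \<Rightarrow> c2map \<Rightarrow> (complex \<Rightarrow>\<^sub>C (real^4))" where
  "jet_bc i f = Bcontfun (jets (c2_apply f) ! i)"

lemma jet_bc_apply:
  assumes "i < 6" shows "apply_bcontfun (jet_bc i f) = jets (c2_apply f) ! i"
proof -
  have f: "C2_bounded (c2_apply f)" using c2_apply by auto
  then have C: "Ck_on 2 UNIV (c2_apply f)" by (simp add: C2_bounded_def)
  have l: "length (jets (c2_apply f)) = 6" by (simp add: jets_def)
  have "\<forall>g\<in>set (jets (c2_apply f)). continuous_on UNIV g"
    unfolding jets_def by (auto intro: Ck_on_2D[OF C])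
  with f assms l have "jets (c2_apply f) ! i \<in> bcontfun"
    by (auto simp: bcontfun_def C2_bounded_def)
  then show ?thesis by (simp add: jet_bc_def Bcontfun_inverse)
qed

lemma Ck_on_2_c2_apply: "Ck_on 2 UNIV (c2_apply f)"
  using c2_apply[of f] by (simp add: C2_bounded_def)

lemma jet_bc_add: assumes "i < 6" shows "jet_bc i (f + g) = jet_bc i f + jet_bc i g"
proof (rule bcontfun_eqI)
  fix x
  have "length (jets h) = 6" for h by (simp add: jets_def)
  then show "apply_bcontfun (jet_bc i (f + g)) x = apply_bcontfun (jet_bc i f + jet_bc i g) x"
    using assms
    by (simp add: jet_bc_apply plus_bcontfun.rep_eq plus_c2map.rep_eq jets_add Ck_on_2_c2_apply)
qed

lemma jet_bc_scaleR: assumes "i < 6" shows "jet_bc i (c *\<^sub>R f) = c *\<^sub>R jet_bc i f"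
proof (rule bcontfun_eqI)
  fix x
  have "length (jets h) = 6" for h by (simp add: jets_def)
  then show "apply_bcontfun (jet_bc i (c *\<^sub>R f)) x = apply_bcontfun (c *\<^sub>R jet_bc i f) x"
    using assms
    by (simp add: jet_bc_apply scaleR_bcontfun.rep_eq scaleR_c2map.rep_eq jets_scaleR Ck_on_2_c2_apply)
qed

text \<open>The norm is the sum of the supremum norms of all derivatives of order at most two.\<close>

instantiation c2map :: real_normed_vector
begin
definition norm_c2map :: "c2map \<Rightarrow> real" where "norm_c2map f = (\<Sum>i<6. norm (jet_bc i f))"
definition dist_c2map :: "c2map \<Rightarrow> c2map \<Rightarrow> real" where "dist_c2map f g = norm (f - g)"
definition sgn_c2map :: "c2map \<Rightarrow> c2map" where "sgn_c2map f = inverse (norm f) *\<^sub>R f"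
definition uniformity_c2map :: "(c2map \<times> c2map) filter" where
  "uniformity_c2map = (INF e\<in>{0<..}. principal {(x, y). dist x y < e})"
definition open_c2map :: "c2map set \<Rightarrow> bool" where
  "open_c2map U = (\<forall>x\<in>U. \<forall>\<^sub>F (x', y) in uniformity. x' = x \<longrightarrow> y \<in> U)"
instance
proof
  fix f g :: c2map and c :: real
  show "(norm f = 0) = (f = 0)"
  proof
    assume "norm f = 0"
    then have "jet_bc 0 f = 0"
      by (simp add: norm_c2map_def sum_nonneg_eq_0_iff)
    moreover have "apply_bcontfun (jet_bc 0 f) = c2_apply f"
      by (simp add: jet_bc_apply jets_def)
    ultimately have "c2_apply f = c2_apply 0"
      by (simp add: zero_c2map.rep_eq zero_bcontfun.rep_eq fun_eq_iff)
    then show "f = 0" by (simp add: c2_apply_inject)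
  next
    assume "f = 0"
    then show "norm f = 0"
      using jet_bc_scaleR[of _ 0 f] by (simp add: norm_c2map_def)
  qed
  show "norm (f + g) \<le> norm f + norm g"
    unfolding norm_c2map_def sum.distrib[symmetric]
    by (intro sum_mono) (simp add: jet_bc_add norm_triangle_ineq)
  show "norm (c *\<^sub>R f) = \<bar>c\<bar> * norm f"
    unfolding norm_c2map_def sum_distrib_left
    by (intro sum.cong) (simp_all add: jet_bc_scaleR)
qed (rule dist_c2map_def sgn_c2map_def uniformity_c2map_def open_c2map_def)+
end


section \<open>Hamiltonian stationary Lagrangian tori\<close>

definition is_lattice :: "complex set \<Rightarrow> bool" where
  "is_lattice \<Gamma> \<longleftrightarrow>
     (\<exists>a b. a \<noteq> b \<and> independent {a, b} \<and> \<Gamma> = {of_int k * a + of_int l * b | k l. True})"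

definition dual_lattice :: "complex set \<Rightarrow> complex set" where
  "dual_lattice \<Gamma> = {\<gamma>. \<forall>z\<in>\<Gamma>. \<gamma> \<bullet> z \<in> \<int>}"

definition maslov_angle :: "complex \<Rightarrow> complex \<Rightarrow> real" where
  "maslov_angle \<beta>0 z = 2 * pi * (\<beta>0 \<bullet> z)"

definition dz :: "(complex \<Rightarrow> real^4) \<Rightarrow> complex \<Rightarrow> complex^4" where
  "dz f z = (1/2) *s (cvec (pd 1 f z) - \<i> *s cvec (pd \<i> f z))"

text \<open>Maps on \<open>\<complex>/\<Gamma>\<close> are \<open>\<Gamma>\<close>-periodic maps on \<open>\<complex>\<close>.\<close>

definition hsl_tori :: "complex set \<Rightarrow> complex \<Rightarrow> c2map set" where
  "hsl_tori \<Gamma> \<beta>0 = {F. \<exists>f. f = c2_apply F \<and> smooth_on UNIV f \<and>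
     (\<forall>z. \<forall>\<omega>\<in>\<Gamma>. f (z + \<omega>) = f z) \<and> (\<nexists>c. \<forall>z. f z = c) \<and> f 0 = 0 \<and>
     (\<forall>z. cmat (mat_exp (maslov_angle \<beta>0 z *\<^sub>R J)) *v (cmat L *v dz f z) = \<i> *s dz f z)}"

definition hsl_class :: "c2map \<Rightarrow> c2map set" where
  "hsl_class F = {G. \<exists>r>0. \<exists>g\<in>G0. \<forall>z. c2_apply G z = r *\<^sub>R (g *v c2_apply F z)}"

text \<open>
  The defining conditions of \<^term>\<open>hsl_tori \<Gamma> \<beta>0\<close> apart from non-constancy are linear, and
  non-constant means nonzero since \<open>f 0 = 0\<close>; thus \<^term>\<open>hsl_tori \<Gamma> \<beta>0\<close> is a (finite-dimensional)
  linear subspace of the Banach space without the origin.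
\<close>

definition moduli :: "complex set \<Rightarrow> complex \<Rightarrow> (c2map set, 'e::euclidean_space) manifold" where
  "moduli \<Gamma> \<beta>0 = quotient_manifold (hsl_tori \<Gamma> \<beta>0) hsl_class"


section \<open>The parametrisation\<close>

definition freqs :: "complex set \<Rightarrow> complex \<Rightarrow> complex set" where
  "freqs \<Gamma> \<beta>0 = {\<gamma>. \<gamma> - \<beta>0 / 2 \<in> dual_lattice \<Gamma> \<and> cmod \<gamma> = cmod \<beta>0 / 2 \<and>
                    \<gamma> \<noteq> \<beta>0 / 2 \<and> \<gamma> \<noteq> - (\<beta>0 / 2)}"

definition freq_poly :: "complex set \<Rightarrow> complex \<Rightarrow> complex poly" where
  "freq_poly \<Gamma> \<beta>0 = (\<Prod>\<gamma>\<in>freqs \<Gamma> \<beta>0. [:- (2 * \<gamma> / \<beta>0), 1:])"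

text \<open>\<open>\<complex>\<^sup>4\<close>-valued polynomials are vectors of polynomials.\<close>

definition peval :: "complex poly^4 \<Rightarrow> complex \<Rightarrow> complex^4" where
  "peval x t = (\<chi> k. poly (x $ k) t)"

text \<open>
  \<open>\<gamma>\<close> labels one half of the frequencies, the other half being their negatives; \<open>\<rho> j\<close> is the
  chosen square root of \<open>p(0) s\<^sub>j\<^sup>N\<^sup>+\<^sup>1\<close>.
\<close>

definition init_poly ::
  "complex set \<Rightarrow> complex \<Rightarrow> ('m \<Rightarrow> complex) \<Rightarrow> ('m \<Rightarrow> complex) \<Rightarrow> quat^'m::finite \<Rightarrow> complex poly^4" where
  "init_poly \<Gamma> \<beta>0 \<gamma> \<rho> w = (THE x.
     (\<forall>k. degree (x $ k) \<le> card (freqs \<Gamma> \<beta>0)) \<and> peval x 0 = 0 \<and>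
     (\<forall>j. peval x (2 * \<gamma> j / \<beta>0) = \<rho> j *s cvec (w $ j) \<and>
          peval x (- (2 * \<gamma> j / \<beta>0)) = (- \<i>) *s (cmat L *v peval x (2 * \<gamma> j / \<beta>0))))"

definition evolved_poly ::
  "complex set \<Rightarrow> complex \<Rightarrow> complex poly^4 \<Rightarrow> complex \<Rightarrow> complex poly^4" where
  "evolved_poly \<Gamma> \<beta>0 x z = (THE y.
     (\<forall>k. degree (y $ k) \<le> card (freqs \<Gamma> \<beta>0)) \<and> peval y 0 = 0 \<and>
     (\<forall>\<gamma>\<in>freqs \<Gamma> \<beta>0. peval y (2 * \<gamma> / \<beta>0) =
        cmat (mat_exp ((- 2 * pi * (\<gamma> \<bullet> z)) *\<^sub>R J)) *v peval x (2 * \<gamma> / \<beta>0)))"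

definition torus_formula ::
  "complex set \<Rightarrow> complex \<Rightarrow> ('m \<Rightarrow> complex) \<Rightarrow> ('m \<Rightarrow> complex) \<Rightarrow> quat^'m::finite \<Rightarrow> complex \<Rightarrow> complex^4" where
  "torus_formula \<Gamma> \<beta>0 \<gamma> \<rho> w z =
     (let x = init_poly \<Gamma> \<beta>0 \<gamma> \<rho> w
      in (1 / poly (freq_poly \<Gamma> \<beta>0) 1) *s
           (cmat (mat_exp ((maslov_angle \<beta>0 z / 2) *\<^sub>R J)) *v peval (evolved_poly \<Gamma> \<beta>0 x z) 1
            - peval (evolved_poly \<Gamma> \<beta>0 x 0) 1))"

end

theory Submission
  imports Defs
begin

text \<open>
  Write \<open>R(t) = e\<^sup>t\<^sup>J\<close>.  In real terms the equation of a Hamiltonian stationary torus is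
  \<open>f\<^sub>y = R(\<beta>) L f\<^sub>x\<close> (\<open>hsl_equation_iff\<close>), which is real linear in \<open>f\<close> and commutes with right
  multiplication by quaternions.  So the tori form a linear space without its origin, and the
  proof determines that space by Fourier series, with \<open>J\<close> as imaginary unit.

  Multiplication by \<open>R(\<beta>) L\<close> carries the frequency \<open>\<delta>\<close> to \<open>\<beta>0 - \<delta>\<close> because \<open>L\<close> anticommutes with \<open>J\<close>.
  The equation therefore couples only the coefficients at \<open>\<delta>\<close> and \<open>\<beta>0 - \<delta>\<close>, and it lets them be nonzero
  only if \<open>\<delta>\<close> and \<open>\<beta>0 - \<delta>\<close> are orthogonal (\<open>hsl_fourier_support\<close>), that is, if \<open>\<delta> = \<beta>0 / 2 - \<gamma>\<close> with
  \<open>\<bar>\<gamma>\<bar> = \<bar>\<beta>0\<bar> / 2\<close>.  For such a pair, the coefficient at \<open>\<beta>0 / 2 + \<gamma>\<close> is \<open>\<tau> L\<close> times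
  the one at \<open>\<beta>0 / 2 - \<gamma>\<close>, where \<open>\<tau>\<close> is real and, up to sign, the ratio of the lengths of the two
  frequencies (\<open>hsl_fourier_e\<close>).  Together with \<open>f 0 = 0\<close> and the completeness of the
  trigonometric system (\<open>fourier_eq_0_imp\<close>, from Stone--Weierstrass), this shows that
  one quaternion for each pair \<open>\<plusminus>\<gamma>\<close> can be prescribed freely and determines \<open>f\<close>
  (\<open>hsl_torus_in_hsl_tori\<close>, \<open>hsl_torus_hsl_coeffs\<close>).

  The formula of the theorem is this parametrisation in other coordinates.  Lagrange interpolation at
  \<open>0\<close> and the \<open>s\<^sub>j\<close>, evaluated at \<open>\<lambda> = 1\<close>, gives a sum over the frequencies
  in which \<open>w\<^sub>j\<close> carries a factor \<open>\<kappa> j\<close>; the square roots \<open>\<rho> j\<close> are chosen such that \<open>\<kappa> j\<close> is real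
  (\<open>weight_real\<close>), and it is nonzero (\<open>torus_formula_hsl_torus\<close>).

  So the assignment is the restriction of an injective bounded linear map, and its
  inverse is the restriction of the bounded linear map that takes the Fourier coefficients.
  The group generated by dilations and base point preserving symplectic isometries is that of
  right multiplications by nonzero quaternions
  (\<open>hsl_class_eq\<close>), so the linear isomorphism matches the fibres of the two projections.  Such an
  isomorphism carries charts to charts (\<open>chart_\<Psi>\<close>), and what is left is to exhibit
  charts of \<open>\<bbbH>\<bbbP>\<^sup>n\<close>, the affine ones (\<open>affine_chart\<close>).
\<close>


section \<open>Calculus of \<open>C\<^sup>k\<close> maps\<close>

lemma Ck_on_cong:
  assumes "\<And>x. x \<in> S \<Longrightarrow> f x = g x" and "Ck_on k S f"
  shows "Ck_on k S g"
proof (cases k)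
  case 0
  with assms show ?thesis by (metis Ck_on.simps(1) continuous_on_cong)
next
  case (Suc l)
  with assms(2) obtain D where
    "\<forall>x\<in>S. (f has_derivative D x) (at x within S)" "\<forall>v\<in>span S. Ck_on l S (\<lambda>x. D x v)"
    by auto
  moreover from this have "(g has_derivative D x) (at x within S)" if "x \<in> S" for x
    using assms(1) by (intro has_derivative_transform[OF that, of g f "D x"]) (use that in auto)
  ultimately show ?thesis
    unfolding Suc by auto
qed

lemma Ck_on_SucD: "Ck_on (Suc k) S f \<Longrightarrow> Ck_on k S f"
proof (induction k arbitrary: f)
  case 0
  then show ?case
    by (auto simp: continuous_on_eq_continuous_within intro: has_derivative_continuous)
next
  case (Suc k)
  from Suc.prems obtain D where
    "\<forall>x\<in>S. (f has_derivative D x) (at x within S)" "\<forall>v\<in>span S. Ck_on (Suc k) S (\<lambda>x. D x v)"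
    by (auto simp del: Ck_on.simps(2) simp: Ck_on.simps(2)[of "Suc _"])
  with Suc.IH show ?case by (auto simp: Ck_on.simps(2)[of k] simp del: Ck_on.simps)
qed

lemma Ck_on_bounded_linear: "bounded_linear f \<Longrightarrow> Ck_on k S f"
  by (cases k) (auto intro!: exI[of _ "\<lambda>x. f"] Ck_on_const bounded_linear.linear linear_continuous_on
      bounded_linear_imp_has_derivative)

lemma smooth_on_id:
  assumes "\<And>x. x \<in> S \<Longrightarrow> f x = x"
  shows "smooth_on S f"
  unfolding smooth_on_def
  by (intro allI Ck_on_cong[OF assms[symmetric]] Ck_on_bounded_linear bounded_linear_ident)

lemma Ck_on_bilinear:
  assumes "bounded_bilinear B"
  shows "Ck_on k S f \<Longrightarrow> Ck_on k S g \<Longrightarrow> Ck_on k S (\<lambda>x. B (f x) (g x))"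
proof (induction k arbitrary: f g)
  case 0
  then show ?case by (simp add: bounded_bilinear.continuous_on[OF assms])
next
  case (Suc k)
  note f = Ck_on_SucD[OF Suc.prems(1)] and g = Ck_on_SucD[OF Suc.prems(2)]
  from Suc.prems obtain D E where
    "\<forall>x\<in>S. (f has_derivative D x) (at x within S)" "\<forall>v\<in>span S. Ck_on k S (\<lambda>x. D x v)"
    "\<forall>x\<in>S. (g has_derivative E x) (at x within S)" "\<forall>v\<in>span S. Ck_on k S (\<lambda>x. E x v)"
    by auto
  then show ?case
    by (auto intro!: exI[of _ "\<lambda>x v. B (f x) (E x v) + B (D x v) (g x)"] Ck_on_add Suc.IH f g
        bounded_bilinear.FDERIV[OF assms])
qed

lemma Ck_on_inverse:
  fixes f :: "'a::real_normed_vector \<Rightarrow> real"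
  assumes "\<And>x. x \<in> S \<Longrightarrow> f x \<noteq> 0"
  shows "Ck_on k S f \<Longrightarrow> Ck_on k S (\<lambda>x. inverse (f x))"
proof (induction k)
  case 0
  then show ?case using assms by (simp add: continuous_on_inverse)
next
  case (Suc k)
  note i = Suc.IH[OF Ck_on_SucD[OF Suc.prems]]
  from Suc.prems obtain D where
    "\<forall>x\<in>S. (f has_derivative D x) (at x within S)" "\<forall>v\<in>span S. Ck_on k S (\<lambda>x. D x v)"
    by auto
  then show ?case
    using assms Ck_on_scaleR[where c="-1"]
    by (auto intro!: exI[of _ "\<lambda>x v. - (inverse (f x) * D x v * inverse (f x))"] i
        Ck_on_bilinear[OF bounded_bilinear_mult] Deriv.has_derivative_inverse
        Ck_on_scaleR[where c="-1", simplified])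
qed

lemma Ck_on_compose_linear:
  assumes A: "bounded_linear A" and "A ` S \<subseteq> T" and "Ck_on k T f"
  shows "Ck_on k S (\<lambda>x. f (A x))"
  using assms(3)
proof (induction k arbitrary: f)
  case 0
  then show ?case
    using assms(2) by (auto intro: continuous_on_compose2 linear_continuous_on[OF A])
next
  case (Suc k)
  have span: "A v \<in> span T" if "v \<in> span S" for v
  proof -
    have "A ` span S = span (A ` S)"
      using linear_span_image[OF bounded_linear.linear[OF A]] by simp
    then show ?thesis using that span_mono[OF assms(2)] by blast
  qed
  from Suc.prems obtain D where D:
    "\<forall>x\<in>T. (f has_derivative D x) (at x within T)" "\<forall>v\<in>span T. Ck_on k T (\<lambda>x. D x v)"
    by auto
  have "((\<lambda>x. f (A x)) has_derivative (\<lambda>v. D (A x) (A v))) (at x within S)" if "x \<in> S" for x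
  proof -
    have "(f has_derivative D (A x)) (at (A x) within A ` S)"
      using D(1) assms(2) that by (auto intro: has_derivative_subset)
    from has_derivative_in_compose[OF bounded_linear_imp_has_derivative[OF A] this]
    show ?thesis .
  qed
  moreover have "Ck_on k S (\<lambda>x. D (A x) (A v))" if "v \<in> span S" for v
    using Suc.IH[of "\<lambda>x. D x (A v)"] D(2) span[OF that] by auto
  ultimately show ?case by (auto intro!: exI[of _ "\<lambda>x v. D (A x) (A v)"])
qed


section \<open>Quotient manifolds under linear isomorphisms\<close>

text \<open>
  \<open>T\<close> is a linear isomorphism from \<open>S1\<close> onto \<open>S2\<close> which matches the fibres of the projections, so
  it induces \<open>\<Phi>\<close> on the quotients.  The inverse of \<open>T\<close> on \<open>S2\<close> is given as a bounded linear map on the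
  whole space, since \<open>S2\<close> may lie in a space of infinite dimension.
\<close>

locale quotient_iso =
  fixes T :: "'a::real_normed_vector \<Rightarrow> 'b::real_normed_vector" and W :: "'b \<Rightarrow> 'a"
    and S1 :: "'a set" and S2 :: "'b set" and \<pi>1 :: "'a \<Rightarrow> 'p" and \<pi>2 :: "'b \<Rightarrow> 'q"
    and \<Phi> :: "'p \<Rightarrow> 'q"
  assumes T: "bounded_linear T" and W: "bounded_linear W"
    and WT: "\<And>x. x \<in> S1 \<Longrightarrow> W (T x) = x" and TS: "T ` S1 = S2"
    and \<pi>: "\<And>x y. x \<in> S1 \<Longrightarrow> y \<in> S1 \<Longrightarrow> \<pi>2 (T x) = \<pi>2 (T y) \<longleftrightarrow> \<pi>1 x = \<pi>1 y"
    and \<Phi>: "\<And>x. x \<in> S1 \<Longrightarrow> \<Phi> (\<pi>1 x) = \<pi>2 (T x)"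
begin

definition \<Psi> :: "'q \<Rightarrow> 'p" where "\<Psi> = inv_into (\<pi>1 ` S1) \<Phi>"

lemma inj_on_\<Phi>: "inj_on \<Phi> (\<pi>1 ` S1)"
  by (auto simp: inj_on_def \<Phi> \<pi>)

lemma \<Phi>_image: "\<Phi> ` \<pi>1 ` S1 = \<pi>2 ` S2"
  unfolding TS[symmetric] by (force simp: \<Phi>)

lemma \<Psi>_\<Phi>: "p \<in> \<pi>1 ` S1 \<Longrightarrow> \<Psi> (\<Phi> p) = p"
  unfolding \<Psi>_def by (rule inv_into_f_f[OF inj_on_\<Phi>])

lemma W_S2: "y \<in> S2 \<Longrightarrow> W y \<in> S1" "y \<in> S2 \<Longrightarrow> T (W y) = y"
  using WT TS by auto

lemma \<Psi>_\<pi>2: "y \<in> S2 \<Longrightarrow> \<Psi> (\<pi>2 y) = \<pi>1 (W y)"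
  using \<Psi>_\<Phi>[of "\<pi>1 (W y)"] \<Phi>[of "W y"] W_S2[of y] by simp

lemma preimage_image_\<Phi>:
  assumes "U \<subseteq> \<pi>1 ` S1"
  shows "{y \<in> S2. \<pi>2 y \<in> \<Phi> ` U} = S2 \<inter> W -` {x \<in> S1. \<pi>1 x \<in> U}"
    and "{x \<in> S1. \<pi>1 x \<in> U} = S1 \<inter> T -` {y \<in> S2. \<pi>2 y \<in> \<Phi> ` U}"
proof -
  have *: "\<pi>2 (T x) \<in> \<Phi> ` U \<longleftrightarrow> \<pi>1 x \<in> U" if "x \<in> S1" for x
    using that assms inj_on_\<Phi> \<Phi>[OF that, symmetric] by (simp add: inj_on_image_mem_iff)
  show "{y \<in> S2. \<pi>2 y \<in> \<Phi> ` U} = S2 \<inter> W -` {x \<in> S1. \<pi>1 x \<in> U}"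
  proof (rule set_eqI)
    fix y
    show "y \<in> {y \<in> S2. \<pi>2 y \<in> \<Phi> ` U} \<longleftrightarrow> y \<in> S2 \<inter> W -` {x \<in> S1. \<pi>1 x \<in> U}"
      using *[of "W y"] W_S2[of y] by (cases "y \<in> S2") simp_all
  qed
  show "{x \<in> S1. \<pi>1 x \<in> U} = S1 \<inter> T -` {y \<in> S2. \<pi>2 y \<in> \<Phi> ` U}"
    using * TS by (simp add: set_eq_iff) blast
qed

text \<open>
  The preimages of \<open>U\<close> in \<open>S1\<close> and of \<open>\<Phi> ` U\<close> in \<open>S2\<close> correspond under the homeomorphism \<open>T\<close>.
\<close>

lemma openin_image_\<Phi>:
  assumes "U \<subseteq> \<pi>1 ` S1"
  shows "openin (quotient_topology S2 \<pi>2) (\<Phi> ` U) \<longleftrightarrow> openin (quotient_topology S1 \<pi>1) U"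
proof -
  have cT: "continuous_on S1 T" and cW: "continuous_on S2 W"
    using T W by (auto intro: linear_continuous_on)
  have "openin (top_of_set S2) {y \<in> S2. \<pi>2 y \<in> \<Phi> ` U} \<longleftrightarrow> openin (top_of_set S1) {x \<in> S1. \<pi>1 x \<in> U}"
  proof
    assume "openin (top_of_set S2) {y \<in> S2. \<pi>2 y \<in> \<Phi> ` U}"
    then show "openin (top_of_set S1) {x \<in> S1. \<pi>1 x \<in> U}"
      unfolding preimage_image_\<Phi>(2)[OF assms]
      by (rule continuous_openin_preimage[OF cT, rotated]) (use TS in auto)
  next
    assume "openin (top_of_set S1) {x \<in> S1. \<pi>1 x \<in> U}"
    then show "openin (top_of_set S2) {y \<in> S2. \<pi>2 y \<in> \<Phi> ` U}"
      unfolding preimage_image_\<Phi>(1)[OF assms]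
      by (rule continuous_openin_preimage[OF cW, rotated]) (use W_S2 in auto)
  qed
  moreover have "\<Phi> ` U \<subseteq> \<pi>2 ` S2" using assms \<Phi>_image by blast
  ultimately show ?thesis using assms by (simp add: openin_quotient_topology)
qed

lemma homeomorphic_map_\<Phi>: "homeomorphic_map (quotient_topology S1 \<pi>1) (quotient_topology S2 \<pi>2) \<Phi>"
proof (rule bijective_open_imp_homeomorphic_map)
  let ?Q1 = "quotient_topology S1 \<pi>1" and ?Q2 = "quotient_topology S2 \<pi>2"
  show "\<Phi> ` topspace ?Q1 = topspace ?Q2" by (simp add: \<Phi>_image)
  show "inj_on \<Phi> (topspace ?Q1)" by (simp add: inj_on_\<Phi>)
  show "open_map ?Q1 ?Q2 \<Phi>"
    unfolding open_map_def using openin_image_\<Phi> openin_subset[of ?Q1] by simp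
  show "continuous_map ?Q1 ?Q2 \<Phi>"
    unfolding continuous_map_def
  proof (intro conjI allI impI)
    show "\<Phi> \<in> topspace ?Q1 \<rightarrow> topspace ?Q2" using \<Phi>_image by auto
    fix V assume V: "openin ?Q2 V"
    let ?U = "{p \<in> topspace ?Q1. \<Phi> p \<in> V}"
    have "\<Phi> ` ?U = V" using openin_subset[OF V] \<Phi>_image by force
    then show "openin ?Q1 ?U" using V openin_image_\<Phi>[of ?U] by simp
  qed
qed

lemma span_S1: "W ` span S2 = span S1"
proof -
  have "W ` S2 = S1" using TS WT by force
  then show ?thesis
    using linear_span_image[OF bounded_linear.linear[OF W]] by metis
qed

text \<open>
  A chart is carried along by \<open>\<Psi>\<close>: in the coordinates \<open>\<phi>\<close> and \<open>\<phi> \<circ> \<Psi>\<close> the projection \<open>\<pi>2\<close> is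
  \<open>\<pi>1\<close> preceded by the linear map \<open>W\<close>, so it is again a smooth submersion.
\<close>

lemma chart_\<Psi>:
  assumes "(U, \<phi>) \<in> quotient_charts S1 \<pi>1"
  shows "(\<Phi> ` U, \<phi> \<circ> \<Psi>) \<in> quotient_charts S2 \<pi>2"
proof -
  let ?Q1 = "quotient_topology S1 \<pi>1" and ?Q2 = "quotient_topology S2 \<pi>2"
  let ?P1 = "{x \<in> S1. \<pi>1 x \<in> U}" and ?P2 = "{y \<in> S2. \<pi>2 y \<in> \<Phi> ` U}"
  from assms obtain E where U: "openin ?Q1 U" and E: "subspace E" "openin (top_of_set E) (\<phi> ` U)"
    and hom: "homeomorphic_map (subtopology ?Q1 U) (top_of_set (\<phi> ` U)) \<phi>"
    and smooth: "smooth_on ?P1 (\<phi> \<circ> \<pi>1)"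
    and subm: "\<And>x. x \<in> S1 \<Longrightarrow> \<pi>1 x \<in> U \<Longrightarrow>
      \<exists>D. ((\<phi> \<circ> \<pi>1) has_derivative D) (at x within ?P1) \<and> D ` span S1 = E"
    unfolding quotient_charts_def by blast
  have U_sub: "U \<subseteq> \<pi>1 ` S1" using openin_subset[OF U] by simp
  have image: "(\<phi> \<circ> \<Psi>) ` \<Phi> ` U = \<phi> ` U" using U_sub \<Psi>_\<Phi> by (force simp: image_iff)
  have P2: "W ` ?P2 \<subseteq> ?P1" unfolding preimage_image_\<Phi>(1)[OF U_sub] by auto
  have eq: "(\<phi> \<circ> \<pi>1) (W y) = (\<phi> \<circ> \<Psi> \<circ> \<pi>2) y" if "y \<in> ?P2" for y
    using that \<Psi>_\<pi>2 by simp
  have "homeomorphic_map (subtopology ?Q1 U) (subtopology ?Q2 (\<Phi> ` U)) \<Phi>"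
    using homeomorphic_map_\<Phi> by (rule homeomorphic_map_subtopologies) (use U_sub \<Phi>_image in auto)
  then have "homeomorphic_map (subtopology ?Q2 (\<Phi> ` U)) (subtopology ?Q1 U) \<Psi>"
    unfolding homeomorphic_map_maps
  proof safe
    fix g assume g: "homeomorphic_maps (subtopology ?Q1 U) (subtopology ?Q2 (\<Phi> ` U)) \<Phi> g"
    have "g y = \<Psi> y" if y: "y \<in> topspace (subtopology ?Q2 (\<Phi> ` U))" for y
    proof -
      from y obtain p where p: "p \<in> U" "y = \<Phi> p" by auto
      with g U_sub have "g (\<Phi> p) = p" by (auto simp: homeomorphic_maps_def)
      then show ?thesis using p U_sub \<Psi>_\<Phi> by auto
    qed
    then have "homeomorphic_maps (subtopology ?Q1 U) (subtopology ?Q2 (\<Phi> ` U)) \<Phi> \<Psi>"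
      by (intro homeomorphic_maps_eq[OF g]) simp_all
    then have "homeomorphic_maps (subtopology ?Q2 (\<Phi> ` U)) (subtopology ?Q1 U) \<Psi> \<Phi>"
      by (subst homeomorphic_maps_sym)
    then show "\<exists>g. homeomorphic_maps (subtopology ?Q2 (\<Phi> ` U)) (subtopology ?Q1 U) \<Psi> g" by blast
  qed
  then have "homeomorphic_map (subtopology ?Q2 (\<Phi> ` U)) (top_of_set ((\<phi> \<circ> \<Psi>) ` \<Phi> ` U)) (\<phi> \<circ> \<Psi>)"
    unfolding image using hom by (rule homeomorphic_map_compose)
  moreover have "smooth_on ?P2 (\<phi> \<circ> \<Psi> \<circ> \<pi>2)"
    unfolding smooth_on_def
  proof
    fix k
    have "Ck_on k ?P1 (\<phi> \<circ> \<pi>1)" using smooth by (simp add: smooth_on_def)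
    from Ck_on_compose_linear[OF W P2 this] show "Ck_on k ?P2 (\<phi> \<circ> \<Psi> \<circ> \<pi>2)"
      by (rule Ck_on_cong[rotated]) (rule eq)
  qed
  moreover have "\<exists>D. ((\<phi> \<circ> \<Psi> \<circ> \<pi>2) has_derivative D) (at y within ?P2) \<and> D ` span S2 = E"
    if y: "y \<in> S2" "\<pi>2 y \<in> \<Phi> ` U" for y
  proof -
    have "W y \<in> ?P1" using P2 y by auto
    then obtain D where D: "((\<phi> \<circ> \<pi>1) has_derivative D) (at (W y) within ?P1)" "D ` span S1 = E"
      using subm by blast
    have "((\<phi> \<circ> \<pi>1) has_derivative D) (at (W y) within W ` ?P2)"
      using D(1) P2 by (rule has_derivative_subset)
    from has_derivative_in_compose[OF bounded_linear_imp_has_derivative[OF W] this]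
    have "((\<lambda>y. (\<phi> \<circ> \<pi>1) (W y)) has_derivative (\<lambda>v. D (W v))) (at y within ?P2)" .
    then have "((\<phi> \<circ> \<Psi> \<circ> \<pi>2) has_derivative (\<lambda>v. D (W v))) (at y within ?P2)"
      by (rule has_derivative_transform[rotated 2]) (use y eq in auto)
    moreover have "(\<lambda>v. D (W v)) ` span S2 = E"
      using D(2) span_S1 by (metis image_image)
    ultimately show ?thesis by blast
  qed
  moreover have "openin ?Q2 (\<Phi> ` U)" using openin_image_\<Phi>[OF U_sub] U by simp
  ultimately show ?thesis
    unfolding quotient_charts_def using E image by auto
qed

text \<open>
  Read in a chart \<open>\<phi>\<close> and its transport \<open>\<phi> \<circ> \<Psi>\<close>, both \<open>\<Phi>\<close> and its inverse are the identity.
\<close>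

lemma diffeomorphism_\<Phi>:
  assumes cover: "\<And>x. x \<in> S1 \<Longrightarrow>
    \<exists>U \<phi>. \<pi>1 x \<in> U \<and> (U, \<phi> :: 'p \<Rightarrow> 'e::euclidean_space) \<in> quotient_charts S1 \<pi>1"
  shows "diffeomorphism (quotient_manifold S1 \<pi>1 :: ('p, 'e) manifold)
    (quotient_manifold S2 \<pi>2 :: ('q, 'e) manifold) \<Phi>"
proof -
  have chart: "\<Phi> ` U \<subseteq> \<pi>2 ` S2 \<and> \<Psi> ` \<Phi> ` U = U \<and>
      smooth_on (\<phi> ` U) ((\<phi> \<circ> \<Psi>) \<circ> \<Phi> \<circ> inv_into U \<phi>) \<and>
      smooth_on ((\<phi> \<circ> \<Psi>) ` \<Phi> ` U) (\<phi> \<circ> \<Psi> \<circ> inv_into (\<Phi> ` U) (\<phi> \<circ> \<Psi>))"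
    if "(U, \<phi> :: 'p \<Rightarrow> 'e) \<in> quotient_charts S1 \<pi>1" for U \<phi>
  proof -
    have "openin (quotient_topology S1 \<pi>1) U"
      using that unfolding quotient_charts_def by blast
    from openin_subset[OF this] have U: "U \<subseteq> \<pi>1 ` S1" by simp
    have "smooth_on (\<phi> ` U) ((\<phi> \<circ> \<Psi>) \<circ> \<Phi> \<circ> inv_into U \<phi>)"
    proof (rule smooth_on_id)
      fix x assume x: "x \<in> \<phi> ` U"
      show "((\<phi> \<circ> \<Psi>) \<circ> \<Phi> \<circ> inv_into U \<phi>) x = x"
        using \<Psi>_\<Phi>[of "inv_into U \<phi> x"] inv_into_into[OF x] U f_inv_into_f[OF x] by auto
    qed
    moreover have "smooth_on ((\<phi> \<circ> \<Psi>) ` \<Phi> ` U) (\<phi> \<circ> \<Psi> \<circ> inv_into (\<Phi> ` U) (\<phi> \<circ> \<Psi>))"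
    proof (rule smooth_on_id)
      fix x assume x: "x \<in> (\<phi> \<circ> \<Psi>) ` \<Phi> ` U"
      show "(\<phi> \<circ> \<Psi> \<circ> inv_into (\<Phi> ` U) (\<phi> \<circ> \<Psi>)) x = x"
        using f_inv_into_f[OF x] by simp
    qed
    moreover have "\<Psi> ` \<Phi> ` U = U" using U \<Psi>_\<Phi> by (force simp: image_iff)
    moreover have "\<Phi> ` U \<subseteq> \<pi>2 ` S2" using U \<Phi>_image by blast
    ultimately show ?thesis by simp
  qed
  have "smooth_map (quotient_manifold S1 \<pi>1 :: ('p, 'e) manifold)
      (quotient_manifold S2 \<pi>2 :: ('q, 'e) manifold) \<Phi>"
    unfolding smooth_map_def
  proof (intro ballI conjI)
    fix p assume "p \<in> topspace (fst (quotient_manifold S1 \<pi>1 :: ('p, 'e) manifold))"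
    then have p: "p \<in> \<pi>1 ` S1" by (simp add: quotient_manifold_def)
    then show "\<Phi> p \<in> topspace (fst (quotient_manifold S2 \<pi>2 :: ('q, 'e) manifold))"
      using \<Phi>_image by (auto simp: quotient_manifold_def)
    obtain U and \<phi> :: "'p \<Rightarrow> 'e" where U: "p \<in> U" "(U, \<phi>) \<in> quotient_charts S1 \<pi>1"
      using p cover by blast
    show "\<exists>(U, \<phi>)\<in>snd (quotient_manifold S1 \<pi>1 :: ('p, 'e) manifold).
        \<exists>(V, \<psi>)\<in>snd (quotient_manifold S2 \<pi>2 :: ('q, 'e) manifold).
          p \<in> U \<and> \<Phi> ` U \<subseteq> V \<and> smooth_on (\<phi> ` U) (\<psi> \<circ> \<Phi> \<circ> inv_into U \<phi>)"
      unfolding quotient_manifold_def snd_conv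
      by (intro bexI[OF _ U(2)] bexI[OF _ chart_\<Psi>[OF U(2)]] case_prodI)
        (use U(1) chart[OF U(2)] in auto)
  qed
  moreover have "smooth_map (quotient_manifold S2 \<pi>2 :: ('q, 'e) manifold)
      (quotient_manifold S1 \<pi>1 :: ('p, 'e) manifold) \<Psi>"
    unfolding smooth_map_def
  proof (intro ballI conjI)
    fix q assume "q \<in> topspace (fst (quotient_manifold S2 \<pi>2 :: ('q, 'e) manifold))"
    then have "q \<in> \<pi>2 ` S2" by (simp add: quotient_manifold_def)
    then obtain p where p: "p \<in> \<pi>1 ` S1" "q = \<Phi> p" using \<Phi>_image by blast
    then show "\<Psi> q \<in> topspace (fst (quotient_manifold S1 \<pi>1 :: ('p, 'e) manifold))"
      using \<Psi>_\<Phi> by (auto simp: quotient_manifold_def)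
    obtain U and \<phi> :: "'p \<Rightarrow> 'e" where U: "p \<in> U" "(U, \<phi>) \<in> quotient_charts S1 \<pi>1"
      using p cover by blast
    show "\<exists>(V, \<psi>)\<in>snd (quotient_manifold S2 \<pi>2 :: ('q, 'e) manifold).
        \<exists>(U, \<phi>)\<in>snd (quotient_manifold S1 \<pi>1 :: ('p, 'e) manifold).
          q \<in> V \<and> \<Psi> ` V \<subseteq> U \<and> smooth_on (\<psi> ` V) (\<phi> \<circ> \<Psi> \<circ> inv_into V \<psi>)"
      unfolding quotient_manifold_def snd_conv
      by (intro bexI[OF _ U(2)] bexI[OF _ chart_\<Psi>[OF U(2)]] case_prodI)
        (use p U(1) chart[OF U(2)] in auto)
  qed
  moreover have "bij_betw \<Phi> (\<pi>1 ` S1) (\<pi>2 ` S2)"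
    by (simp add: bij_betw_def inj_on_\<Phi> \<Phi>_image)
  ultimately show ?thesis
    unfolding diffeomorphism_def \<Psi>_def by (simp add: quotient_manifold_def)
qed

end


section \<open>Quaternionic projective space\<close>

definition qcnj :: "quat \<Rightarrow> quat" where
  "qcnj a = vector [a$1, - (a$2), - (a$3), - (a$4)]"

abbreviation q1 :: quat where "q1 \<equiv> axis 1 1"

lemma norm_sq_quat: "a \<bullet> a = (a$1)\<^sup>2 + (a$2)\<^sup>2 + (a$3)\<^sup>2 + (a$4)\<^sup>2" for a :: quat
  by (simp add: inner_vec_def sum_4 power2_eq_square)

lemma qmult_assoc: "qmult (qmult a b) c = qmult a (qmult b c)"
  by (simp add: vec_eq_iff forall_4 qmult_def algebra_simps)

lemma qmult_1 [simp]: "qmult q1 a = a" "qmult a q1 = a"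
  by (simp_all add: vec_eq_iff forall_4 qmult_def axis_def)

lemma qmult_scaleR [simp]:
  "qmult (r *\<^sub>R a) b = r *\<^sub>R qmult a b" "qmult a (r *\<^sub>R b) = r *\<^sub>R qmult a b"
  by (simp_all add: vec_eq_iff forall_4 qmult_def algebra_simps)

lemma qmult_0 [simp]: "qmult 0 a = 0" "qmult a 0 = 0"
  by (simp_all add: vec_eq_iff forall_4 qmult_def)

lemma qmult_qcnj: "qmult a (qcnj a) = (a \<bullet> a) *\<^sub>R q1" "qmult (qcnj a) a = (a \<bullet> a) *\<^sub>R q1"
  by (simp_all add: vec_eq_iff forall_4 qmult_def qcnj_def axis_def norm_sq_quat
      power2_eq_square algebra_simps)

lemma bilinear_qmult: "bilinear qmult"
  unfolding bilinear_def
  by (auto intro!: linearI simp: vec_eq_iff forall_4 qmult_def algebra_simps)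

lemma linear_qcnj: "linear qcnj"
  by (auto intro!: linearI simp: vec_eq_iff forall_4 qcnj_def algebra_simps)

lemma qmult_cancel_right: "q \<noteq> 0 \<Longrightarrow> qmult a q = qmult b q \<longleftrightarrow> a = b"
proof
  assume q: "q \<noteq> 0" and "qmult a q = qmult b q"
  then have "qmult (qmult a q) (qcnj q) = qmult (qmult b q) (qcnj q)" by simp
  then show "a = b" using q by (simp add: qmult_assoc qmult_qcnj)
qed simp

lemma qmult_eq_0_iff [simp]: "qmult a q = 0 \<longleftrightarrow> a = 0 \<or> q = 0"
  using qmult_cancel_right[of q a 0] by auto

definition qinv :: "quat \<Rightarrow> quat" where "qinv a = inverse (a \<bullet> a) *\<^sub>R qcnj a"

lemma qmult_qinv: "a \<noteq> 0 \<Longrightarrow> qmult a (qinv a) = q1" "a \<noteq> 0 \<Longrightarrow> qmult (qinv a) a = q1"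
  by (simp_all add: qinv_def qmult_qcnj)

lemma qinv_nonzero: "a \<noteq> 0 \<Longrightarrow> qinv a \<noteq> 0"
  using qmult_qinv(1)[of a] by (auto simp: axis_eq_0_iff)

lemma qinv_qmult: "a \<noteq> 0 \<Longrightarrow> b \<noteq> 0 \<Longrightarrow> qinv (qmult a b) = qmult (qinv b) (qinv a)"
proof -
  assume ab: "a \<noteq> 0" "b \<noteq> 0"
  let ?c = "qmult a b"
  have c: "?c \<noteq> 0" using ab by simp
  have "qmult (qmult (qinv b) (qinv a)) ?c = qmult (qinv b) (qmult (qmult (qinv a) a) b)"
    by (simp only: qmult_assoc)
  also have "\<dots> = qmult (qinv ?c) ?c"
    using ab c by (simp add: qmult_qinv)
  finally show ?thesis using c by (simp add: qmult_cancel_right)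
qed

definition rmult :: "quat^'m::finite \<Rightarrow> quat \<Rightarrow> quat^'m" where
  "rmult w q = (\<chi> j. qmult (w $ j) q)"

lemma rmult_nth [simp]: "rmult w q $ j = qmult (w $ j) q"
  by (simp add: rmult_def)

lemma hp_class_eq: "hp_class w = {rmult w q | q. q \<noteq> 0}"
  by (simp add: hp_class_def rmult_def)

lemma hp_class_eq_iff: "hp_class w = hp_class w' \<longleftrightarrow> (\<exists>q. q \<noteq> 0 \<and> w' = rmult w q)"
proof
  assume "hp_class w = hp_class w'"
  moreover have "w' \<in> hp_class w'"
    unfolding hp_class_eq by (auto intro!: exI[of _ q1] simp: vec_eq_iff[of w'] axis_eq_0_iff)
  ultimately show "\<exists>q. q \<noteq> 0 \<and> w' = rmult w q" by (auto simp: hp_class_eq)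
next
  assume "\<exists>q. q \<noteq> 0 \<and> w' = rmult w q"
  then obtain q where q: "q \<noteq> 0" "w' = rmult w q" by blast
  have "rmult w p = rmult w' (qmult (qinv q) p)" for p
    unfolding q(2) by (simp add: vec_eq_iff[of "rmult w p"] qmult_assoc[symmetric]
        qmult_assoc[of _ q "qinv q"] qmult_qinv[OF q(1)])
  moreover have "rmult w' p = rmult w (qmult q p)" for p
    unfolding q(2) by (simp add: vec_eq_iff[of "rmult _ p"] qmult_assoc)
  ultimately show "hp_class w = hp_class w'"
    unfolding hp_class_eq using q(1) qinv_nonzero[OF q(1)] by (auto; metis qmult_eq_0_iff)
qed

lemma axis_nth_if: "axis k a $ j = (if j = k then a else 0)"
  by (simp add: axis_def)

text \<open>
  The affine chart \<open>w \<mapsto> (w\<^sub>j w\<^sub>k\<inverse>)\<^sub>j\<close> where \<open>w\<^sub>k \<noteq> 0\<close>.  Its component at \<open>k\<close> would be constantly 1;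
  it is replaced by 0 so that the values form a linear subspace.
\<close>

definition affine :: "'m::finite \<Rightarrow> quat^'m \<Rightarrow> quat^'m" where
  "affine k w = (\<chi> j. if j = k then 0 else qmult (w $ j) (qinv (w $ k)))"

definition affine_chart :: "'m::finite \<Rightarrow> (quat^'m) set \<Rightarrow> quat^'m" where
  "affine_chart k C = affine k (SOME w. w \<in> C)"

lemma affine_rmult: "q \<noteq> 0 \<Longrightarrow> w $ k \<noteq> 0 \<Longrightarrow> affine k (rmult w q) = affine k w"
  by (simp add: affine_def vec_eq_iff qinv_qmult qmult_assoc[symmetric] qmult_assoc[of _ q "qinv q"]
      qmult_qinv)

lemma affine_chart_hp_class: "w $ k \<noteq> 0 \<Longrightarrow> affine_chart k (hp_class w) = affine k w"
proof -
  assume w: "w $ k \<noteq> 0"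
  have "rmult w q1 \<in> hp_class w" unfolding hp_class_eq by (auto simp: axis_eq_0_iff)
  then have "(SOME w'. w' \<in> hp_class w) \<in> hp_class w" by (rule someI)
  then show ?thesis
    unfolding affine_chart_def by (auto simp: hp_class_eq affine_rmult[OF _ w])
qed

text \<open>The affine coordinates are a quadratic map divided by \<open>\<bar>w\<^sub>k\<bar>\<^sup>2\<close>.\<close>

definition affine_num :: "'m::finite \<Rightarrow> quat^'m \<Rightarrow> quat^'m \<Rightarrow> quat^'m" where
  "affine_num k w w' = (\<chi> j. if j = k then 0 else qmult (w $ j) (qcnj (w' $ k)))"

lemma affine_eq: "affine k w = inverse (w $ k \<bullet> w $ k) *\<^sub>R affine_num k w w"
  by (simp add: affine_def affine_num_def qinv_def vec_eq_iff)

lemma bounded_bilinear_affine_num: "bounded_bilinear (affine_num k)"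
proof -
  note b = bilinear_qmult[unfolded bilinear_def] and c = linear_qcnj
  have "bilinear (affine_num k)"
    unfolding bilinear_def
    by (auto intro!: linearI simp: affine_num_def vec_eq_iff linear_add[OF c] linear_cmul[OF c]
        bilinear_ladd[OF bilinear_qmult] bilinear_radd[OF bilinear_qmult])
  then show ?thesis by (simp add: bilinear_conv_bounded_bilinear)
qed

lemma smooth_on_affine: "smooth_on {w. w $ k \<noteq> 0} (affine k)"
  unfolding smooth_on_def affine_eq[abs_def]
proof
  fix m
  have nth: "bounded_linear (\<lambda>w :: quat^'a. w $ k)" by (rule bounded_linear_vec_nth)
  show "Ck_on m {w. w $ k \<noteq> 0} (\<lambda>w. inverse (w $ k \<bullet> w $ k) *\<^sub>R affine_num k w w)"
    by (intro Ck_on_bilinear[OF bounded_bilinear_scaleR] Ck_on_inverse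
        Ck_on_bilinear[OF bounded_bilinear_inner] Ck_on_bilinear[OF bounded_bilinear_affine_num]
        Ck_on_bounded_linear nth bounded_linear_ident) auto
qed

text \<open>
  The derivative in the directions \<open>h\<close> with \<open>h\<^sub>k = 0\<close>, in which the denominator is constant,
  already exhausts the subspace of the chart.
\<close>

lemma affine_submersion:
  fixes w :: "quat^'m::finite"
  assumes w: "w $ k \<noteq> 0"
  shows "\<exists>D. (affine k has_derivative D) (at w) \<and> range D = {v. v $ k = 0}"
proof -
  let ?r = "w $ k \<bullet> w $ k"
  define D where "D h = inverse ?r *\<^sub>R (affine_num k w h + affine_num k h w) +
      (- (inverse ?r * (w $ k \<bullet> h $ k + h $ k \<bullet> w $ k) * inverse ?r)) *\<^sub>R affine_num k w w" for h
  have n: "((\<lambda>w. w $ k) has_derivative (\<lambda>h. h $ k)) (at w)"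
    by (rule bounded_linear_imp_has_derivative[OF bounded_linear_vec_nth])
  have r: "?r \<noteq> 0" using w by simp
  have "((\<lambda>w. w $ k \<bullet> w $ k) has_derivative (\<lambda>h. w $ k \<bullet> h $ k + h $ k \<bullet> w $ k)) (at w)"
    by (rule bounded_bilinear.FDERIV[OF bounded_bilinear_inner n n])
  note inv = Deriv.has_derivative_inverse[OF r this]
  have num: "((\<lambda>w. affine_num k w w) has_derivative (\<lambda>h. affine_num k w h + affine_num k h w)) (at w)"
    by (rule bounded_bilinear.FDERIV[OF bounded_bilinear_affine_num has_derivative_ident has_derivative_ident])
  have D: "(affine k has_derivative D) (at w)"
    unfolding affine_eq[abs_def] D_def[abs_def]
    by (rule bounded_bilinear.FDERIV[OF bounded_bilinear_scaleR inv num])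
  have "D h \<in> {v. v $ k = 0}" for h by (simp add: D_def affine_num_def)
  moreover have "v \<in> range D" if v: "v $ k = 0" for v
  proof
    let ?h = "\<chi> j. qmult (v $ j) (w $ k)"
 have "qmult (v $ k) (w $ k) = 0" using v by simp
    then have "affine_num k w ?h = 0"
      by (auto simp: affine_num_def vec_eq_iff[of _ "0 :: quat^'m"] linear_0[OF linear_qcnj])
    moreover have "affine_num k ?h w = ?r *\<^sub>R v"
      using v by (auto simp: affine_num_def vec_eq_iff qmult_assoc qmult_qcnj)
    ultimately show "v = D ?h" using v r by (simp add: D_def)
  qed auto
  ultimately show ?thesis using D by blast
qed

lemma affine_chart:
  "({hp_class w | w. w $ k \<noteq> 0}, affine_chart k) \<in> quotient_charts (- {0}) hp_class"
  (is "(?U, _) \<in> _")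
proof -
  let ?S = "- {0} :: (quat^'a) set" and ?E = "{v :: quat^'a. v $ k = 0}"
  let ?Q = "quotient_topology ?S hp_class"
  let ?P = "{w :: quat^'a. w $ k \<noteq> 0}"
  define \<sigma> :: "quat^'a \<Rightarrow> quat^'a" where "\<sigma> v = v + axis k q1" for v
  have \<sigma>_nth: "\<sigma> v $ k \<noteq> 0" if "v \<in> ?E" for v using that by (simp add: \<sigma>_def axis_eq_0_iff)
  then have \<sigma>_nz: "\<sigma> v \<noteq> 0" if "v \<in> ?E" for v using that by (metis zero_index)
  \<comment> \<open>The inverse of the chart puts \<open>1\<close> back in place \<open>k\<close>.\<close>
  have affine_\<sigma>: "affine k (\<sigma> v) = v" if "v \<in> ?E" for v
  proof -
    have "qinv q1 = q1" using qmult_qinv(2)[of q1] by (simp add: axis_eq_0_iff)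
    then show ?thesis using that by (simp add: \<sigma>_def affine_def vec_eq_iff[of _ v] axis_nth_if)
  qed
  have \<sigma>_affine: "hp_class (\<sigma> (affine k w)) = hp_class w" if "w $ k \<noteq> 0" for w
  proof -
    have "\<sigma> (affine k w) $ j = rmult w (qinv (w $ k)) $ j" for j
      using that qmult_qinv(1)[OF that] by (cases "j = k") (simp_all add: \<sigma>_def affine_def axis_nth_if)
    then have "\<sigma> (affine k w) = rmult w (qinv (w $ k))" by (simp add: vec_eq_iff)
    then show ?thesis using qinv_nonzero[OF that] hp_class_eq_iff by metis
  qed
  have U: "hp_class w \<in> ?U \<longleftrightarrow> w $ k \<noteq> 0" for w :: "quat^'a"
  proof
    assume "hp_class w \<in> ?U"
    then obtain w' where "w' $ k \<noteq> 0" "hp_class w' = hp_class w" by auto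
    then show "w $ k \<noteq> 0" by (auto simp: hp_class_eq_iff)
  qed blast
  have P: "{w \<in> ?S. hp_class w \<in> ?U} = ?P"
    using U by auto
  have openP: "open ?P" by (intro open_Collect_neq continuous_intros)
  have open_iff: "openin ?Q V \<longleftrightarrow> V \<subseteq> hp_class ` ?S \<and> open {w \<in> ?S. hp_class w \<in> V}" for V
    using openin_open_eq[of ?S "{w \<in> ?S. hp_class w \<in> V}"]
    by (auto simp: openin_quotient_topology open_Compl)
  have openU: "openin ?Q ?U" using openP P by (auto simp: open_iff)
  have affine_E: "affine k w \<in> ?E" for w by (simp add: affine_def)
  have image: "affine_chart k ` ?U = ?E"
  proof
    show "affine_chart k ` ?U \<subseteq> ?E" by (auto simp: affine_chart_hp_class affine_def)
    show "?E \<subseteq> affine_chart k ` ?U"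
    proof
      fix v assume v: "v \<in> ?E"
      show "v \<in> affine_chart k ` ?U"
        using affine_\<sigma>[OF v] affine_chart_hp_class[OF \<sigma>_nth[OF v]] \<sigma>_nth[OF v]
        by (metis (mono_tags, lifting) imageI mem_Collect_eq)
    qed
  qed
  have topU: "topspace (subtopology ?Q ?U) = ?U" using openin_subset[OF openU] by auto
  have cont: "continuous_on ?P (affine k)"
    using smooth_on_affine[of k] unfolding smooth_on_def by (metis Ck_on.simps(1))
  have "homeomorphic_maps (subtopology ?Q ?U) (top_of_set ?E) (affine_chart k) (\<lambda>v. hp_class (\<sigma> v))"
    unfolding homeomorphic_maps_def
  proof (intro conjI ballI)
    show "continuous_map (subtopology ?Q ?U) (top_of_set ?E) (affine_chart k)"
      unfolding continuous_map_def topU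
    proof (intro conjI allI impI)
      show "affine_chart k \<in> ?U \<rightarrow> topspace (top_of_set ?E)" using image by auto
      fix V assume "openin (top_of_set ?E) V"
      then obtain V' where V': "open V'" "V = ?E \<inter> V'" by (auto simp: openin_open)
      let ?X = "{C \<in> ?U. affine_chart k C \<in> V}"
      have "{w \<in> ?S. hp_class w \<in> ?X} = ?P \<inter> affine k -` V'"
        using U affine_E V' by (auto simp: affine_chart_hp_class)
      moreover have "open (?P \<inter> affine k -` V')"
        using continuous_open_preimage[OF cont openP V'(1)] .
      ultimately have "openin ?Q ?X"
        using openin_subset[OF openU] by (auto simp: open_iff)
      then show "openin (subtopology ?Q ?U) ?X"
        by (auto simp: openin_subtopology_alt openin_subtopology intro!: exI[of _ ?X])
    qed
    show "continuous_map (top_of_set ?E) (subtopology ?Q ?U) (\<lambda>v. hp_class (\<sigma> v))"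
      unfolding continuous_map_def topU
    proof (intro conjI allI impI)
      show "(\<lambda>v. hp_class (\<sigma> v)) \<in> topspace (top_of_set ?E) \<rightarrow> ?U" using U \<sigma>_nth by auto
      fix V assume "openin (subtopology ?Q ?U) V"
      then have V: "openin ?Q V" "V \<subseteq> ?U"
        using openin_subtopology_Int2 openU by (auto simp: openin_open_subtopology)
      have "continuous_on ?E \<sigma>" unfolding \<sigma>_def by (intro continuous_intros)
      moreover have "open {w \<in> ?S. hp_class w \<in> V}" using V by (simp add: open_iff)
      ultimately have "openin (top_of_set ?E) (?E \<inter> \<sigma> -` {w \<in> ?S. hp_class w \<in> V})"
        by (rule continuous_openin_preimage_gen)
      also have "?E \<inter> \<sigma> -` {w \<in> ?S. hp_class w \<in> V} = {v \<in> topspace (top_of_set ?E). hp_class (\<sigma> v) \<in> V}"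
        using \<sigma>_nz by auto
      finally show "openin (top_of_set ?E) {v \<in> topspace (top_of_set ?E). hp_class (\<sigma> v) \<in> V}" .
    qed
    show "hp_class (\<sigma> (affine_chart k C)) = C" if "C \<in> topspace (subtopology ?Q ?U)" for C
      using that \<sigma>_affine unfolding topU by (auto simp: affine_chart_hp_class)
    show "affine_chart k (hp_class (\<sigma> v)) = v" if "v \<in> topspace (top_of_set ?E)" for v
      using that \<sigma>_nth affine_\<sigma> by (auto simp: affine_chart_hp_class)
  qed
  then have "homeomorphic_map (subtopology ?Q ?U) (top_of_set (affine_chart k ` ?U)) (affine_chart k)"
    unfolding image homeomorphic_map_maps by blast
  moreover have "smooth_on ?P (affine_chart k \<circ> hp_class)"
    unfolding smooth_on_def
  proof
    fix m
    have "Ck_on m ?P (affine k)" using smooth_on_affine[of k] by (simp add: smooth_on_def)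
    then show "Ck_on m ?P (affine_chart k \<circ> hp_class)"
      by (rule Ck_on_cong[rotated]) (simp add: affine_chart_hp_class)
  qed
  moreover have "\<exists>D. ((affine_chart k \<circ> hp_class) has_derivative D) (at w within ?P) \<and> D ` span ?S = ?E"
    if "hp_class w \<in> ?U" for w
  proof -
    have w: "w $ k \<noteq> 0" using that U by blast
    have "v \<in> span ?S" for v by (cases "v = 0") (auto intro: span_0 span_base)
    then have "span ?S = UNIV" by blast
    moreover obtain D where D: "(affine k has_derivative D) (at w)" "range D = ?E"
      using affine_submersion[OF w] by blast
    moreover have "((affine_chart k \<circ> hp_class) has_derivative D) (at w within ?P)"
      by (rule has_derivative_transform[OF _ _ has_derivative_at_withinI[OF D(1)]])
        (use w in \<open>auto simp: affine_chart_hp_class\<close>)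
    ultimately show ?thesis by auto
  qed
  moreover have "subspace ?E" by (auto simp: subspace_def)
  ultimately have "subspace ?E \<and> openin (top_of_set ?E) (affine_chart k ` ?U) \<and>
      homeomorphic_map (subtopology ?Q ?U) (top_of_set (affine_chart k ` ?U)) (affine_chart k) \<and>
      smooth_on {w \<in> ?S. hp_class w \<in> ?U} (affine_chart k \<circ> hp_class) \<and>
      (\<forall>w\<in>?S. hp_class w \<in> ?U \<longrightarrow>
        (\<exists>D. ((affine_chart k \<circ> hp_class) has_derivative D) (at w within {w \<in> ?S. hp_class w \<in> ?U}) \<and>
             D ` span ?S = ?E))"
    unfolding P image by (intro conjI ballI impI) (assumption | simp)+
  then show ?thesis
    unfolding quotient_charts_def using openU by blast
qed


section \<open>Symplectic isometries are right multiplications\<close>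

lemma qmult_J: "qmult (J *v x) q = J *v qmult x q" and qmult_L: "qmult (L *v x) q = L *v qmult x q"
  by (simp_all add: J_eq_qmult L_eq_qmult qmult_assoc)

lemma norm_qmult: "norm (qmult x q) = norm x * norm q"
proof -
  have "qmult x q \<bullet> qmult x q = (x \<bullet> x) * (q \<bullet> q)"
    by (simp add: norm_sq_quat qmult_def power2_eq_square algebra_simps)
  then show ?thesis by (simp add: norm_eq_sqrt_inner real_sqrt_mult)
qed

lemma linear_qmult_left: "linear (\<lambda>x. qmult x q)"
  using bilinear_qmult unfolding bilinear_def by blast

text \<open>
  Unit quaternions are squares: halve the angle between \<open>1\<close> and \<open>q\<close>.
\<close>

lemma unit_quat_square:
  assumes "norm q = 1"
  obtains p where "norm p = 1" "qmult p p = q"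
proof (cases "q = - q1")
  case True
  have "qmult (axis 2 1) (axis 2 1) = q"
    unfolding True by (simp add: vec_eq_iff forall_4 qmult_def axis_def)
  then show ?thesis using that[of "axis 2 1"] by simp
next
  case False
  then have nz: "q1 + q \<noteq> 0" by (metis add.commute add_eq_0_iff)
  have q: "(q$1)\<^sup>2 + (q$2)\<^sup>2 + (q$3)\<^sup>2 + (q$4)\<^sup>2 = 1"
    using assms by (simp add: norm_eq_1 norm_sq_quat)
  have n: "(q1 + q) \<bullet> (q1 + q) = 2 + 2 * q$1"
    using q by (simp add: norm_sq_quat axis_def power2_sum)
  have sq: "qmult (q1 + q) (q1 + q) = (2 + 2 * q$1) *\<^sub>R q"
    using q by (simp add: vec_eq_iff forall_4 qmult_def axis_def power2_eq_square algebra_simps)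
  let ?p = "(1 / norm (q1 + q)) *\<^sub>R (q1 + q)"
  have "qmult ?p ?p = ((1 / norm (q1 + q))\<^sup>2 * (2 + 2 * q$1)) *\<^sub>R q"
    by (simp add: sq power2_eq_square)
  also have "(1 / norm (q1 + q))\<^sup>2 * (2 + 2 * q$1) = 1"
    using nz unfolding n[symmetric] power_divide power2_norm_eq_inner by simp
  finally show ?thesis using that[of ?p] nz by simp
qed

lemma G0_rmult:
  assumes "norm q = 1"
  shows "\<exists>g\<in>G0. \<forall>x. g *v x = qmult x q"
proof -
  define R where "R q = matrix (\<lambda>x. qmult x q)" for q
  have R: "R q *v x = qmult x q" for q x
    unfolding R_def using fun_cong[OF matrix_vector_mul(2)[OF linear_qmult_left]] .
  have orth: "orthogonal_matrix (R q)" if "norm q = 1" for q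
  proof -
    have "orthogonal_transformation (\<lambda>x. qmult x q)"
      using that by (simp add: orthogonal_transformation linear_qmult_left norm_qmult)
    then show ?thesis by (simp add: orthogonal_transformation_matrix R_def)
  qed
  \<comment> \<open>As the square of an orthogonal matrix, \<open>R q\<close> has determinant \<open>1\<close> rather than \<open>- 1\<close>.\<close>
  obtain p where p: "norm p = 1" "qmult p p = q" using unit_quat_square[OF assms] .
  have "R q = R p ** R p"
    by (simp add: matrix_eq R matrix_vector_mul_assoc[symmetric] p(2)[symmetric] qmult_assoc)
  then have "det (R q) = det (R p) * det (R p)" by (simp add: det_mul)
  also have "\<dots> = 1" using det_orthogonal_matrix[OF orth[OF p(1)]] by auto
  finally have "R q \<in> G0"
    unfolding G0_def using orth[OF assms]
    by (simp add: matrix_eq R matrix_vector_mul_assoc[symmetric] qmult_J qmult_L)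
  then show ?thesis using R by blast
qed

lemma quat_basis: "x = x$1 *\<^sub>R q1 + x$2 *\<^sub>R (J *v q1) + x$3 *\<^sub>R (L *v q1) + x$4 *\<^sub>R (J *v (L *v q1))"
  by (simp add: vec_eq_iff forall_4 J_eq_qmult L_eq_qmult qmult_def axis_def)

text \<open>
  A map commuting with left multiplication by \<open>i\<close> and \<open>j\<close> is determined by its value at \<open>1\<close>.
\<close>

lemma rmult_of_G0:
  assumes "g \<in> G0"
  shows "\<exists>q. q \<noteq> 0 \<and> (\<forall>x. g *v x = qmult x q)"
proof (intro exI conjI allI)
  have J: "g *v (J *v y) = J *v (g *v y)" and L: "g *v (L *v y) = L *v (g *v y)" for y
    using assms by (simp_all add: G0_def matrix_vector_mul_assoc)
  let ?q = "g *v q1"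
  have "norm ?q = norm q1"
    using assms orthogonal_transformation_matrix[of "\<lambda>x. g *v x"]
    by (simp add: G0_def orthogonal_transformation matrix_vector_mul_linear)
  then show "?q \<noteq> 0" by auto
  fix x
  have "g *v x = x$1 *\<^sub>R (g *v q1) + x$2 *\<^sub>R (g *v (J *v q1)) + x$3 *\<^sub>R (g *v (L *v q1))
      + x$4 *\<^sub>R (g *v (J *v (L *v q1)))"
    by (subst quat_basis[of x]) (simp only: matrix_vector_right_distrib matrix_vector_mult_scaleR)
  also have "\<dots> = x$1 *\<^sub>R qmult q1 ?q + x$2 *\<^sub>R qmult (J *v q1) ?q + x$3 *\<^sub>R qmult (L *v q1) ?q
      + x$4 *\<^sub>R qmult (J *v (L *v q1)) ?q"
    by (simp only: J L qmult_J qmult_L qmult_1)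
  also have "\<dots> = qmult x ?q"
    by (subst (5) quat_basis[of x])
      (simp only: linear_add[OF linear_qmult_left] qmult_scaleR)
  finally show "g *v x = qmult x ?q" .
qed

text \<open>
  The positive factor of a dilation is the norm of the quaternion, the isometry its direction.
\<close>

lemma hsl_class_eq: "hsl_class F = {G. \<exists>q. q \<noteq> 0 \<and> (\<forall>z. c2_apply G z = qmult (c2_apply F z) q)}"
proof (intro set_eqI iffI; clarsimp simp: hsl_class_def)
  fix G r g assume r: "0 < r" and "g \<in> G0" and G: "\<forall>z. c2_apply G z = r *\<^sub>R (g *v c2_apply F z)"
  then obtain q where "q \<noteq> 0" "\<forall>x. g *v x = qmult x q" using rmult_of_G0 by blast
  then show "\<exists>q. q \<noteq> 0 \<and> (\<forall>z. r *\<^sub>R (g *v c2_apply F z) = qmult (c2_apply F z) q)"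
    using r by (intro exI[of _ "r *\<^sub>R q"]) simp
next
  fix G and q :: quat assume q: "q \<noteq> 0" and G: "\<forall>z. c2_apply G z = qmult (c2_apply F z) q"
  obtain g where "g \<in> G0" "\<forall>x. g *v x = qmult x ((1 / norm q) *\<^sub>R q)"
    using G0_rmult[of "(1 / norm q) *\<^sub>R q"] q by auto
  then show "\<exists>r>0. \<exists>g\<in>G0. \<forall>z. qmult (c2_apply F z) q = r *\<^sub>R (g *v c2_apply F z)"
    using q by (intro exI[of _ "norm q"] conjI bexI[of _ g]) auto
qed


section \<open>Rotations generated by \<open>J\<close>\<close>

definition rot :: "real \<Rightarrow> real^4 \<Rightarrow> real^4" where
  "rot t v = cos t *\<^sub>R v + sin t *\<^sub>R (J *v v)"

lemma JJ [simp]: "J *v (J *v v) = - v" and LL [simp]: "L *v (L *v v) = - v"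
  and LJ: "L *v (J *v v) = - (J *v (L *v v))"
  by (simp_all add: vec_eq_iff forall_4 J_eq_qmult L_eq_qmult qmult_def axis_def)

lemma rot_0 [simp]: "rot 0 v = v"
  by (simp add: rot_def)

lemma rot_rot: "rot s (rot t v) = rot (s + t) v"
  by (simp add: rot_def cos_add sin_add matrix_vector_right_distrib matrix_vector_mult_scaleR
      algebra_simps)

lemma L_rot: "L *v rot t v = rot (- t) (L *v v)"
  by (simp add: rot_def matrix_vector_right_distrib matrix_vector_mult_scaleR LJ)

lemma J_rot: "J *v rot t v = rot t (J *v v)"
  by (simp add: rot_def matrix_vector_right_distrib matrix_vector_mult_scaleR)

lemma linear_rot: "linear (rot t)"
  by (auto intro!: linearI simp: rot_def matrix_vector_right_distrib matrix_vector_mult_scaleR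
      algebra_simps)

lemma rot_qmult: "qmult (rot t v) q = rot t (qmult v q)"
  by (simp add: rot_def linear_add[OF linear_qmult_left] qmult_J)

lemma norm_J [simp]: "norm (J *v v) = norm v" and norm_L [simp]: "norm (L *v v) = norm v"
  by (simp_all add: J_eq_qmult L_eq_qmult norm_qmult)

lemma norm_rot_le: "norm (rot t v) \<le> 2 * norm v"
proof -
  have "norm (rot t v) \<le> \<bar>cos t\<bar> * norm v + \<bar>sin t\<bar> * norm v"
    unfolding rot_def by (rule order.trans[OF norm_triangle_ineq]) simp
  also have "\<dots> \<le> 1 * norm v + 1 * norm v"
    by (intro add_mono mult_right_mono) auto
  finally show ?thesis by simp
qed

lemma continuous_matrix_vector_mult [continuous_intros]:
  fixes A :: "real^'n^'m"
  shows "continuous_on S f \<Longrightarrow> continuous_on S (\<lambda>z. A *v f z)"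
  by (rule continuous_on_compose2[OF matrix_vector_mult_linear_continuous_on[of UNIV]]) auto

lemma continuous_rot [continuous_intros]:
  fixes f :: "complex \<Rightarrow> real^4"
  assumes "continuous_on S \<theta>" "continuous_on S f"
  shows "continuous_on S (\<lambda>z. rot (\<theta> z) (f z))"
  unfolding rot_def by (intro continuous_intros assms)

lemma has_derivative_rot:
  assumes "(\<theta> has_derivative \<theta>') (at z within S)" "(f has_derivative f') (at z within S)"
  shows "((\<lambda>z. rot (\<theta> z) (f z)) has_derivative
    (\<lambda>v. \<theta>' v *\<^sub>R (J *v rot (\<theta> z) (f z)) + rot (\<theta> z) (f' v))) (at z within S)"
proof -
  have "((\<lambda>z. J *v f z) has_derivative (\<lambda>v. J *v f' v)) (at z within S)"
    by (rule bounded_linear.has_derivative[OF matrix_vector_mul_bounded_linear assms(2)])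
  then show ?thesis
    unfolding rot_def
    by (auto intro!: derivative_eq_intros assms simp: matrix_vector_right_distrib
        matrix_vector_mult_scaleR algebra_simps)
qed

lemma mat_exp_J: "mat_exp (t *\<^sub>R J) = cos t *\<^sub>R mat 1 + sin t *\<^sub>R J"
proof -
  have JJ: "J ** J = - mat 1"
    by (simp add: matrix_matrix_mult_def vec_eq_iff forall_4 sum_4 J_def mat_def)
  have "(1 / fact k) *\<^sub>R (((**) (t *\<^sub>R J)) ^^ k) (mat 1) =
      (cos_coeff k *\<^sub>R t ^ k) *\<^sub>R mat 1 + (sin_coeff k *\<^sub>R t ^ k) *\<^sub>R J" (is "?l k = ?r k") for k
  proof (induction k)
    case (Suc k)
    have "?l (Suc k) = (t / real (Suc k)) *\<^sub>R (J ** ?l k)"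
      by (simp add: scalar_matrix_assoc[symmetric] matrix_scalar_ac scalar_mult_eq_scaleR field_simps)
    also have "\<dots> = (t / real (Suc k)) *\<^sub>R (J ** ?r k)" by (simp only: Suc)
    also have "\<dots> = ?r (Suc k)"
      by (simp add: cos_coeff_Suc sin_coeff_Suc matrix_add_ldistrib matrix_scalar_ac
          scalar_matrix_assoc[symmetric] JJ field_simps)
    finally show ?case .
  qed simp
  moreover have "(\<lambda>k. ?r k) sums (cos t *\<^sub>R mat 1 + sin t *\<^sub>R J)" for r
    by (intro sums_add bounded_linear.sums[OF bounded_linear_scaleR_left] cos_converges sin_converges)
  ultimately show ?thesis unfolding mat_exp_def by (simp add: sums_iff)
qed

lemma mat_exp_J_mult: "mat_exp (t *\<^sub>R J) *v v = rot t v"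
  by (simp add: mat_exp_J rot_def matrix_vector_mult_add_rdistrib scaleR_matrix_vector_assoc[symmetric])

lemma cmat_cvec: "cmat A *v cvec x = cvec (A *v x)"
  by (simp add: cmat_def cvec_def map_matrix_def matrix_vector_mult_def vec_eq_iff)

lemma cmat_smult: "cmat A *v (c *s x) = c *s (cmat A *v x)"
  by (simp add: matrix_vector_mult_def vec_eq_iff sum_distrib_left algebra_simps)

lemma cvec_simps: "cvec (x + y) = cvec x + cvec y" "cvec (x - y) = cvec x - cvec y"
  "cvec (r *\<^sub>R x) = complex_of_real r *s cvec x" "cvec 0 = 0"
  by (simp_all add: cvec_def vec_eq_iff)

lemma cvec_sum: "cvec (sum f A) = (\<Sum>x\<in>A. cvec (f x))"
  by (induction A rule: infinite_finite_induct) (simp_all add: cvec_simps)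

text \<open>
  In real terms the equation \<open>e\<^sup>J\<^sup>\<beta> L f\<^sub>z = i f\<^sub>z\<close> is \<open>f\<^sub>y = e\<^sup>J\<^sup>\<beta> L f\<^sub>x\<close>; its other half
  follows because \<open>e\<^sup>J\<^sup>\<beta> L\<close> squares to \<open>-1\<close>.
\<close>

lemma hsl_equation_iff:
  "cmat (mat_exp (t *\<^sub>R J)) *v (cmat L *v dz f z) = \<i> *s dz f z \<longleftrightarrow>
     pd \<i> f z = rot t (L *v pd 1 f z)"
proof -
  let ?x = "pd 1 f z" and ?y = "pd \<i> f z"
  let ?A = "\<lambda>v. rot t (L *v v)"
  have AA: "?A (?A v) = - v" for v
    using linear_neg[OF linear_rot] by (simp add: L_rot rot_rot)
  have half: "a / 2 - \<i> * b / 2 = \<i> * c / 2 + d / 2 \<longleftrightarrow> a - \<i> * b = \<i> * c + d"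
    for a b c d by (auto simp: complex_eq_iff)
  have "cmat (mat_exp (t *\<^sub>R J)) *v (cmat L *v dz f z) = \<i> *s dz f z \<longleftrightarrow>
      cvec (?A ?x) - \<i> *s cvec (?A ?y) = \<i> *s cvec ?x + cvec ?y"
    unfolding dz_def cmat_smult matrix_vector_mult_diff_distrib cmat_cvec mat_exp_J_mult
    by (simp add: vec_eq_iff half right_diff_distrib)
  also have "\<dots> \<longleftrightarrow> ?A ?x = ?y \<and> ?A ?y = - ?x"
    by (auto simp: vec_eq_iff cvec_def complex_eq_iff minus_equation_iff)
  also have "\<dots> \<longleftrightarrow> ?y = ?A ?x"
    using AA[of ?x] by auto
  finally show ?thesis .
qed


section \<open>Mean values and Fourier coefficients on a torus\<close>

text \<open>
  A basis \<open>a, b\<close> of a lattice together with the dual basis \<open>a', b'\<close>, which yields the coordinates.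
\<close>

locale lattice_basis =
  fixes a b a' b' :: complex
  assumes dual: "a' \<bullet> a = 1" "a' \<bullet> b = 0" "b' \<bullet> a = 0" "b' \<bullet> b = 1"
    and coords: "\<And>z. z = (a' \<bullet> z) *\<^sub>R a + (b' \<bullet> z) *\<^sub>R b"
begin

definition lat :: "complex set" where
  "lat = {of_int k * a + of_int l * b | k l. True}"

definition dual_lat :: "complex set" where
  "dual_lat = dual_lattice lat"

lemma dual_lat_iff: "\<delta> \<in> dual_lat \<longleftrightarrow> \<delta> \<bullet> a \<in> \<int> \<and> \<delta> \<bullet> b \<in> \<int>"
proof
  have "of_int 1 * a + of_int 0 * b \<in> lat" "of_int 0 * a + of_int 1 * b \<in> lat"
    unfolding lat_def by blast+
  then show "\<delta> \<in> dual_lat \<Longrightarrow> \<delta> \<bullet> a \<in> \<int> \<and> \<delta> \<bullet> b \<in> \<int>"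
    by (simp add: dual_lat_def dual_lattice_def)
  have "\<delta> \<bullet> (of_int k * a + of_int l * b) = of_int k * (\<delta> \<bullet> a) + of_int l * (\<delta> \<bullet> b)" for k l
    by (simp add: inner_complex_def algebra_simps)
  then show "\<delta> \<bullet> a \<in> \<int> \<and> \<delta> \<bullet> b \<in> \<int> \<Longrightarrow> \<delta> \<in> dual_lat"
    by (auto simp: dual_lat_def dual_lattice_def lat_def)
qed

lemma dual_lat_simps:
  "a' \<in> dual_lat" "b' \<in> dual_lat" "0 \<in> dual_lat" "\<delta> \<in> dual_lat \<Longrightarrow> - \<delta> \<in> dual_lat"
  "\<delta> \<in> dual_lat \<Longrightarrow> \<eta> \<in> dual_lat \<Longrightarrow> \<delta> + \<eta> \<in> dual_lat"
  "\<delta> \<in> dual_lat \<Longrightarrow> \<eta> \<in> dual_lat \<Longrightarrow> \<delta> - \<eta> \<in> dual_lat"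
  by (auto simp: dual_lat_iff dual inner_add_left inner_diff_left)

lemma ab_in_lat: "a \<in> lat" "b \<in> lat"
proof -
  have "of_int 1 * a + of_int 0 * b \<in> lat" "of_int 0 * a + of_int 1 * b \<in> lat"
    unfolding lat_def by blast+
  then show "a \<in> lat" "b \<in> lat" by simp_all
qed

definition periodic :: "(complex \<Rightarrow> 'v) \<Rightarrow> bool" where
  "periodic h \<longleftrightarrow> (\<forall>z. \<forall>\<omega>\<in>lat. h (z + \<omega>) = h z)"

definition pt :: "real \<times> real \<Rightarrow> complex" where
  "pt x = fst x *\<^sub>R a + snd x *\<^sub>R b"

abbreviation square :: "(real \<times> real) set" where
  "square \<equiv> cbox (0, 0) (1, 1)"

lemma continuous_pt: "continuous_on S pt"
  unfolding pt_def by (intro continuous_intros)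

lemma coords_pt: "a' \<bullet> pt x = fst x" "b' \<bullet> pt x = snd x"
  by (simp_all add: pt_def inner_add_right dual)

text \<open>
  The average over a fundamental parallelogram, computed on the unit square.
\<close>

definition mean :: "(complex \<Rightarrow> 'v::euclidean_space) \<Rightarrow> 'v" where
  "mean h = integral square (\<lambda>x. h (pt x))"

lemma integrable_pt:
  fixes h :: "complex \<Rightarrow> 'v::euclidean_space"
  assumes "continuous_on UNIV h"
  shows "(\<lambda>x. h (pt x)) integrable_on square"
  by (intro integrable_continuous continuous_on_compose2[OF assms continuous_pt]) auto

lemma mean_add:
  fixes h :: "complex \<Rightarrow> 'v::euclidean_space"
  assumes "continuous_on UNIV h" "continuous_on UNIV g"
  shows "mean (\<lambda>z. h z + g z) = mean h + mean g"
  unfolding mean_def using assms by (intro integral_add integrable_pt)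

lemma mean_linear:
  fixes h :: "complex \<Rightarrow> 'v::euclidean_space"
  assumes "continuous_on UNIV h" "linear f"
  shows "mean (\<lambda>z. f (h z)) = f (mean h)"
  unfolding mean_def
  using integral_linear[OF integrable_pt[OF assms(1)] assms(2)[unfolded linear_conv_bounded_linear]]
  by (simp add: o_def)

lemma mean_scaleR:
  fixes h :: "complex \<Rightarrow> 'v::euclidean_space"
  shows "mean (\<lambda>z. c *\<^sub>R h z) = c *\<^sub>R mean h"
  unfolding mean_def by simp

lemma mean_mult_left: "mean (\<lambda>z. c * h z) = c * mean h" for c :: real
  unfolding mean_def by simp

lemma content_square: "measure lborel square = 1"
  using content_Pair[of "0::real" "0::real" "1::real" "1::real"] by simp

lemma mean_const: "mean (\<lambda>z. c) = c"
  unfolding mean_def by (simp add: content_square)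

lemma norm_mean_le:
  fixes h :: "complex \<Rightarrow> 'v::euclidean_space"
  assumes "continuous_on UNIV h" "\<And>x. x \<in> square \<Longrightarrow> norm (h (pt x)) \<le> B"
  shows "norm (mean h) \<le> B"
proof -
  have "0 \<le> B" using assms(2)[of "(0,0)"] norm_ge_zero[of "h (pt (0,0))"]
    by (simp add: cbox_Pair_eq del: norm_ge_zero)
  then show ?thesis
    using integrable_bound[OF _ integrable_pt[OF assms(1)] assms(2)] unfolding mean_def
    by (simp add: content_square)
qed

text \<open>
  In the directions \<open>a\<close> and \<open>b\<close>, integrating first along a period leaves nothing; every other direction
  is a combination of these two.
\<close>

lemma mean_derivative:
  fixes h :: "complex \<Rightarrow> 'v::euclidean_space"
  assumes h: "periodic h" and D: "\<And>z. (h has_derivative D z) (at z)"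
    and c: "\<And>v. continuous_on UNIV (\<lambda>z. D z v)"
  shows "mean (\<lambda>z. D z v) = 0"
proof -
  have line: "integral (cbox 0 1) (\<lambda>t. D (z + t *\<^sub>R w) w) = 0" if "w \<in> lat" for z w
  proof -
    have "((\<lambda>t. h (z + t *\<^sub>R w)) has_vector_derivative D (z + t *\<^sub>R w) w) (at t within {0..1})" for t
    proof -
      have "((\<lambda>t. z + t *\<^sub>R w) has_derivative (\<lambda>s. s *\<^sub>R w)) (at t within {0..1})"
        by (auto intro!: derivative_eq_intros)
      from has_derivative_compose[OF this D]
      show ?thesis
        unfolding has_vector_derivative_def
        by (simp add: linear_cmul[OF has_derivative_linear[OF D]])
    qed
    from fundamental_theorem_of_calculus[OF _ this]
    have "((\<lambda>t. D (z + t *\<^sub>R w) w) has_integral 0) {0..1}"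
      using h that by (simp add: periodic_def)
    then show ?thesis by (simp add: integral_unique)
  qed
  have cont: "continuous_on S (\<lambda>x. D (pt x) v)" for v S
    by (rule continuous_on_compose2[OF c continuous_pt]) auto
  have "mean (\<lambda>z. D z b) = integral (cbox 0 1) (\<lambda>s. integral (cbox 0 1) (\<lambda>t. D (pt (s, t)) b))"
    unfolding mean_def by (rule integral_prod_continuous[OF cont])
  also have "\<dots> = 0" using line[OF ab_in_lat(2)] by (simp add: pt_def)
  finally have b: "mean (\<lambda>z. D z b) = 0" .
  have "mean (\<lambda>z. D z a) = integral (cbox 0 1) (\<lambda>s. integral (cbox 0 1) (\<lambda>t. D (pt (s, t)) a))"
    unfolding mean_def by (rule integral_prod_continuous[OF cont])
  also have "\<dots> = integral (cbox 0 1) (\<lambda>t. integral (cbox 0 1) (\<lambda>s. D (pt (s, t)) a))"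
    by (rule integral_swap_continuous) (use cont in \<open>simp add: case_prod_beta\<close>)
  also have "\<dots> = 0" using line[OF ab_in_lat(1)] by (simp add: pt_def add.commute)
  finally have a: "mean (\<lambda>z. D z a) = 0" .
  have "D z v = (a' \<bullet> v) *\<^sub>R D z a + (b' \<bullet> v) *\<^sub>R D z b" for z
    using linear_add[OF has_derivative_linear[OF D]] linear_cmul[OF has_derivative_linear[OF D]] coords[of v]
    by metis
  then have "mean (\<lambda>z. D z v) = mean (\<lambda>z. (a' \<bullet> v) *\<^sub>R D z a + (b' \<bullet> v) *\<^sub>R D z b)" by simp
  also have "\<dots> = 0"
    by (subst mean_add) (simp_all add: mean_scaleR a b c continuous_on_scaleR)
  finally show ?thesis .
qed


subsection \<open>Completeness of the trigonometric system\<close>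

definition orth :: "(complex \<Rightarrow> real) \<Rightarrow> bool" where
  "orth h \<longleftrightarrow> continuous_on UNIV h \<and>
     (\<forall>\<delta>\<in>dual_lat. mean (\<lambda>z. h z * cos (2 * pi * (\<delta> \<bullet> z))) = 0 \<and>
                   mean (\<lambda>z. h z * sin (2 * pi * (\<delta> \<bullet> z))) = 0)"

lemma orth_add: "orth h \<Longrightarrow> orth g \<Longrightarrow> orth (\<lambda>z. h z + g z)"
  unfolding orth_def by (auto simp: distrib_right mean_add continuous_intros)

lemma orth_scale: "orth h \<Longrightarrow> orth (\<lambda>z. h z * c)"
proof -
  assume h: "orth h"
  have "(\<lambda>z. h z * c * g z) = (\<lambda>z. c * (h z * g z))" for g by auto
  with h show ?thesis unfolding orth_def by (auto simp: mean_mult_left intro!: continuous_intros)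
qed

text \<open>
  Products of characters are combinations of the characters of the sum and the difference
  of their frequencies.
\<close>

lemma orth_trig:
  assumes h: "orth h" and "\<eta> \<in> dual_lat"
  shows "orth (\<lambda>z. h z * cos (2 * pi * (\<eta> \<bullet> z)))" "orth (\<lambda>z. h z * sin (2 * pi * (\<eta> \<bullet> z)))"
proof -
  have c: "continuous_on UNIV h" using h by (simp add: orth_def)
  have "mean (\<lambda>z. h z * f (\<eta> \<bullet> z) * g (\<delta> \<bullet> z)) = 0"
    if "\<delta> \<in> dual_lat" and fg: "f = (\<lambda>s. cos (2 * pi * s)) \<or> f = (\<lambda>s. sin (2 * pi * s))"
      "g = (\<lambda>s. cos (2 * pi * s)) \<or> g = (\<lambda>s. sin (2 * pi * s))" for \<delta> and f g :: "real \<Rightarrow> real"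
  proof -
    let ?C = "\<lambda>\<delta> z. h z * cos (2 * pi * (\<delta> \<bullet> z))" and ?S = "\<lambda>\<delta> z. h z * sin (2 * pi * (\<delta> \<bullet> z))"
    have m: "mean (?C \<kappa>) = 0" "mean (?S \<kappa>) = 0" if "\<kappa> \<in> {\<eta> - \<delta>, \<eta> + \<delta>}" for \<kappa>
      using h that \<open>\<delta> \<in> dual_lat\<close> \<open>\<eta> \<in> dual_lat\<close> dual_lat_simps by (auto simp: orth_def)
    have k: "continuous_on UNIV (?C \<kappa>)" "continuous_on UNIV (?S \<kappa>)" for \<kappa>
      by (intro continuous_intros c)+
    have lin: "mean (\<lambda>z. q * F z + r * G z) = 0"
      if "mean F = 0" "mean G = 0" "continuous_on UNIV F" "continuous_on UNIV G"
      for F G and q r :: real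
      using that by (subst mean_add) (simp_all add: mean_mult_left continuous_on_mult_left)
    have e: "(\<lambda>z. ?C \<eta> z * cos (2 * pi * (\<delta> \<bullet> z))) = (\<lambda>z. (1/2) * ?C (\<eta> - \<delta>) z + (1/2) * ?C (\<eta> + \<delta>) z)"
      "(\<lambda>z. ?C \<eta> z * sin (2 * pi * (\<delta> \<bullet> z))) = (\<lambda>z. (1/2) * ?S (\<eta> + \<delta>) z + (-1/2) * ?S (\<eta> - \<delta>) z)"
      "(\<lambda>z. ?S \<eta> z * cos (2 * pi * (\<delta> \<bullet> z))) = (\<lambda>z. (1/2) * ?S (\<eta> + \<delta>) z + (1/2) * ?S (\<eta> - \<delta>) z)"
      "(\<lambda>z. ?S \<eta> z * sin (2 * pi * (\<delta> \<bullet> z))) = (\<lambda>z. (1/2) * ?C (\<eta> - \<delta>) z + (-1/2) * ?C (\<eta> + \<delta>) z)"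
      by (auto simp: fun_eq_iff inner_add_left inner_diff_left ring_distribs cos_add cos_diff sin_add sin_diff)
    have "mean (\<lambda>z. ?C \<eta> z * cos (2 * pi * (\<delta> \<bullet> z))) = 0" "mean (\<lambda>z. ?S \<eta> z * sin (2 * pi * (\<delta> \<bullet> z))) = 0"
      unfolding e by (rule lin[OF m(1) m(1) k(1) k(1)]; simp)+
    moreover have "mean (\<lambda>z. ?C \<eta> z * sin (2 * pi * (\<delta> \<bullet> z))) = 0" "mean (\<lambda>z. ?S \<eta> z * cos (2 * pi * (\<delta> \<bullet> z))) = 0"
      unfolding e by (rule lin[OF m(2) m(2) k(2) k(2)]; simp)+
    ultimately show ?thesis using fg by auto
  qed
  from this[of _ "\<lambda>s. cos (2 * pi * s)" "\<lambda>s. cos (2 * pi * s)"]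
    this[of _ "\<lambda>s. cos (2 * pi * s)" "\<lambda>s. sin (2 * pi * s)"]
    this[of _ "\<lambda>s. sin (2 * pi * s)" "\<lambda>s. cos (2 * pi * s)"]
    this[of _ "\<lambda>s. sin (2 * pi * s)" "\<lambda>s. sin (2 * pi * s)"]
  show "orth (\<lambda>z. h z * cos (2 * pi * (\<eta> \<bullet> z)))" "orth (\<lambda>z. h z * sin (2 * pi * (\<eta> \<bullet> z)))"
    unfolding orth_def using c by (auto intro!: continuous_intros)
qed

definition torus_point :: "complex \<Rightarrow> complex \<times> complex" where
  "torus_point z = (cis (2 * pi * (a' \<bullet> z)), cis (2 * pi * (b' \<bullet> z)))"

text \<open>
  The coordinates of \<open>torus_point z\<close> are cosines and sines, so \<open>orth_trig\<close> covers linear \<open>p\<close>;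
  multiplying by the factors of a product one after the other covers all polynomials.
\<close>

lemma orth_polynomial:
  assumes "real_polynomial_function p" "orth h"
  shows "orth (\<lambda>z. h z * p (torus_point z))"
  using assms
proof (induction p arbitrary: h)
  case (linear p)
  have expand: "p (torus_point z) = cos (2 * pi * (a' \<bullet> z)) * p (1, 0) + sin (2 * pi * (a' \<bullet> z)) * p (\<i>, 0)
    + cos (2 * pi * (b' \<bullet> z)) * p (0, 1) + sin (2 * pi * (b' \<bullet> z)) * p (0, \<i>)" for z
  proof -
    have "torus_point z = cos (2 * pi * (a' \<bullet> z)) *\<^sub>R (1, 0) + sin (2 * pi * (a' \<bullet> z)) *\<^sub>R (\<i>, 0)
      + cos (2 * pi * (b' \<bullet> z)) *\<^sub>R (0, 1) + sin (2 * pi * (b' \<bullet> z)) *\<^sub>R (0, \<i>)"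
      by (simp add: torus_point_def complex_eq_iff)
    then show ?thesis
      by (simp only: linear_add[OF bounded_linear.linear[OF linear.hyps]]
          linear_cmul[OF bounded_linear.linear[OF linear.hyps]] real_scaleR_def)
  qed
  show ?case
    unfolding expand distrib_left mult.assoc[symmetric]
    by (intro orth_add orth_scale orth_trig linear.prems dual_lat_simps)
next
  case (const c)
  then show ?case by (rule orth_scale)
next
  case (add f g)
  then show ?case by (simp add: distrib_left orth_add)
next
  case (mult f g)
  then show ?case by (simp add: mult.assoc[symmetric])
qed

lemma torus_point_eq_imp:
  assumes "torus_point z = torus_point w" and h: "periodic h"
  shows "h z = h w"
proof -
  have int: "\<exists>k::int. s = t + k" if "cis (2 * pi * s) = cis (2 * pi * t)" for s t :: real
  proof -
    have "sin (2 * pi * s) = sin (2 * pi * t) \<and> cos (2 * pi * s) = cos (2 * pi * t)"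
      using that by (simp add: cis.code complex_eq_iff)
    then obtain n :: int where "2 * pi * s = 2 * pi * t + 2 * pi * n"
      unfolding sin_cos_eq_iff by blast
    then have "2 * pi * (s - (t + n)) = 0" by (simp add: algebra_simps)
    then show ?thesis by auto
  qed
  obtain k l :: int where "a' \<bullet> z = a' \<bullet> w + k" "b' \<bullet> z = b' \<bullet> w + l"
    using assms(1) int unfolding torus_point_def by blast
  then have "z = w + (of_int k * a + of_int l * b)"
    using coords[of z] coords[of w] by (simp add: scaleR_conv_of_real algebra_simps)
  moreover have "of_int k * a + of_int l * b \<in> lat" unfolding lat_def by blast
  ultimately show ?thesis using h by (simp add: periodic_def)
qed

text \<open>
  A continuous function on the torus is uniformly close to a trigonometric polynomial by
  Stone--Weierstrass; if it is orthogonal to all of these, its square has mean value 0.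
\<close>

lemma orth_imp_zero:
  assumes h: "periodic h" and o: "orth h"
  shows "h z = 0"
proof -
  let ?K = "pt ` square"
  have c: "continuous_on S h" for S using o by (auto simp: orth_def intro: continuous_on_subset)
  have K: "compact ?K" by (intro compact_continuous_image continuous_pt compact_cbox)
  have cont_torus_point: "continuous_on S torus_point" for S unfolding torus_point_def by (intro continuous_intros)
  define H where "H u = h (inv_into ?K torus_point u)" for u
  have H: "H (torus_point z) = h z" if "z \<in> ?K" for z
    unfolding H_def using that by (intro torus_point_eq_imp[OF _ h] f_inv_into_f) auto
  \<comment> \<open>\<open>H\<close> is \<open>h\<close> seen as a function on the torus in \<open>\<complex> \<times> \<complex>\<close>; its graph is the compact image of \<open>?K\<close>.\<close>
  have "continuous_on (torus_point ` ?K) H"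
  proof (rule continuous_from_closed_graph)
    show "compact (h ` ?K)" by (intro compact_continuous_image c K)
    show "H \<in> torus_point ` ?K \<rightarrow> h ` ?K" using H by auto
    have "(\<lambda>x. (x, H x)) ` torus_point ` ?K = (\<lambda>z. (torus_point z, h z)) ` ?K"
      unfolding image_comp by (intro image_cong refl) (simp add: H)
    moreover have "compact ((\<lambda>z. (torus_point z, h z)) ` ?K)"
      by (intro compact_continuous_image continuous_on_Pair c cont_torus_point K)
    ultimately show "closed ((\<lambda>x. (x, H x)) ` torus_point ` ?K)" by (simp add: compact_imp_closed)
  qed
  moreover have "compact (torus_point ` ?K)" by (intro compact_continuous_image cont_torus_point K)
  ultimately have approx: "\<exists>p. real_polynomial_function p \<and> (\<forall>z\<in>?K. \<bar>h z - p (torus_point z)\<bar> < e)" if "e > 0" for e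
    using Stone_Weierstrass_real_polynomial_function[OF _ _ that, of "torus_point ` ?K" H] H
    by (metis imageI)
  have "bounded (h ` ?K)" by (intro compact_imp_bounded compact_continuous_image c K)
  then obtain B where B: "B > 0" "\<And>z. z \<in> ?K \<Longrightarrow> \<bar>h z\<bar> \<le> B"
    by (auto simp: bounded_pos)
  have small: "norm (mean (\<lambda>z. h z * h z)) \<le> B * e" if e: "e > 0" for e
  proof -
    obtain p where p: "real_polynomial_function p" "\<And>z. z \<in> ?K \<Longrightarrow> \<bar>h z - p (torus_point z)\<bar> < e"
      using approx[OF e] by blast
    note op = orth_polynomial[OF p(1) o]
    have c2: "continuous_on UNIV (\<lambda>z. h z * p (torus_point z))" using op by (simp add: orth_def)
    have "continuous_on UNIV (\<lambda>z. h z * h z + (-1) * (h z * p (torus_point z)))"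
      by (intro continuous_intros c c2)
    then have "norm (mean (\<lambda>z. h z * h z + (-1) * (h z * p (torus_point z)))) \<le> B * e"
    proof (rule norm_mean_le)
      fix x assume "x \<in> square"
      then have x: "pt x \<in> ?K" by blast
      have "h (pt x) * h (pt x) + (-1) * (h (pt x) * p (torus_point (pt x))) = h (pt x) * (h (pt x) - p (torus_point (pt x)))"
        by (simp add: algebra_simps)
      also have "norm \<dots> \<le> B * e"
        unfolding norm_mult using B(2)[OF x] p(2)[OF x] B(1) by (intro mult_mono) auto
      finally show "norm (h (pt x) * h (pt x) + (-1) * (h (pt x) * p (torus_point (pt x)))) \<le> B * e" .
    qed
    moreover have "mean (\<lambda>z. h z * p (torus_point z)) = 0"
      using op dual_lat_simps(3) by (auto simp: orth_def)
    moreover have "mean (\<lambda>z. h z * h z + (-1) * (h z * p (torus_point z))) = mean (\<lambda>z. h z * h z) + (-1) * mean (\<lambda>z. h z * p (torus_point z))"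
      by (subst mean_add) (auto simp only: mean_mult_left intro!: continuous_intros c c2)
    ultimately show ?thesis by simp
  qed
  have "norm (mean (\<lambda>z. h z * h z)) \<le> 0"
  proof (rule field_le_epsilon)
    fix e :: real assume "e > 0"
    then show "norm (mean (\<lambda>z. h z * h z)) \<le> 0 + e" using small[of "e / B"] B(1) by simp
  qed
  then have "integral square (\<lambda>x. h (pt x) * h (pt x)) = 0" by (simp add: mean_def)
  moreover have "continuous_on square (\<lambda>x. h (pt x) * h (pt x))"
    by (intro continuous_intros continuous_on_compose2[OF c continuous_pt]) auto
  ultimately have zero: "h (pt x) = 0" if "x \<in> square" for x
    using integral_cbox_eq_0_iff[of "(0,0)" "(1,1)" "\<lambda>x. h (pt x) * h (pt x)"] that
    by (auto simp: box_ne_empty Basis_prod_def)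
  define x where "x = (frac (a' \<bullet> z), frac (b' \<bullet> z))"
  have "x \<in> square"
    unfolding x_def cbox_Pair_eq using frac_lt_1 frac_ge_0 less_imp_le by auto
  moreover have "torus_point (pt x) = torus_point z"
  proof -
    have "cis (2 * pi * frac t) = cis (2 * pi * t)" for t
    proof -
      have "cis (2 * pi * t) = cis (2 * pi * frac t) * cis (2 * pi * of_int \<lfloor>t\<rfloor>)"
        by (simp add: cis_mult frac_def algebra_simps)
      also have "cis (2 * pi * of_int \<lfloor>t\<rfloor>) = 1" by (rule cis_multiple_2pi) simp
      finally show ?thesis by simp
    qed
    then show ?thesis by (simp add: torus_point_def x_def coords_pt)
  qed
  ultimately show ?thesis using zero[of x] torus_point_eq_imp[OF _ h, of "pt x" z] by simp
qed


subsection \<open>Fourier coefficients of maps into \<open>\<real>\<^sup>4\<close>\<close>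

text \<open>
  \<open>J\<close> plays the role of the imaginary unit, so that \<open>rot (2 * pi * (\<delta> \<bullet> z))\<close> is the character
  of frequency \<open>\<delta>\<close>.
\<close>

definition fourier :: "complex \<Rightarrow> (complex \<Rightarrow> real^4) \<Rightarrow> real^4" where
  "fourier \<delta> f = mean (\<lambda>z. rot (- (2 * pi * (\<delta> \<bullet> z))) (f z))"

lemma fourier_add: "continuous_on UNIV f \<Longrightarrow> continuous_on UNIV g \<Longrightarrow>
    fourier \<delta> (\<lambda>z. f z + g z) = fourier \<delta> f + fourier \<delta> g"
  unfolding fourier_def by (simp add: linear_add[OF linear_rot] mean_add continuous_intros)

lemma fourier_scaleR: "fourier \<delta> (\<lambda>z. c *\<^sub>R f z) = c *\<^sub>R fourier \<delta> f"
  unfolding fourier_def by (simp add: linear_cmul[OF linear_rot] mean_scaleR)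

lemma norm_fourier_le:
  assumes "continuous_on UNIV f" "\<And>z. norm (f z) \<le> B"
  shows "norm (fourier \<delta> f) \<le> 2 * B"
  unfolding fourier_def
  by (intro norm_mean_le continuous_intros assms order.trans[OF norm_rot_le] mult_left_mono) simp

text \<open>
  The coefficients at \<open>\<delta>\<close> and \<open>- \<delta>\<close> together give the mean values of \<open>cos\<close> and \<open>sin\<close> times \<open>f\<close>,
  so that each real component of \<open>f\<close> is orthogonal to all characters.
\<close>

lemma fourier_eq_0_imp:
  assumes c: "continuous_on UNIV f" and p: "periodic f" and 0: "\<And>\<delta>. \<delta> \<in> dual_lat \<Longrightarrow> fourier \<delta> f = 0"
  shows "f z = 0"
proof -
  have *: "mean (\<lambda>z. cos (2 * pi * (\<delta> \<bullet> z)) *\<^sub>R f z) = 0 \<and> mean (\<lambda>z. sin (2 * pi * (\<delta> \<bullet> z)) *\<^sub>R f z) = 0"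
    if "\<delta> \<in> dual_lat" for \<delta>
  proof -
    let ?C = "\<lambda>z. cos (2 * pi * (\<delta> \<bullet> z)) *\<^sub>R f z" and ?S = "\<lambda>z. sin (2 * pi * (\<delta> \<bullet> z)) *\<^sub>R f z"
    have cont: "continuous_on UNIV ?C" "continuous_on UNIV ?S" "continuous_on UNIV (\<lambda>z. J *v ?S z)"
      by (intro continuous_intros c)+
    have lin: "linear (\<lambda>v. r *\<^sub>R (J *v v))" for r
      by (auto intro!: linearI simp: matrix_vector_right_distrib matrix_vector_mult_scaleR algebra_simps)
    have "fourier \<kappa> f = mean ?C + r *\<^sub>R (J *v mean ?S)"
      if \<kappa>: "\<And>z. cos (2 * pi * (\<kappa> \<bullet> z)) = cos (2 * pi * (\<delta> \<bullet> z))"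
        "\<And>z. - sin (2 * pi * (\<kappa> \<bullet> z)) = r * sin (2 * pi * (\<delta> \<bullet> z))" for \<kappa> r
    proof -
      have "fourier \<kappa> f = mean (\<lambda>z. ?C z + r *\<^sub>R (J *v ?S z))"
        unfolding fourier_def rot_def by (simp add: \<kappa> matrix_vector_mult_scaleR)
      also have "\<dots> = mean ?C + mean (\<lambda>z. r *\<^sub>R (J *v ?S z))"
        by (rule mean_add) (intro cont continuous_intros)+
      also have "mean (\<lambda>z. r *\<^sub>R (J *v ?S z)) = r *\<^sub>R (J *v mean ?S)"
        by (rule mean_linear[OF cont(2) lin])
      finally show ?thesis .
    qed
    from this[of \<delta> "-1"] this[of "- \<delta>" 1]
    have "fourier \<delta> f = mean ?C - J *v mean ?S" "fourier (- \<delta>) f = mean ?C + J *v mean ?S"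
      by simp_all
    moreover have "fourier \<delta> f = 0" "fourier (- \<delta>) f = 0" using 0 that dual_lat_simps by blast+
    ultimately have eq: "mean ?C = J *v mean ?S" "mean ?C + J *v mean ?S = 0" by simp_all
    then have "mean ?C + mean ?C = 0" by simp
    then have "2 *\<^sub>R mean ?C = 0" unfolding scaleR_2 .
    then have "mean ?C = 0" by (simp only: scaleR_eq_0_iff) simp
    moreover have "mean ?S = 0" using eq(1) \<open>mean ?C = 0\<close> norm_J[of "mean ?S"] by simp
    ultimately show ?thesis by simp
  qed
  have "f z $ k = 0" for k
  proof (rule orth_imp_zero)
    show "periodic (\<lambda>z. f z $ k)" using p by (simp add: periodic_def)
    have "linear (\<lambda>v::real^4. v $ k)" by (rule bounded_linear.linear[OF bounded_linear_vec_nth])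
    note l = mean_linear[OF _ this]
    show "orth (\<lambda>z. f z $ k)"
      unfolding orth_def
    proof (intro conjI ballI)
      show "continuous_on UNIV (\<lambda>z. f z $ k)" by (intro continuous_intros c)
      fix \<delta> assume \<delta>: "\<delta> \<in> dual_lat"
      have "continuous_on UNIV (\<lambda>z. cos (2 * pi * (\<delta> \<bullet> z)) *\<^sub>R f z)"
        "continuous_on UNIV (\<lambda>z. sin (2 * pi * (\<delta> \<bullet> z)) *\<^sub>R f z)"
        by (intro continuous_intros c)+
      from this[THEN l] show "mean (\<lambda>z. f z $ k * cos (2 * pi * (\<delta> \<bullet> z))) = 0"
        "mean (\<lambda>z. f z $ k * sin (2 * pi * (\<delta> \<bullet> z))) = 0"
        using *[OF \<delta>] by (simp_all add: mult.commute)
    qed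
  qed
  then show ?thesis by (simp add: vec_eq_iff)
qed

lemma periodic_character: "\<delta> \<in> dual_lat \<Longrightarrow> \<omega> \<in> lat \<Longrightarrow>
    rot (- (2 * pi * (\<delta> \<bullet> (z + \<omega>)))) v = rot (- (2 * pi * (\<delta> \<bullet> z))) v"
proof -
  assume "\<delta> \<in> dual_lat" "\<omega> \<in> lat"
  then have "\<delta> \<bullet> \<omega> \<in> \<int>" by (simp add: dual_lat_def dual_lattice_def)
  then obtain k :: int where "\<delta> \<bullet> \<omega> = k" by (auto elim: Ints_cases)
  then have "rot (- (2 * pi * (\<delta> \<bullet> \<omega>))) v = v" for v
    by (simp add: rot_def)
  moreover have "rot (- (2 * pi * (\<delta> \<bullet> (z + \<omega>)))) v
      = rot (- (2 * pi * (\<delta> \<bullet> \<omega>))) (rot (- (2 * pi * (\<delta> \<bullet> z))) v)"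
    by (simp add: rot_rot inner_add_right algebra_simps)
  ultimately show ?thesis by simp
qed

text \<open>
  Integration by parts: the derivative of the periodic map \<open>rot (- (2 * pi * (\<delta> \<bullet> z))) (f z)\<close> has mean value 0.
\<close>

lemma fourier_derivative:
  assumes p: "periodic f" and D: "\<And>z. (f has_derivative D z) (at z)"
    and c: "\<And>v. continuous_on UNIV (\<lambda>z. D z v)" and \<delta>: "\<delta> \<in> dual_lat"
  shows "fourier \<delta> (\<lambda>z. D z v) = (2 * pi * (\<delta> \<bullet> v)) *\<^sub>R (J *v fourier \<delta> f)"
proof -
  let ?r = "\<lambda>z. rot (- (2 * pi * (\<delta> \<bullet> z)))"
  have cf: "continuous_on UNIV f"
    using D by (auto simp: continuous_on_eq_continuous_at intro: has_derivative_continuous)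
  let ?E = "\<lambda>z v. (- (2 * pi * (\<delta> \<bullet> v))) *\<^sub>R (J *v ?r z (f z)) + ?r z (D z v)"
  have cont: "continuous_on UNIV (\<lambda>z. ?r z (f z))" "continuous_on UNIV (\<lambda>z. ?r z (D z v))" for v
    by (intro continuous_intros cf c)+
  then have contJ: "continuous_on UNIV (\<lambda>z. s *\<^sub>R (J *v ?r z (f z)))" for s
    by (intro continuous_intros cf)
  have "mean (\<lambda>z. ?E z v) = 0"
  proof (rule mean_derivative)
    show "periodic (\<lambda>z. ?r z (f z))"
      unfolding periodic_def using p \<delta> by (simp add: periodic_def periodic_character)
    show "((\<lambda>z. ?r z (f z)) has_derivative ?E z) (at z)" for z
      by (rule has_derivative_rot[OF _ D]) (auto intro!: derivative_eq_intros)
    show "continuous_on UNIV (\<lambda>z. ?E z v)" for v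
      by (intro continuous_intros contJ cont)
  qed
  moreover have "linear (\<lambda>x. (- (2 * pi * (\<delta> \<bullet> v))) *\<^sub>R (J *v x))"
    by (auto intro!: linearI simp: matrix_vector_right_distrib matrix_vector_mult_scaleR algebra_simps)
  note mean_linear[OF cont(1) this]
  ultimately have "0 = (- (2 * pi * (\<delta> \<bullet> v))) *\<^sub>R (J *v fourier \<delta> f) + fourier \<delta> (\<lambda>z. D z v)"
    unfolding fourier_def by (simp only: mean_add[OF contJ cont(2)])
  then show ?thesis by (simp add: eq_neg_iff_add_eq_0[symmetric])
qed

text \<open>
  \<open>L\<close> anticommutes with \<open>J\<close> and thus reverses the sign of frequencies.
\<close>

lemma fourier_rot_L:
  assumes "continuous_on UNIV g"
  shows "fourier \<delta> (\<lambda>z. rot (2 * pi * (\<beta> \<bullet> z)) (L *v g z)) = L *v fourier (\<beta> - \<delta>) g"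
proof -
  have "rot (- (2 * pi * (\<delta> \<bullet> z))) (rot (2 * pi * (\<beta> \<bullet> z)) (L *v g z))
      = L *v rot (- (2 * pi * ((\<beta> - \<delta>) \<bullet> z))) (g z)" for z
    by (simp add: rot_rot L_rot inner_diff_left algebra_simps)
  moreover have "continuous_on UNIV (\<lambda>z. rot (- (2 * pi * ((\<beta> - \<delta>) \<bullet> z))) (g z))"
    by (intro continuous_intros assms)
  note mean_linear[OF this matrix_vector_mul_linear[of L]]
  ultimately show ?thesis
    unfolding fourier_def by simp
qed

text \<open>
  For \<open>\<delta> \<noteq> \<eta>\<close> this is a coefficient of a constant at a nonzero frequency, and it vanishes
  because the derivative of the constant does.
\<close>

lemma fourier_character:
  assumes "\<delta> \<in> dual_lat" "\<eta> \<in> dual_lat"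
  shows "fourier \<delta> (\<lambda>z. rot (2 * pi * (\<eta> \<bullet> z)) c) = (if \<delta> = \<eta> then c else 0)"
proof (cases "\<delta> = \<eta>")
  case True
  then show ?thesis by (simp add: fourier_def rot_rot mean_const)
next
  case False
  let ?f = "\<lambda>z :: complex. - (J *v c)" and ?\<kappa> = "\<delta> - \<eta>"
  have \<kappa>: "?\<kappa> \<in> dual_lat" using assms dual_lat_simps by blast
  have "fourier ?\<kappa> (\<lambda>z. 0 :: real^4) = (2 * pi * (?\<kappa> \<bullet> ?\<kappa>)) *\<^sub>R (J *v fourier ?\<kappa> (\<lambda>z. c))"
    by (rule fourier_derivative[OF _ _ _ \<kappa>, where D="\<lambda>z v. 0"]) (auto simp: periodic_def)
  moreover have "fourier ?\<kappa> (\<lambda>z. 0 :: real^4) = 0"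
    using fourier_scaleR[of ?\<kappa> 0 "\<lambda>z. 0"] by simp
  ultimately have "norm (J *v fourier ?\<kappa> (\<lambda>z. c)) = 0" using False by simp
  then have "fourier ?\<kappa> (\<lambda>z. c) = 0" by (simp only: norm_J norm_eq_zero)
  moreover have "fourier \<delta> (\<lambda>z. rot (2 * pi * (\<eta> \<bullet> z)) c) = fourier ?\<kappa> (\<lambda>z. c)"
    unfolding fourier_def by (simp add: rot_rot inner_diff_left algebra_simps)
  ultimately show ?thesis using False by simp
qed

end


section \<open>Interpolation at the frequencies\<close>

text \<open>
  The fundamental polynomial of the node \<open>s\<close> among the nodes in \<open>insert 0 S\<close>: the factor \<open>[:0, 1:]\<close>
  makes it vanish at 0.
\<close>

definition lagrange :: "complex set \<Rightarrow> complex \<Rightarrow> complex poly" where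
  "lagrange S s = smult (1 / (s * (\<Prod>t\<in>S - {s}. s - t))) ([:0, 1:] * (\<Prod>t\<in>S - {s}. [:- t, 1:]))"

lemma poly_lagrange:
  "poly (lagrange S s) u = u * (\<Prod>t\<in>S - {s}. u - t) / (s * (\<Prod>t\<in>S - {s}. s - t))"
  by (simp add: lagrange_def poly_prod)

lemma poly_lagrange_node:
  assumes "finite S" "s \<in> S" "t \<in> S" "s \<noteq> 0"
  shows "poly (lagrange S s) t = (if t = s then 1 else 0)"
proof (cases "t = s")
  case True
  have "(\<Prod>t\<in>S - {s}. s - t) \<noteq> 0" using assms(1) by (simp add: prod_zero_iff)
  then show ?thesis using True assms(4) by (simp add: poly_lagrange)
next
  case False
  then have "(\<Prod>r\<in>S - {s}. t - r) = 0" using assms by (auto simp: prod_zero_iff)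
  then show ?thesis using False by (simp add: poly_lagrange)
qed

lemma degree_lagrange:
  assumes "finite S" "s \<in> S"
  shows "degree (lagrange S s) \<le> card S"
proof -
  have "degree (\<Prod>t\<in>S - {s}. [:- t, 1:]) = card (S - {s})"
    by (subst degree_prod_eq_sum_degree) (auto simp: one_poly_def)
  moreover have "card S = Suc (card (S - {s}))" using card.remove[OF assms] .
  moreover have "degree (lagrange S s) \<le> degree ([:0, 1:] * (\<Prod>t\<in>S - {s}. [:- t, 1:]))"
    unfolding lagrange_def by (rule degree_smult_le)
  moreover have "\<dots> \<le> degree [:0, 1::complex:] + degree (\<Prod>t\<in>S - {s}. [:- t, 1:])"
    by (rule degree_mult_le)
  ultimately show ?thesis by simp
qed

definition interpolates :: "complex set \<Rightarrow> (complex \<Rightarrow> complex^4) \<Rightarrow> complex poly^4 \<Rightarrow> bool" where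
  "interpolates S v y \<longleftrightarrow>
     (\<forall>k. degree (y $ k) \<le> card S) \<and> peval y 0 = 0 \<and> (\<forall>s\<in>S. peval y s = v s)"

lemma interpolates_unique:
  assumes S: "finite S" "0 \<notin> S" and "interpolates S v y" "interpolates S v y'"
  shows "y = y'"
proof -
  have "y $ k = y' $ k" for k
  proof (rule poly_eqI_degree)
    fix t assume "t \<in> insert 0 S"
    then have "peval y t = peval y' t" using assms by (auto simp: interpolates_def)
    then show "poly (y $ k) t = poly (y' $ k) t" by (simp add: peval_def vec_eq_iff)
  qed (use assms in \<open>auto simp: interpolates_def le_imp_less_Suc\<close>)
  then show ?thesis by (simp add: vec_eq_iff)
qed

lemma interpolates_lagrange:
  assumes S: "finite S" "0 \<notin> S"
  shows "interpolates S v (\<chi> k. \<Sum>s\<in>S. smult (v s $ k) (lagrange S s))" (is "interpolates S v ?y")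
proof -
  have "degree (?y $ k) \<le> card S" for k
    using degree_lagrange[OF S(1)] order.trans[OF degree_smult_le]
    by (auto intro!: degree_sum_le S)
  moreover have "peval ?y 0 = 0"
    by (simp add: peval_def poly_sum poly_lagrange vec_eq_iff)
  moreover have "peval ?y t = v t" if "t \<in> S" for t
  proof -
    have "(\<Sum>s\<in>S. v s $ k * poly (lagrange S s) t) = v t $ k" for k
    proof -
      have "(\<Sum>s\<in>S. v s $ k * poly (lagrange S s) t) = (\<Sum>s\<in>S. if t = s then v s $ k else 0)"
        by (intro sum.cong refl) (subst poly_lagrange_node, use S that in auto)
      then show ?thesis using S that by simp
    qed
    then show ?thesis by (simp add: peval_def poly_sum vec_eq_iff)
  qed
  ultimately show ?thesis unfolding interpolates_def by blast
qed

lemma the_interpolates: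
  assumes "finite S" "0 \<notin> S"
  shows "interpolates S v (THE y. interpolates S v y)"
proof (rule theI)
  show "interpolates S v (\<chi> k. \<Sum>s\<in>S. smult (v s $ k) (lagrange S s))"
    by (rule interpolates_lagrange[OF assms])
  then show "y = (\<chi> k. \<Sum>s\<in>S. smult (v s $ k) (lagrange S s))" if "interpolates S v y" for y
    by (rule interpolates_unique[OF assms that])
qed

lemma peval_interpolates:
  assumes S: "finite S" "0 \<notin> S" and "interpolates S v y"
  shows "peval y t = (\<Sum>s\<in>S. poly (lagrange S s) t *s v s)"
proof -
  have "y = (\<chi> k. \<Sum>s\<in>S. smult (v s $ k) (lagrange S s))"
    using interpolates_unique[OF S assms(3) interpolates_lagrange[OF S]] .
  then show ?thesis by (simp add: peval_def poly_sum vec_eq_iff mult.commute)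
qed


section \<open>Reality of the coefficients\<close>

text \<open>
  The roots of the polynomial \<open>p\<close>, of even degree and symmetric under \<open>s \<mapsto> - s\<close>, on the unit circle.
\<close>

locale unit_roots =
  fixes S :: "complex set"
  assumes finite: "finite S" and unit: "\<And>s. s \<in> S \<Longrightarrow> cmod s = 1"
    and neg: "\<And>s. s \<in> S \<Longrightarrow> - s \<in> S" and not_1: "1 \<notin> S" and even: "even (card S)"
begin

lemma nonzero: "s \<in> S \<Longrightarrow> s \<noteq> 0" "0 \<notin> S"
  using unit by force+

lemma not_minus_1: "- 1 \<notin> S"
  using neg[of "- 1"] not_1 by auto

lemma cnj_root: "s \<in> S \<Longrightarrow> cnj s = 1 / s"
  using unit[of s] complex_norm_square[of s] nonzero(1)[of s] by (simp add: field_simps)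

text \<open>
  The factor with which the value at the node \<open>s\<close> enters \<open>x(1) / p(1)\<close>, see \<open>lagrange_at_1\<close>.
\<close>

definition weight :: "complex \<Rightarrow> complex" where
  "weight s = 1 / (s * (1 - s) * (\<Prod>t\<in>S - {s}. s - t))"

text \<open>
  For \<open>s = e\<^sup>i\<^sup>\<theta>\<close> this is \<open>- tan (\<theta> / 2)\<close>.
\<close>

definition ratio :: "complex \<Rightarrow> complex" where
  "ratio s = - \<i> * (1 - s) / (1 + s)"

lemma prod_diff_nonzero: "(\<Prod>t\<in>S - {s}. s - t) \<noteq> 0"
  using finite by (simp add: prod_zero_iff)

lemma odd_rest: "s \<in> S \<Longrightarrow> (- 1 :: complex) ^ card (S - {s}) = - 1"
proof -
  assume "s \<in> S"
  then have "odd (card (S - {s}))" using even card.remove[OF finite] by (metis even_Suc)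
  then show ?thesis by (rule power_minus_odd[of _ 1, simplified])
qed

lemma lagrange_at_1:
  assumes s: "s \<in> S"
  shows "1 / (\<Prod>t\<in>S. 1 - t) * poly (lagrange S s) 1 = weight s"
proof -
  have "(\<Prod>t\<in>S. 1 - t) = (1 - s) * (\<Prod>t\<in>S - {s}. 1 - t)"
    by (rule prod.remove[OF finite s])
  moreover have "(\<Prod>t\<in>S - {s}. 1 - t) \<noteq> 0" using finite not_1 by (auto simp: prod_zero_iff)
  moreover have "1 / (x * A) * (1 * A / (s * Q)) = 1 / (s * x * Q)" if "A \<noteq> 0" for x A Q :: complex
    using that by simp
  ultimately show ?thesis unfolding weight_def poly_lagrange by simp
qed

text \<open>
  Conjugation inverts numbers of modulus one, so it changes \<open>s * (1 - s) * (\<Prod>t. s - t)\<close> by a monomial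
  factor, which the square root \<open>\<rho>\<close> of \<open>(\<Prod>t. t) * s ^ (N + 1)\<close> compensates.
\<close>

lemma weight_real:
  assumes s: "s \<in> S" and \<rho>: "\<rho>\<^sup>2 = (\<Prod>t\<in>S. t) * s ^ (card S + 1)"
  shows "weight s * \<rho> \<in> \<real>" "weight s * \<rho> \<noteq> 0"
proof -
  let ?R = "S - {s}" let ?Q = "\<Prod>t\<in>?R. s - t" and ?P = "\<Prod>t\<in>S. t"
  have s0: "s \<noteq> 0" "1 - s \<noteq> 0" using nonzero s not_1 by auto
  note Q0 = prod_diff_nonzero[of s]
  have P0: "?P \<noteq> 0" using nonzero finite by (auto simp: prod_zero_iff)
  have card: "card S = Suc (card ?R)" using card.remove[OF finite s] .
  have P: "?P = s * \<Prod>?R" by (rule prod.remove[OF finite s])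
  have R0: "\<Prod>?R \<noteq> 0" using P P0 by auto
  have "cmod ?P = 1" by (simp add: prod_norm[symmetric] unit)
  then have "cmod (\<rho>\<^sup>2) = 1" unfolding \<rho> by (simp add: norm_mult norm_power unit s)
  then have "cmod \<rho> = 1 \<or> cmod \<rho> = - 1" by (simp add: norm_power power2_eq_1_iff)
  then have "cmod \<rho> = 1" using norm_ge_zero[of \<rho>] by linarith
  then have \<rho>0: "\<rho> \<noteq> 0" by auto
  have cnj_\<rho>: "cnj \<rho> = 1 / \<rho>"
    using complex_norm_square[of \<rho>] \<open>cmod \<rho> = 1\<close> \<rho>0 by (simp add: field_simps)
  have "cnj ?Q = (\<Prod>t\<in>?R. - 1 * (s - t) / (s * t))"
  proof (subst cnj_prod, intro prod.cong refl)
    fix t assume "t \<in> ?R"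
    then show "cnj (s - t) = - 1 * (s - t) / (s * t)"
      using s nonzero by (simp add: cnj_root field_simps)
  qed
  also have "\<dots> = (- 1) ^ card ?R * ?Q / (s ^ card ?R * \<Prod>?R)"
    by (simp only: prod_dividef prod.distrib prod_constant)
  also have "\<dots> = - ?Q * s\<^sup>2 / (s ^ card S * ?P)"
  proof -
    have "- 1 * Q / (c * R) = - Q * s\<^sup>2 / (s * c * (s * R))" for Q c R
      using s0 by (simp add: power2_eq_square)
    then show ?thesis unfolding odd_rest[OF s] card P power_Suc by blast
  qed
  finally have Q: "cnj ?Q = - ?Q * s\<^sup>2 / (s ^ card S * ?P)" .
  have "cnj (1 - s) = - (1 - s) / s" using s0 by (simp add: cnj_root s field_simps)
  moreover have "1 / (1 / s * (- u / s) * (- Q * s\<^sup>2 / (c * P))) * (1 / r) = (c * P) / (r * u * Q)"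
    for u Q c P r using s0 by (simp add: power2_eq_square)
  ultimately have "cnj (weight s * \<rho>) = (s ^ card S * ?P) / (\<rho> * (1 - s) * ?Q)"
    unfolding weight_def by (simp only: complex_cnj_mult complex_cnj_divide complex_cnj_one Q cnj_\<rho> cnj_root[OF s])
  also have "s ^ card S * ?P = \<rho>\<^sup>2 / s" using s0 by (simp add: \<rho>)
  also have "\<rho>\<^sup>2 / s / (\<rho> * (1 - s) * ?Q) = weight s * \<rho>"
    unfolding weight_def using \<rho>0 by (simp add: power2_eq_square)
  finally show "weight s * \<rho> \<in> \<real>" by (simp add: Reals_cnj_iff)
  show "weight s * \<rho> \<noteq> 0" unfolding weight_def using s0 Q0 \<rho>0 by simp
qed

lemma ratio_real:
  assumes s: "s \<in> S"
  shows "ratio s \<in> \<real>"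
proof -
  have s0: "s \<noteq> 0" using nonzero s by auto
  then have "1 - 1 / s = - (1 - s) / s" "1 + 1 / s = (1 + s) / s" by (simp_all add: field_simps)
  then have "cnj (ratio s) = \<i> * (- (1 - s) / s) / ((1 + s) / s)"
    unfolding ratio_def by (simp add: cnj_root[OF s])
  also have "\<dots> = ratio s"
  proof -
    have "\<i> * (- u / s) / (v / s) = - \<i> * u / v" for u v using s0 by simp
    then show ?thesis unfolding ratio_def by blast
  qed
  finally have "cnj (ratio s) = ratio s" .
  then show ?thesis by (simp add: Reals_cnj_iff)
qed

text \<open>
  The substitution \<open>t \<mapsto> - t\<close> changes the sign of all factors of \<open>\<Prod>t\<in>S - {s}. s - t\<close>, an odd number.
\<close>

lemma weight_neg:
  assumes s: "s \<in> S"
  shows "weight (- s) * (- \<i>) = weight s * ratio s"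
proof -
  have "1 - s \<noteq> 0" using s not_1 by auto
  moreover have "(\<Prod>t\<in>S - {- s}. - s - t) = (\<Prod>t\<in>S - {s}. - 1 * (s - t))"
    by (rule prod.reindex_bij_witness[of _ uminus uminus]) (use neg in auto)
  then have "(\<Prod>t\<in>S - {- s}. - s - t) = - (\<Prod>t\<in>S - {s}. s - t)"
    unfolding prod.distrib prod_constant odd_rest[OF s] by simp
  moreover have "1 / (- s * (1 - - s) * - Q) * - \<i> = 1 / (s * u * Q) * (- \<i> * u / (1 + s))"
    if "u \<noteq> 0" for u Q using that by simp
  ultimately show ?thesis unfolding weight_def ratio_def by simp
qed

end


section \<open>Smoothness of the characters\<close>

lemma Ck_on_sum: "(\<And>i. i \<in> A \<Longrightarrow> Ck_on k S (f i)) \<Longrightarrow> Ck_on k S (\<lambda>x. \<Sum>i\<in>A. f i x)"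
  by (induction A rule: infinite_finite_induct) (auto intro: Ck_on_add Ck_on_const)

lemma has_derivative_character:
  "((\<lambda>z. rot (2 * pi * (\<delta> \<bullet> z)) c + u) has_derivative
    (\<lambda>v. rot (2 * pi * (\<delta> \<bullet> z)) ((2 * pi * (\<delta> \<bullet> v)) *\<^sub>R (J *v c)))) (at z within S)"
proof -
  have "((\<lambda>z. 2 * pi * (\<delta> \<bullet> z)) has_derivative (\<lambda>v. 2 * pi * (\<delta> \<bullet> v))) (at z within S)"
    by (auto intro!: derivative_eq_intros)
  from has_derivative_add[OF has_derivative_rot[OF this has_derivative_const] has_derivative_const]
  show ?thesis
    by (simp add: J_rot linear_cmul[OF linear_rot] linear_0[OF linear_rot])
qed

lemma Ck_on_character:
  fixes \<delta> :: complex
  shows "Ck_on k S (\<lambda>z. rot (2 * pi * (\<delta> \<bullet> z)) c + u)"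
proof (induction k arbitrary: c u)
  case 0
  show ?case by (simp, intro continuous_intros)
next
  case (Suc k)
  show ?case
    using Suc[where u=0]
    by (auto intro!: exI[of _ "\<lambda>z v. rot (2 * pi * (\<delta> \<bullet> z)) ((2 * pi * (\<delta> \<bullet> v)) *\<^sub>R (J *v c))"]
        has_derivative_character)
qed

lemma pd_character:
  "pd v (\<lambda>z. rot (2 * pi * (\<delta> \<bullet> z)) c + u) =
   (\<lambda>z. rot (2 * pi * (\<delta> \<bullet> z)) ((2 * pi * (\<delta> \<bullet> v)) *\<^sub>R (J *v c)) + 0)"
  unfolding frechet_derivative_at[OF has_derivative_character, symmetric] by simp

lemma C2_bounded_character: "C2_bounded (\<lambda>z. rot (2 * pi * (\<delta> \<bullet> z)) c + u)"
proof -
  have *: "bounded (range (\<lambda>z. rot (2 * pi * (\<delta> \<bullet> z)) c + u))" for c u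
    by (rule boundedI[of _ "2 * norm c + norm u"])
      (auto intro!: order.trans[OF norm_triangle_ineq] norm_rot_le)
  then show ?thesis
    unfolding C2_bounded_def jets_def using * *[where u = 0, simplified]
    by (simp only: pd_character Ck_on_character) simp
qed

text \<open>
  A character as an element of the Banach space, shifted so that it vanishes at the base point \<open>0\<close>.
\<close>

lift_definition mode :: "complex \<Rightarrow> real^4 \<Rightarrow> c2map" is
  "\<lambda>\<delta> c z. rot (2 * pi * (\<delta> \<bullet> z)) c + - c"
  by (rule C2_bounded_character)

lemma linear_mode: "linear (mode \<delta>)"
proof (rule linearI)
  show "mode \<delta> (c + d) = mode \<delta> c + mode \<delta> d" for c d
    by transfer (simp only: linear_add[OF linear_rot] minus_add_distrib add_ac)
  show "mode \<delta> (r *\<^sub>R c) = r *\<^sub>R mode \<delta> c" for r c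
    by transfer (simp only: linear_cmul[OF linear_rot] scaleR_add_right scaleR_minus_right)
qed

lemma c2_apply_sum: "c2_apply (sum F A) z = (\<Sum>i\<in>A. c2_apply (F i) z)"
  by (induction A rule: infinite_finite_induct) (simp_all add: zero_c2map.rep_eq plus_c2map.rep_eq)

lemma c2_apply_minus: "c2_apply (F - G) z = c2_apply F z - c2_apply G z"
  by (simp only: minus_c2map_def plus_c2map.rep_eq scaleR_c2map.rep_eq) simp

lemma norm_c2_apply_le: "norm (c2_apply F z) \<le> norm F"
proof -
  have "norm (c2_apply F z) = norm (apply_bcontfun (jet_bc 0 F) z)"
    by (simp add: jet_bc_apply jets_def)
  also have "\<dots> \<le> norm (jet_bc 0 F)" by (rule norm_bounded)
  also have "\<dots> \<le> (\<Sum>i<6. norm (jet_bc i F))" by (rule member_le_sum) auto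
  finally show ?thesis by (simp add: norm_c2map_def)
qed

lemma continuous_c2_apply: "continuous_on UNIV (c2_apply F)"
  by (rule Ck_on_2D[OF Ck_on_2_c2_apply])

lemma cmat_sum: "cmat A *v sum f X = (\<Sum>x\<in>X. cmat A *v f x)"
  by (induction X rule: infinite_finite_induct) (simp_all add: matrix_vector_right_distrib)

context lattice_basis begin

lemma linear_fourier: "linear (\<lambda>F. fourier \<delta> (c2_apply F))"
proof (rule linearI)
  show "fourier \<delta> (c2_apply (F + G)) = fourier \<delta> (c2_apply F) + fourier \<delta> (c2_apply G)" for F G
    using fourier_add[OF continuous_c2_apply[of F] continuous_c2_apply[of G]]
    by (simp add: plus_c2map.rep_eq)
  show "fourier \<delta> (c2_apply (r *\<^sub>R F)) = r *\<^sub>R fourier \<delta> (c2_apply F)" for r F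
    using fourier_scaleR[of \<delta> r "c2_apply F"] by (simp add: scaleR_c2map.rep_eq)
qed

lemma fourier_const: "\<delta> \<in> dual_lat \<Longrightarrow> fourier \<delta> (\<lambda>z. c) = (if \<delta> = 0 then c else 0)"
  using fourier_character[of \<delta> 0 c] dual_lat_simps(3) by simp

lemma fourier_mode:
  assumes "\<delta> \<in> dual_lat" "\<eta> \<in> dual_lat" "\<delta> \<noteq> 0"
  shows "fourier \<delta> (c2_apply (mode \<eta> c)) = (if \<delta> = \<eta> then c else 0)"
proof -
  have "fourier \<delta> (c2_apply (mode \<eta> c)) = fourier \<delta> (\<lambda>z. rot (2 * pi * (\<eta> \<bullet> z)) c) + fourier \<delta> (\<lambda>z. - c)"
    unfolding mode.rep_eq by (intro fourier_add continuous_intros)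
  then show ?thesis using assms fourier_const[of \<delta> "- c"] fourier_character[of \<delta> \<eta> c] by simp
qed

lemma periodic_mode:
  assumes "\<eta> \<in> dual_lat" "\<omega> \<in> lat"
  shows "c2_apply (mode \<eta> c) (z + \<omega>) = c2_apply (mode \<eta> c) z"
  using periodic_character[of "- \<eta>" \<omega> z c] assms dual_lat_simps(4) unfolding mode.rep_eq by simp

end


section \<open>Hamiltonian stationary tori and their frequencies\<close>

text \<open>
  The data of the theorem for the lattice spanned by \<open>a\<close> and \<open>b\<close>, where \<open>\<gamma>\<close> enumerates one
  half of the frequencies.
\<close>

locale hsl_data = lattice_basis a b a' b' for a b a' b' +
  fixes \<beta>0 :: complex and \<gamma> \<rho> :: "'m::finite \<Rightarrow> complex"
  assumes \<beta>0: "\<beta>0 \<in> dual_lat" and inj: "inj \<gamma>"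
    and disjoint: "range \<gamma> \<inter> range (\<lambda>j. - \<gamma> j) = {}"
    and freqs: "freqs lat \<beta>0 = range \<gamma> \<union> range (\<lambda>j. - \<gamma> j)"
    and \<rho>: "\<And>j. (\<rho> j)\<^sup>2 = poly (freq_poly lat \<beta>0) 0 * (2 * \<gamma> j / \<beta>0) ^ (card (freqs lat \<beta>0) + 1)"
begin

lemma freqs_iff: "g \<in> freqs lat \<beta>0 \<longleftrightarrow>
    g - \<beta>0 / 2 \<in> dual_lat \<and> cmod g = cmod \<beta>0 / 2 \<and> g \<noteq> \<beta>0 / 2 \<and> g \<noteq> - (\<beta>0 / 2)"
  by (simp add: freqs_def dual_lat_def)

lemma \<gamma>_freqs: "\<gamma> j \<in> freqs lat \<beta>0" "- \<gamma> j \<in> freqs lat \<beta>0"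
  by (auto simp: freqs)

lemma \<beta>0_nonzero: "\<beta>0 \<noteq> 0"
  using \<gamma>_freqs(1)[of undefined] by (auto simp: freqs_iff)

definition node :: "complex \<Rightarrow> complex" where "node g = 2 * g / \<beta>0"

definition nodes :: "complex set" where "nodes = node ` freqs lat \<beta>0"

lemma inj_node: "inj_on node A"
  using \<beta>0_nonzero by (auto simp: inj_on_def node_def)

lemma finite_freqs: "finite (freqs lat \<beta>0)"
  by (simp add: freqs)

lemma card_freqs: "card (freqs lat \<beta>0) = 2 * CARD('m)"
proof -
  have "card (range (\<lambda>j. - \<gamma> j)) = CARD('m)"
    using inj by (intro card_image) (auto simp: inj_on_def)
  then show ?thesis
    unfolding freqs using disjoint by (subst card_Un_disjoint) (auto simp: card_image[OF inj])
qed

lemma card_nodes: "card nodes = card (freqs lat \<beta>0)"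
  unfolding nodes_def by (rule card_image[OF inj_node])

sublocale unit_roots nodes
proof
  show "finite nodes" by (simp add: nodes_def finite_freqs)
  show "cmod s = 1" if "s \<in> nodes" for s
    using that \<beta>0_nonzero by (auto simp: nodes_def node_def freqs_iff norm_divide norm_mult)
  show "- s \<in> nodes" if s: "s \<in> nodes" for s
  proof -
    obtain g where g: "g \<in> freqs lat \<beta>0" "s = node g" using s by (auto simp: nodes_def)
    then have "- g \<in> freqs lat \<beta>0" by (auto simp: freqs)
    moreover have "- s = node (- g)" by (simp add: g(2) node_def)
    ultimately show ?thesis by (auto simp: nodes_def)
  qed
  show "1 \<notin> nodes"
    using \<beta>0_nonzero by (auto simp: nodes_def node_def freqs_iff field_simps)
  show "even (card nodes)" by (simp add: card_nodes card_freqs)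
qed

lemma freq_poly_eq: "poly (freq_poly lat \<beta>0) t = (\<Prod>s\<in>nodes. t - s)"
proof -
  have "(\<Prod>s\<in>nodes. t - s) = (\<Prod>g\<in>freqs lat \<beta>0. t - node g)"
    unfolding nodes_def by (subst prod.reindex[OF inj_node]) simp
  then show ?thesis by (simp add: freq_poly_def poly_prod node_def)
qed

lemma freq_poly_0: "poly (freq_poly lat \<beta>0) 0 = \<Prod>nodes"
proof -
  have "(\<Prod>s\<in>nodes. 0 - s) = (\<Prod>s\<in>nodes. - 1 * s)" by simp
  also have "\<dots> = \<Prod>nodes" unfolding prod.distrib prod_constant using even by simp
  finally show ?thesis by (simp add: freq_poly_eq)
qed

abbreviation s :: "'m \<Rightarrow> complex" where "s j \<equiv> node (\<gamma> j)"

lemma node_in_nodes: "s j \<in> nodes"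
  using \<gamma>_freqs by (auto simp: nodes_def)

definition \<kappa> :: "'m \<Rightarrow> real" where "\<kappa> j = Re (weight (s j) * \<rho> j)"

definition \<tau> :: "'m \<Rightarrow> real" where "\<tau> j = Re (ratio (s j))"

lemma \<kappa>: "weight (s j) * \<rho> j = complex_of_real (\<kappa> j)" "\<kappa> j \<noteq> 0"
proof -
  have "(\<rho> j)\<^sup>2 = \<Prod>nodes * s j ^ (card nodes + 1)"
    using \<rho>[of j] by (simp add: freq_poly_0 card_nodes node_def)
  note w = weight_real[OF node_in_nodes this]
  show 1: "weight (s j) * \<rho> j = complex_of_real (\<kappa> j)"
    unfolding \<kappa>_def using w(1) by (metis of_real_Re)
  show "\<kappa> j \<noteq> 0" using w(2) unfolding 1 by simp
qed

lemma \<tau>: "ratio (s j) = complex_of_real (\<tau> j)"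
  unfolding \<tau>_def using ratio_real[OF node_in_nodes] by (metis of_real_Re)

text \<open>
  The rotated derivative \<open>e\<^sup>-\<^sup>J\<^sup>\<beta>\<^sup>/\<^sup>2 f\<^sub>x\<close> will have the frequencies \<open>- \<gamma> j\<close> and \<open>\<gamma> j\<close>.  So
  \<open>f\<close> itself has the frequencies \<open>d j\<close> and \<open>e j\<close>, besides \<open>0\<close>.
\<close>

definition d :: "'m \<Rightarrow> complex" where "d j = \<beta>0 / 2 - \<gamma> j"

definition e :: "'m \<Rightarrow> complex" where "e j = \<beta>0 / 2 + \<gamma> j"

lemma de_dual: "d j \<in> dual_lat" "e j \<in> dual_lat"
proof -
  have "- (\<gamma> j - \<beta>0 / 2) \<in> dual_lat" "- (- \<gamma> j - \<beta>0 / 2) \<in> dual_lat"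
    using \<gamma>_freqs dual_lat_simps(4) unfolding freqs_iff by blast+
  then show "d j \<in> dual_lat" "e j \<in> dual_lat" by (simp_all add: d_def e_def add.commute)
qed

lemma de_nonzero: "d j \<noteq> 0" "e j \<noteq> 0"
  using \<gamma>_freqs[of j] unfolding freqs_iff d_def e_def by (auto simp: add_eq_0_iff)

lemma de_distinct: "d i = d j \<longleftrightarrow> i = j" "e i = e j \<longleftrightarrow> i = j" "d i \<noteq> e j"
proof -
  show "d i = d j \<longleftrightarrow> i = j" "e i = e j \<longleftrightarrow> i = j"
    unfolding d_def e_def using inj by (auto simp: inj_eq)
  have "\<gamma> i \<noteq> - \<gamma> j" using disjoint by blast
  then have "- \<gamma> i \<noteq> \<gamma> j" by (metis minus_minus)
  then show "d i \<noteq> e j" unfolding d_def e_def by simp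
qed

lemma de_sum: "\<beta>0 - d j = e j" "\<beta>0 - e j = d j"
  by (simp_all add: d_def e_def field_simps)

text \<open>
  By Thales, \<open>d j\<close> and \<open>e j\<close> are orthogonal: \<open>d j = \<tau> j * \<i> * e j\<close>.  In this form
  the ratio \<open>\<tau> j\<close> enters the equation of the torus.
\<close>

lemma Re_d: "Re (d j) = - \<tau> j * Im (e j)" and Im_d: "Im (d j) = \<tau> j * Re (e j)"
proof -
  have "1 + s j \<noteq> 0" using node_in_nodes[of j] not_minus_1 by (metis add_eq_0_iff)
  then have "ratio (s j) * \<i> * (1 + s j) = 1 - s j"
    by (simp add: ratio_def) (simp add: algebra_simps)
  moreover have "d j = \<beta>0 / 2 * (1 - s j)" "e j = \<beta>0 / 2 * (1 + s j)"
    using \<beta>0_nonzero by (simp_all add: d_def e_def node_def field_simps)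
  ultimately have d: "d j = complex_of_real (\<tau> j) * \<i> * e j"
    unfolding \<tau>[symmetric] by (metis mult.assoc mult.left_commute)
  show "Re (d j) = - \<tau> j * Im (e j)" "Im (d j) = \<tau> j * Re (e j)"
    by (subst d, simp)+
qed


subsection \<open>The linear parametrisation\<close>

text \<open>
  The torus with parameters \<open>w\<close>, as it results from the interpolation formula
  (see \<open>torus_formula_hsl_torus\<close>), and the recovery of \<open>w\<close> from Fourier coefficients.
\<close>

definition hsl_torus :: "quat^'m \<Rightarrow> c2map" where
  "hsl_torus w = (\<Sum>j\<in>UNIV. \<kappa> j *\<^sub>R (mode (d j) (w $ j) + \<tau> j *\<^sub>R mode (e j) (L *v (w $ j))))"

definition hsl_coeffs :: "c2map \<Rightarrow> quat^'m" where
  "hsl_coeffs F = (\<chi> j. (1 / \<kappa> j) *\<^sub>R fourier (d j) (c2_apply F))"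

lemma bounded_linear_hsl_torus: "bounded_linear hsl_torus"
proof -
  have "linear hsl_torus"
    unfolding hsl_torus_def
    by (intro linear_compose_sum linear_compose_scale_right linear_compose_add ballI
        linear_compose[OF _ linear_mode, unfolded o_def]
        linear_compose[OF _ matrix_vector_mul_linear, unfolded o_def]
        bounded_linear.linear[OF bounded_linear_vec_nth])
  then show ?thesis by (simp add: linear_conv_bounded_linear)
qed

lemma bounded_linear_hsl_coeffs: "bounded_linear hsl_coeffs"
proof (rule bounded_linear_intro)
  show "hsl_coeffs (F + G) = hsl_coeffs F + hsl_coeffs G" for F G
    by (simp add: hsl_coeffs_def vec_eq_iff linear_add[OF linear_fourier] algebra_simps)
  show "hsl_coeffs (r *\<^sub>R F) = r *\<^sub>R hsl_coeffs F" for r F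
    by (simp add: hsl_coeffs_def vec_eq_iff linear_cmul[OF linear_fourier])
  show "norm (hsl_coeffs F) \<le> norm F * (\<Sum>j\<in>UNIV. \<bar>1 / \<kappa> j\<bar> * 2)" for F
  proof -
    have "norm (hsl_coeffs F) \<le> (\<Sum>j\<in>UNIV. norm (hsl_coeffs F $ j))"
      unfolding norm_vec_def by (rule L2_set_le_sum) simp
    also have "\<dots> \<le> (\<Sum>j\<in>UNIV. \<bar>1 / \<kappa> j\<bar> * (2 * norm F))"
      unfolding hsl_coeffs_def using norm_fourier_le[OF continuous_c2_apply norm_c2_apply_le]
      by (intro sum_mono) (auto intro: mult_left_mono simp: divide_right_mono)
    finally show ?thesis by (simp add: sum_distrib_left mult_ac)
  qed
qed

lemma fourier_hsl_torus:
  assumes "\<delta> \<in> dual_lat" "\<delta> \<noteq> 0"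
  shows "fourier \<delta> (c2_apply (hsl_torus w)) =
    (\<Sum>j\<in>UNIV. \<kappa> j *\<^sub>R ((if \<delta> = d j then w $ j else 0) + (if \<delta> = e j then \<tau> j *\<^sub>R (L *v (w $ j)) else 0)))"
  unfolding hsl_torus_def using assms
  by (simp add: linear_sum[OF linear_fourier] linear_add[OF linear_fourier] linear_cmul[OF linear_fourier]
      fourier_mode de_dual if_distrib cong: if_cong)

lemma fourier_hsl_torus_d: "fourier (d j) (c2_apply (hsl_torus w)) = \<kappa> j *\<^sub>R (w $ j)"
  by (subst fourier_hsl_torus) (simp_all add: de_dual de_nonzero de_distinct if_distrib[of "scaleR _"] cong: if_cong)

lemma fourier_hsl_torus_e: "fourier (e j) (c2_apply (hsl_torus w)) = (\<kappa> j * \<tau> j) *\<^sub>R (L *v (w $ j))"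
  by (subst fourier_hsl_torus) (simp_all add: de_dual de_nonzero de_distinct de_distinct(3)[symmetric]
      if_distrib[of "scaleR _"] cong: if_cong)

lemma hsl_coeffs_hsl_torus: "hsl_coeffs (hsl_torus w) = w"
  by (simp add: hsl_coeffs_def fourier_hsl_torus_d vec_eq_iff \<kappa>(2))

text \<open>
  \<open>R(\<beta>) L\<close> turns the \<open>x\<close>-derivative of the component of frequency \<open>d j\<close> into the \<open>y\<close>-derivative of the
  component of frequency \<open>e j = \<beta>0 - d j\<close>, and vice versa, by \<open>d j = \<tau> j * \<i> * e j\<close>.
\<close>

lemma hsl_torus_in_hsl_tori:
  assumes "w \<noteq> 0"
  shows "hsl_torus w \<in> hsl_tori lat \<beta>0"
proof -
  let ?f = "c2_apply (hsl_torus w)"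
  let ?E = "\<lambda>\<delta> z. rot (2 * pi * (\<delta> \<bullet> z))"
  have f: "?f = (\<lambda>z. \<Sum>j\<in>UNIV. \<kappa> j *\<^sub>R ((?E (d j) z (w $ j) + - (w $ j)) +
      \<tau> j *\<^sub>R (?E (e j) z (L *v (w $ j)) + - (L *v (w $ j)))))"
    by (simp add: hsl_torus_def fun_eq_iff c2_apply_sum plus_c2map.rep_eq scaleR_c2map.rep_eq mode.rep_eq)
  have "smooth_on UNIV ?f"
    unfolding f smooth_on_def by (intro allI Ck_on_sum Ck_on_scaleR Ck_on_add Ck_on_character)
  moreover have "\<forall>z. \<forall>\<omega>\<in>lat. ?f (z + \<omega>) = ?f z"
    by (auto simp: hsl_torus_def c2_apply_sum plus_c2map.rep_eq scaleR_c2map.rep_eq periodic_mode de_dual)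
  moreover have zero: "?f 0 = 0" by (simp add: f)
  moreover have "\<nexists>c. \<forall>z. ?f z = c"
  proof
    assume "\<exists>c. \<forall>z. ?f z = c"
    then have "?f = c2_apply 0" using zero by (auto simp: zero_c2map.rep_eq)
    then have "hsl_torus w = 0" by (simp add: c2_apply_inject)
    then show False
      using hsl_coeffs_hsl_torus[of w] linear_0[OF bounded_linear.linear[OF bounded_linear_hsl_coeffs]] assms by simp
  qed
  moreover have "pd \<i> ?f z = rot (maslov_angle \<beta>0 z) (L *v pd 1 ?f z)" for z
  proof -
    define D where "D v = (\<Sum>j\<in>UNIV. \<kappa> j *\<^sub>R (?E (d j) z ((2 * pi * (d j \<bullet> v)) *\<^sub>R (J *v (w $ j))) +
      \<tau> j *\<^sub>R ?E (e j) z ((2 * pi * (e j \<bullet> v)) *\<^sub>R (J *v (L *v (w $ j))))))" for v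
    have "(?f has_derivative D) (at z)"
      unfolding f D_def
      by (intro has_derivative_sum has_derivative_scaleR_right has_derivative_add has_derivative_character)
    then have pd: "pd v ?f z = D v" for v by (metis frechet_derivative_at)
    have swap: "rot (maslov_angle \<beta>0 z) (L *v ?E \<delta> z c) = ?E (\<beta>0 - \<delta>) z (L *v c)" for \<delta> c
      by (simp add: L_rot rot_rot maslov_angle_def inner_diff_left algebra_simps)
    have lin: "linear (\<lambda>c. rot (maslov_angle \<beta>0 z) (L *v c))"
      using linear_compose[OF matrix_vector_mul_linear linear_rot] by (simp add: o_def)
    have LJL: "L *v (r *\<^sub>R (J *v (L *v c))) = r *\<^sub>R (J *v c)" "L *v (r *\<^sub>R (J *v c)) = - r *\<^sub>R (J *v (L *v c))" for r c
      by (simp_all add: matrix_vector_mult_scaleR LJ linear_neg[OF matrix_vector_mul_linear])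
    have "rot (maslov_angle \<beta>0 z) (L *v D 1) = D \<i>"
      unfolding D_def linear_sum[OF lin] linear_add[OF lin] linear_cmul[OF lin] swap de_sum LJL
      by (intro sum.cong refl) (simp add: linear_cmul[OF linear_rot] linear_neg[OF linear_rot]
          linear_neg[OF matrix_vector_mul_linear] Re_d Im_d inner_complex_def algebra_simps)
    then show ?thesis by (simp add: pd)
  qed
  ultimately show ?thesis
    unfolding hsl_tori_def mem_Collect_eq hsl_equation_iff[abs_def] by blast
qed

text \<open>
  The first relation is the Fourier transform of \<open>f\<^sub>y = R(\<beta>) L f\<^sub>x\<close> at \<open>\<delta>\<close>.  The second is the first one
  at \<open>\<beta>0 - \<delta>\<close>, multiplied by \<open>L\<close>.
\<close>

lemma hsl_fourier:
  assumes F: "F \<in> hsl_tori lat \<beta>0" and \<delta>: "\<delta> \<in> dual_lat"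
  defines "A \<equiv> \<lambda>\<delta>. fourier \<delta> (c2_apply F)"
  shows "Im \<delta> *\<^sub>R A \<delta> = - Re (\<beta>0 - \<delta>) *\<^sub>R (L *v A (\<beta>0 - \<delta>))"
    and "Re \<delta> *\<^sub>R A \<delta> = Im (\<beta>0 - \<delta>) *\<^sub>R (L *v A (\<beta>0 - \<delta>))"
proof -
  let ?f = "c2_apply F"
  have per: "periodic ?f" and eq: "\<And>z. pd \<i> ?f z = rot (2 * pi * (\<beta>0 \<bullet> z)) (L *v pd 1 ?f z)"
    using F unfolding hsl_tori_def periodic_def mem_Collect_eq hsl_equation_iff maslov_angle_def by blast+
  note C = Ck_on_2D[OF Ck_on_2_c2_apply[of F]]
  have D: "(?f has_derivative (\<lambda>v. pd v ?f z)) (at z)" for z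
    using C(1) by (auto simp: differentiable_on_def frechet_derivative_works)
  have deriv: "fourier \<eta> (pd v ?f) = (2 * pi * (\<eta> \<bullet> v)) *\<^sub>R (J *v A \<eta>)" if "\<eta> \<in> dual_lat" for \<eta> v
    unfolding A_def by (rule fourier_derivative[OF per D C(4) that])
  have *: "Im \<eta> *\<^sub>R A \<eta> = - Re (\<beta>0 - \<eta>) *\<^sub>R (L *v A (\<beta>0 - \<eta>))" if \<eta>: "\<eta> \<in> dual_lat" for \<eta>
  proof -
    have \<eta>': "\<beta>0 - \<eta> \<in> dual_lat" using \<eta> \<beta>0 dual_lat_simps by blast
    have "(2 * pi * Im \<eta>) *\<^sub>R (J *v A \<eta>) = fourier \<eta> (pd \<i> ?f)"
      by (simp add: deriv[OF \<eta>] inner_complex_def)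
    also have "\<dots> = L *v fourier (\<beta>0 - \<eta>) (pd 1 ?f)"
      unfolding eq[abs_def] by (rule fourier_rot_L[OF C(4)])
    also have "\<dots> = (2 * pi * - Re (\<beta>0 - \<eta>)) *\<^sub>R (J *v (L *v A (\<beta>0 - \<eta>)))"
      by (simp add: deriv[OF \<eta>'] inner_complex_def matrix_vector_mult_scaleR LJ algebra_simps)
    finally have "J *v ((2 * pi) *\<^sub>R (Im \<eta> *\<^sub>R A \<eta>)) =
        J *v ((2 * pi) *\<^sub>R (- Re (\<beta>0 - \<eta>) *\<^sub>R (L *v A (\<beta>0 - \<eta>))))"
      by (simp add: matrix_vector_mult_scaleR)
    then have "J *v (J *v ((2 * pi) *\<^sub>R (Im \<eta> *\<^sub>R A \<eta>))) =
        J *v (J *v ((2 * pi) *\<^sub>R (- Re (\<beta>0 - \<eta>) *\<^sub>R (L *v A (\<beta>0 - \<eta>)))))" by simp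
    then show ?thesis unfolding JJ by (simp only: neg_equal_iff_equal real_vector.scale_cancel_left) simp
  qed
  show "Im \<delta> *\<^sub>R A \<delta> = - Re (\<beta>0 - \<delta>) *\<^sub>R (L *v A (\<beta>0 - \<delta>))" by (rule *[OF \<delta>])
  have "\<beta>0 - \<delta> \<in> dual_lat" using \<delta> \<beta>0 dual_lat_simps by blast
  from arg_cong[OF *[OF this], of "(*v) L"] show "Re \<delta> *\<^sub>R A \<delta> = Im (\<beta>0 - \<delta>) *\<^sub>R (L *v A (\<beta>0 - \<delta>))"
    by (simp add: matrix_vector_mult_scaleR linear_neg[OF matrix_vector_mul_linear])
qed

text \<open>
  Eliminating the coefficient at \<open>\<delta>\<close> from the two relations leaves \<open>\<delta> \<bullet> (\<beta>0 - \<delta>)\<close> times a nonzero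
  vector.  So \<open>\<delta>\<close> lies on the circle with diameter from \<open>0\<close> to \<open>\<beta>0\<close>, whose centre is \<open>\<beta>0 / 2\<close>.
\<close>

lemma hsl_fourier_support:
  assumes F: "F \<in> hsl_tori lat \<beta>0" and \<delta>: "\<delta> \<in> dual_lat" "\<delta> \<noteq> 0"
    and A: "fourier \<delta> (c2_apply F) \<noteq> 0"
  shows "\<delta> \<in> range d \<union> range e"
proof -
  let ?A = "fourier \<delta> (c2_apply F)" and ?\<delta>' = "\<beta>0 - \<delta>"
  let ?B = "L *v fourier ?\<delta>' (c2_apply F)"
  note r = hsl_fourier[OF F \<delta>(1)]
  have "?\<delta>' \<noteq> 0"
  proof
    assume "?\<delta>' = 0"
    then have "Im \<delta> = 0" "Re \<delta> = 0" using r A by simp_all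
    then show False using \<delta>(2) by (simp add: complex_eq_iff)
  qed
  have B: "?B \<noteq> 0"
  proof
    assume "?B = 0"
    then have "Im \<delta> = 0" "Re \<delta> = 0" using r A by simp_all
    then show False using \<delta>(2) by (simp add: complex_eq_iff)
  qed
  have "Re \<delta> *\<^sub>R (- Re ?\<delta>' *\<^sub>R ?B) = Re \<delta> *\<^sub>R (Im \<delta> *\<^sub>R ?A)" by (simp only: r)
  also have "\<dots> = Im \<delta> *\<^sub>R (Re \<delta> *\<^sub>R ?A)" by simp
  also have "\<dots> = Im \<delta> *\<^sub>R (Im ?\<delta>' *\<^sub>R ?B)" by (simp only: r)
  finally have "(Re \<delta> * Re ?\<delta>' + Im \<delta> * Im ?\<delta>') *\<^sub>R ?B = 0"
    by (simp add: algebra_simps)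
  then have "\<delta> \<bullet> ?\<delta>' = 0" using B by (simp add: inner_complex_def)
  then have "(\<beta>0 / 2 - \<delta>) \<bullet> (\<beta>0 / 2 - \<delta>) = (\<beta>0 / 2) \<bullet> (\<beta>0 / 2)"
    by (simp add: inner_complex_def algebra_simps)
  then have "cmod (\<beta>0 / 2 - \<delta>) = cmod (\<beta>0 / 2)" by (simp only: norm_eq)
  moreover have "\<beta>0 / 2 - \<delta> - \<beta>0 / 2 \<in> dual_lat" using dual_lat_simps(4)[OF \<delta>(1)] by simp
  moreover have "\<beta>0 / 2 - \<delta> \<noteq> \<beta>0 / 2" using \<delta>(2) by simp
  moreover have "\<beta>0 / 2 - \<delta> \<noteq> - (\<beta>0 / 2)"
    using \<open>?\<delta>' \<noteq> 0\<close> by (auto simp: algebra_simps eq_neg_iff_add_eq_0)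
  ultimately have "\<beta>0 / 2 - \<delta> \<in> range \<gamma> \<union> range (\<lambda>j. - \<gamma> j)"
    unfolding freqs[symmetric] freqs_iff by (simp add: norm_divide)
  then obtain j where "\<beta>0 / 2 - \<delta> = \<gamma> j \<or> \<beta>0 / 2 - \<delta> = - \<gamma> j" by auto
  then have "\<delta> = d j \<or> \<delta> = e j" unfolding d_def e_def by (auto simp: algebra_simps)
  then show ?thesis by blast
qed

lemma hsl_fourier_e:
  assumes F: "F \<in> hsl_tori lat \<beta>0"
  shows "fourier (e j) (c2_apply F) = \<tau> j *\<^sub>R (L *v fourier (d j) (c2_apply F))"
proof -
  let ?A = "fourier (d j) (c2_apply F)" and ?B = "L *v fourier (e j) (c2_apply F)"
  note r = hsl_fourier[OF F de_dual(1)[of j], unfolded de_sum]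
  have "Re (e j) *\<^sub>R (\<tau> j *\<^sub>R ?A + ?B) = 0" "Im (e j) *\<^sub>R (\<tau> j *\<^sub>R ?A + ?B) = 0"
    using r unfolding Re_d Im_d by (simp_all add: algebra_simps eq_neg_iff_add_eq_0 neg_eq_iff_add_eq_0)
  then have "\<tau> j *\<^sub>R ?A + ?B = 0" using de_nonzero(2)[of j] by (auto simp: complex_eq_iff)
  then have "L *v (\<tau> j *\<^sub>R ?A + ?B) = 0" by simp
  then show ?thesis by (simp add: matrix_vector_right_distrib matrix_vector_mult_scaleR)
qed

text \<open>
  Both maps have the same Fourier coefficients at all nonzero frequencies, so they differ by a
  constant, and both vanish at \<open>0\<close>.
\<close>

lemma hsl_torus_hsl_coeffs:
  assumes F: "F \<in> hsl_tori lat \<beta>0"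
  shows "hsl_torus (hsl_coeffs F) = F"
proof -
  let ?G = "F - hsl_torus (hsl_coeffs F)"
  let ?g = "c2_apply ?G"
  define c where "c = fourier 0 ?g"
  have base_point: "c2_apply (hsl_torus w) 0 = 0" for w
    by (simp add: hsl_torus_def c2_apply_sum plus_c2map.rep_eq scaleR_c2map.rep_eq mode.rep_eq)
  have "fourier \<delta> (\<lambda>z. ?g z + - c) = 0" if \<delta>: "\<delta> \<in> dual_lat" for \<delta>
  proof -
    have "fourier \<delta> ?g = 0" if "\<delta> \<noteq> 0"
    proof -
      have coeff: "\<kappa> j *\<^sub>R (hsl_coeffs F $ j) = fourier (d j) (c2_apply F)" for j by (simp add: hsl_coeffs_def \<kappa>(2))
      have "fourier \<delta> (c2_apply F) = fourier \<delta> (c2_apply (hsl_torus (hsl_coeffs F)))"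
      proof (cases "\<delta> \<in> range d \<union> range e")
        case True
        then show ?thesis
          by (auto simp: fourier_hsl_torus_d fourier_hsl_torus_e hsl_fourier_e[OF F] coeff[symmetric]
              matrix_vector_mult_scaleR mult.commute)
      next
        case False
        then have "fourier \<delta> (c2_apply F) = 0" using hsl_fourier_support[OF F \<delta> that] by blast
        moreover have "fourier \<delta> (c2_apply (hsl_torus (hsl_coeffs F))) = 0"
          using False by (subst fourier_hsl_torus[OF \<delta> that]) (auto intro!: sum.neutral)
        ultimately show ?thesis by simp
      qed
      then show ?thesis by (simp add: linear_diff[OF linear_fourier])
    qed
    moreover have "fourier \<delta> (\<lambda>z. ?g z + - c) = fourier \<delta> ?g + fourier \<delta> (\<lambda>z. - c)"
      by (intro fourier_add continuous_c2_apply continuous_intros)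
    ultimately show ?thesis using fourier_const[OF \<delta>, of "- c"] by (auto simp: c_def)
  qed
  moreover have "periodic (\<lambda>z. ?g z + - c)"
  proof -
    have "c2_apply F (z + \<omega>) = c2_apply F z" if "\<omega> \<in> lat" for z \<omega>
      using F that by (simp add: hsl_tori_def)
    moreover have "c2_apply (hsl_torus (hsl_coeffs F)) (z + \<omega>) = c2_apply (hsl_torus (hsl_coeffs F)) z" if "\<omega> \<in> lat" for z \<omega>
      using that
      by (simp add: hsl_torus_def c2_apply_sum plus_c2map.rep_eq scaleR_c2map.rep_eq periodic_mode de_dual)
    ultimately show ?thesis by (simp add: periodic_def c2_apply_minus)
  qed
  moreover have "continuous_on UNIV (\<lambda>z. ?g z + - c)"
    by (intro continuous_intros continuous_c2_apply)
  ultimately have "?g z + - c = 0" for z using fourier_eq_0_imp by blast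
  then have g: "?g z = c" for z by (simp add: eq_neg_iff_add_eq_0[symmetric])
  have "c2_apply F 0 = 0" using F by (simp add: hsl_tori_def)
  then have "c = 0" using g[of 0] base_point by (simp add: c2_apply_minus)
  then have "c2_apply ?G = c2_apply 0" using g by (simp add: fun_eq_iff zero_c2map.rep_eq)
  then show ?thesis by (simp add: c2_apply_inject)
qed

lemma hsl_torus_image: "hsl_torus ` (- {0}) = hsl_tori lat \<beta>0"
proof
  show "hsl_torus ` (- {0}) \<subseteq> hsl_tori lat \<beta>0" using hsl_torus_in_hsl_tori by auto
  show "hsl_tori lat \<beta>0 \<subseteq> hsl_torus ` (- {0})"
  proof
    fix F assume F: "F \<in> hsl_tori lat \<beta>0"
    have "F \<noteq> 0" using F by (auto simp: hsl_tori_def zero_c2map.rep_eq)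
    then have "hsl_coeffs F \<noteq> 0"
      using hsl_torus_hsl_coeffs[OF F] linear_0[OF bounded_linear.linear[OF bounded_linear_hsl_torus]] by auto
    then show "F \<in> hsl_torus ` (- {0})" using hsl_torus_hsl_coeffs[OF F] by force
  qed
qed

lemma hsl_torus_rmult: "c2_apply (hsl_torus (rmult w q)) z = qmult (c2_apply (hsl_torus w) z) q"
  by (simp add: hsl_torus_def c2_apply_sum plus_c2map.rep_eq scaleR_c2map.rep_eq mode.rep_eq
      linear_sum[OF linear_qmult_left] linear_add[OF linear_qmult_left] rot_qmult qmult_L
      linear_diff[OF linear_qmult_left])

text \<open>
  Right multiplication commutes with the left multiplications \<open>J\<close> and \<open>L\<close>, of which the
  parametrisation is made up.
\<close>

lemma hsl_class_hsl_torus: "hsl_class (hsl_torus w) = hsl_torus ` hp_class w"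
proof -
  have "(\<forall>z. c2_apply G z = qmult (c2_apply (hsl_torus w) z) q) \<longleftrightarrow> G = hsl_torus (rmult w q)" for G q
    unfolding hsl_torus_rmult[symmetric] by (auto simp: c2_apply_inject[symmetric])
  then show ?thesis unfolding hsl_class_eq hp_class_eq by auto
qed

lemma hsl_class_hsl_torus_eq_iff: "hsl_class (hsl_torus v) = hsl_class (hsl_torus w) \<longleftrightarrow> hp_class v = hp_class w"
proof -
  have "inj hsl_torus" by (rule inj_on_inverseI[of _ hsl_coeffs]) (rule hsl_coeffs_hsl_torus)
  then show ?thesis by (simp add: hsl_class_hsl_torus inj_image_eq_iff)
qed


subsection \<open>The formula through interpolation\<close>

lemma init_poly:
  defines "x w \<equiv> init_poly lat \<beta>0 \<gamma> \<rho> w"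
  shows "peval (x w) (s j) = \<rho> j *s cvec (w $ j)"
    and "peval (x w) (- s j) = (- \<i> * \<rho> j) *s cvec (L *v (w $ j))"
proof -
  \<comment> \<open>All prescribed values, as a function on the nodes: those at \<open>- s j\<close> no longer refer to \<open>x\<close>.\<close>
  define v where "v w t = (if t \<in> range s then let j = inv s t in \<rho> j *s cvec (w $ j)
    else let j = inv s (- t) in (- \<i> * \<rho> j) *s cvec (L *v (w $ j)))" for w t
  have inj_s: "inj s" using inj inj_node[of UNIV] by (auto simp: inj_def)
  have v: "v w (s j) = \<rho> j *s cvec (w $ j)" "v w (- s j) = (- \<i> * \<rho> j) *s cvec (L *v (w $ j))" for w j
  proof -
    show "v w (s j) = \<rho> j *s cvec (w $ j)" by (simp add: v_def inv_f_f[OF inj_s])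
    have "- s j \<notin> range s"
    proof
      assume "- s j \<in> range s"
      then obtain i where "node (- \<gamma> j) = node (\<gamma> i)" by (auto simp: node_def)
      then have "- \<gamma> j = \<gamma> i" using inj_node[of UNIV] by (auto dest: injD)
      then show False using disjoint by blast
    qed
    then show "v w (- s j) = (- \<i> * \<rho> j) *s cvec (L *v (w $ j))"
      by (simp add: v_def inv_f_f[OF inj_s])
  qed
  have nodes: "nodes = range s \<union> range (\<lambda>j. - s j)"
    unfolding nodes_def freqs image_Un image_image by (simp add: node_def)
  have "interpolates nodes (v w) y \<longleftrightarrow>
      (\<forall>k. degree (y $ k) \<le> card (freqs lat \<beta>0)) \<and> peval y 0 = 0 \<and>
      (\<forall>j. peval y (2 * \<gamma> j / \<beta>0) = \<rho> j *s cvec (w $ j) \<and>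
          peval y (- (2 * \<gamma> j / \<beta>0)) = (- \<i>) *s (cmat L *v peval y (2 * \<gamma> j / \<beta>0)))" for y w
  proof -
    have "(\<forall>t\<in>nodes. peval y t = v w t) \<longleftrightarrow> (\<forall>j. peval y (s j) = \<rho> j *s cvec (w $ j) \<and>
          peval y (- s j) = (- \<i>) *s (cmat L *v peval y (s j)))"
      unfolding nodes by (auto simp: v cmat_smult cmat_cvec)
    then show ?thesis unfolding interpolates_def card_nodes node_def by blast
  qed
  then have "x w = (THE y. interpolates nodes (v w) y)"
    unfolding x_def init_poly_def by simp
  then have "interpolates nodes (v w) (x w)"
    using the_interpolates[OF finite nonzero(2)] by simp
  then have "peval (x w) t = v w t" if "t \<in> nodes" for t
    using that by (simp add: interpolates_def)
  then show "peval (x w) (s j) = \<rho> j *s cvec (w $ j)"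
    and "peval (x w) (- s j) = (- \<i> * \<rho> j) *s cvec (L *v (w $ j))"
    using v node_in_nodes neg by simp_all
qed

lemma evolved_poly:
  "peval (evolved_poly lat \<beta>0 x z) 1 = (\<Sum>g\<in>freqs lat \<beta>0.
     poly (lagrange nodes (node g)) 1 *s
       (cmat (mat_exp ((- 2 * pi * (g \<bullet> z)) *\<^sub>R J)) *v peval x (node g)))"
proof -
  define v where "v t = cmat (mat_exp ((- 2 * pi * ((t * \<beta>0 / 2) \<bullet> z)) *\<^sub>R J)) *v peval x t" for t
  have v: "v (node g) = cmat (mat_exp ((- 2 * pi * (g \<bullet> z)) *\<^sub>R J)) *v peval x (node g)" for g
    unfolding v_def using \<beta>0_nonzero by (simp add: node_def)
  have "evolved_poly lat \<beta>0 x z = (THE y. interpolates nodes v y)"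
    unfolding evolved_poly_def interpolates_def card_nodes
    unfolding nodes_def by (simp add: v) (simp add: node_def)
  then have "interpolates nodes v (evolved_poly lat \<beta>0 x z)"
    using the_interpolates[OF finite nonzero(2)] by simp
  then have "peval (evolved_poly lat \<beta>0 x z) 1 = (\<Sum>t\<in>nodes. poly (lagrange nodes t) 1 *s v t)"
    by (rule peval_interpolates[OF finite nonzero(2)])
  also have "\<dots> = (\<Sum>g\<in>freqs lat \<beta>0. poly (lagrange nodes (node g)) 1 *s v (node g))"
    by (simp add: nodes_def sum.reindex[OF inj_node])
  finally show ?thesis by (simp only: v)
qed

text \<open>
  By Lagrange interpolation the formula is a sum over the frequencies, in which \<open>\<gamma> j\<close> and \<open>- \<gamma> j\<close>
  contribute with the factors \<open>weight (s j) * \<rho> j = \<kappa> j\<close> and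
  \<open>weight (- s j) * (- \<i>) * \<rho> j = \<kappa> j * \<tau> j\<close>.
\<close>

lemma torus_formula_hsl_torus: "torus_formula lat \<beta>0 \<gamma> \<rho> w z = cvec (c2_apply (hsl_torus w) z)"
proof -
  define x where "x = init_poly lat \<beta>0 \<gamma> \<rho> w"
  let ?R = "\<lambda>t. cmat (mat_exp (t *\<^sub>R J))"
  let ?p = "1 / poly (freq_poly lat \<beta>0) 1"
  define summand where "summand g = weight (node g) *s
    (?R (maslov_angle \<beta>0 z / 2) *v (?R (- 2 * pi * (g \<bullet> z)) *v peval x (node g)) - peval x (node g))" for g
  have R0: "?R 0 *v y = y" for y
  proof -
    have "mat_exp (0 *\<^sub>R J) = mat 1" by (simp only: mat_exp_J) simp
    moreover have "cmat (mat 1) = mat 1" by (simp add: cmat_def map_matrix_def mat_def vec_eq_iff)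
    ultimately show ?thesis by (simp only: matrix_vector_mul_lid)
  qed
  have "torus_formula lat \<beta>0 \<gamma> \<rho> w z = (\<Sum>g\<in>freqs lat \<beta>0.
      ?p *s (?R (maslov_angle \<beta>0 z / 2) *v (poly (lagrange nodes (node g)) 1 *s
        (?R (- 2 * pi * (g \<bullet> z)) *v peval x (node g))) - poly (lagrange nodes (node g)) 1 *s peval x (node g)))"
    unfolding torus_formula_def Let_def x_def[symmetric] evolved_poly
    by (simp add: R0[simplified] cmat_sum sum_subtractf vec.scale_sum_right vec.scale_right_diff_distrib)
  also have "\<dots> = (\<Sum>g\<in>freqs lat \<beta>0. summand g)"
  proof (intro sum.cong refl)
    fix g assume "g \<in> freqs lat \<beta>0"
    then have "weight (node g) = ?p * poly (lagrange nodes (node g)) 1"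
      using lagrange_at_1[of "node g"] by (simp add: freq_poly_eq nodes_def)
    then show "?p *s (?R (maslov_angle \<beta>0 z / 2) *v (poly (lagrange nodes (node g)) 1 *s
        (?R (- 2 * pi * (g \<bullet> z)) *v peval x (node g))) - poly (lagrange nodes (node g)) 1 *s peval x (node g)) = summand g"
      by (simp add: summand_def cmat_smult vec.scale_right_diff_distrib)
  qed
  also have "\<dots> = (\<Sum>j\<in>UNIV. summand (\<gamma> j)) + (\<Sum>j\<in>UNIV. summand (- \<gamma> j))"
  proof -
    have "inj (\<lambda>j. - \<gamma> j)" using inj by (simp add: inj_def)
    then show ?thesis
      unfolding freqs using disjoint by (simp add: sum.union_disjoint sum.reindex inj)
  qed
  also have "\<dots> = (\<Sum>j\<in>UNIV. cvec (\<kappa> j *\<^sub>R (c2_apply (mode (d j) (w $ j)) z +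
      \<tau> j *\<^sub>R c2_apply (mode (e j) (L *v (w $ j))) z)))"
    unfolding sum.distrib[symmetric]
  proof (intro sum.cong refl)
    fix j
    have R: "?R (maslov_angle \<beta>0 z / 2) *v (?R (- 2 * pi * (g \<bullet> z)) *v (k *s cvec c)) - k *s cvec c
        = k *s cvec (c2_apply (mode (\<beta>0 / 2 - g) c) z)" for g k c
    proof -
      have "maslov_angle \<beta>0 z / 2 + - 2 * pi * (g \<bullet> z) = 2 * pi * ((\<beta>0 / 2 - g) \<bullet> z)"
        by (simp add: maslov_angle_def inner_complex_def algebra_simps)
      then show ?thesis
        unfolding cmat_smult cmat_cvec mat_exp_J_mult rot_rot mode.rep_eq
        by (simp add: cvec_simps vec.scale_right_diff_distrib)
    qed
    have w: "weight (- s j) * (- \<i>) * \<rho> j = complex_of_real (\<kappa> j * \<tau> j)"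
      unfolding weight_neg[OF node_in_nodes] by (simp add: \<kappa>(1)[symmetric] \<tau>[symmetric])
    have "summand (\<gamma> j) = (weight (s j) * \<rho> j) *s cvec (c2_apply (mode (d j) (w $ j)) z)"
      unfolding summand_def x_def init_poly R by (simp add: d_def)
    moreover have "node (- \<gamma> j) = - s j" by (simp add: node_def)
    then have "summand (- \<gamma> j) = (weight (- s j) * (- \<i>) * \<rho> j) *s cvec (c2_apply (mode (e j) (L *v (w $ j))) z)"
      unfolding summand_def x_def by (simp only: init_poly R) (simp add: e_def mult.assoc)
    then have "summand (- \<gamma> j) = complex_of_real (\<kappa> j * \<tau> j) *s cvec (c2_apply (mode (e j) (L *v (w $ j))) z)"
      unfolding w .
    ultimately show "summand (\<gamma> j) + summand (- \<gamma> j) = cvec (\<kappa> j *\<^sub>R (c2_apply (mode (d j) (w $ j)) z +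
      \<tau> j *\<^sub>R c2_apply (mode (e j) (L *v (w $ j))) z))"
      unfolding \<kappa>(1) by (simp add: cvec_simps scaleR_add_right del: of_real_mult)
  qed
  also have "\<dots> = cvec (c2_apply (hsl_torus w) z)"
    by (simp add: hsl_torus_def c2_apply_sum plus_c2map.rep_eq scaleR_c2map.rep_eq cvec_sum)
  finally show ?thesis .
qed

end

text \<open>
  The dual basis is given by Cramer's rule.
\<close>

lemma lattice_basis_exists:
  assumes "is_lattice \<Gamma>"
  obtains a b a' b' where "lattice_basis a b a' b'" "\<Gamma> = lattice_basis.lat a b"
proof -
  obtain a b where ab: "a \<noteq> b" "independent {a, b}" "\<Gamma> = {of_int k * a + of_int l * b | k l. True}"
    using assms unfolding is_lattice_def by blast
  let ?D = "Re a * Im b - Im a * Re b"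
  have D: "?D \<noteq> 0"
  proof
    assume D: "?D = 0"
    have "b \<noteq> 0" using ab(2) dependent_zero[of "{a, b}"] by auto
    then have "b \<bullet> b \<noteq> 0" by simp
    have "a = ((a \<bullet> b) / (b \<bullet> b)) *\<^sub>R b"
    proof -
      have "(b \<bullet> b) *\<^sub>R a = (a \<bullet> b) *\<^sub>R b"
        using D by (simp add: complex_eq_iff inner_complex_def) algebra
      then have "(1 / (b \<bullet> b)) *\<^sub>R ((b \<bullet> b) *\<^sub>R a) = (1 / (b \<bullet> b)) *\<^sub>R ((a \<bullet> b) *\<^sub>R b)" by simp
      then show ?thesis using \<open>b \<bullet> b \<noteq> 0\<close> by simp
    qed
    then have "a \<in> span {b}" by (metis span_base span_scale singletonI)
    moreover have "{a, b} - {a} = {b}" using ab(1) by auto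
    ultimately show False using ab(2) unfolding dependent_def by auto
  qed
  let ?a' = "Complex (Im b / ?D) (- Re b / ?D)" and ?b' = "Complex (- Im a / ?D) (Re a / ?D)"
  have inner: "?a' \<bullet> v = (Im b * Re v - Re b * Im v) / ?D" "?b' \<bullet> v = (Re a * Im v - Im a * Re v) / ?D" for v
    by (simp_all add: inner_complex_def diff_divide_distrib)
  have "lattice_basis a b ?a' ?b'"
  proof
    show "?a' \<bullet> a = 1" "?b' \<bullet> b = 1" "?a' \<bullet> b = 0" "?b' \<bullet> a = 0"
      unfolding inner using D by (simp_all add: mult.commute)
    show "z = (?a' \<bullet> z) *\<^sub>R a + (?b' \<bullet> z) *\<^sub>R b" for z
    proof -
      let ?A = "Im b * Re z - Re b * Im z" and ?B = "Re a * Im z - Im a * Re z"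
      have "?D * Re z = ?A * Re a + ?B * Re b" "?D * Im z = ?A * Im a + ?B * Im b"
        by algebra+
      then have "Re z = (?A * Re a + ?B * Re b) / ?D" "Im z = (?A * Im a + ?B * Im b) / ?D"
        using D by (simp_all add: nonzero_eq_divide_eq mult.commute)
      then show ?thesis
        unfolding inner by (simp only: complex_eq_iff plus_complex.sel scaleR_complex.sel
            add_divide_distrib times_divide_eq_left)
    qed
  qed
  then show ?thesis using that ab(3) lattice_basis.lat_def by metis
qed

section \<open>The diffeomorphism\<close>

theorem proposition5p6:
  fixes \<Gamma> :: "complex set" and \<beta>0 :: complex and N n :: nat
    and \<gamma> \<rho> :: "'m::finite \<Rightarrow> complex"
  assumes "is_lattice \<Gamma>" and "\<beta>0 \<in> dual_lattice \<Gamma>"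
    and "N = card (freqs \<Gamma> \<beta>0)" and "n = N div 2 - 1" and "N > 0"
    and "CARD('m) = n + 1"
    and "inj \<gamma>" and "range \<gamma> \<inter> range (\<lambda>j. - \<gamma> j) = {}"
    and "freqs \<Gamma> \<beta>0 = range \<gamma> \<union> range (\<lambda>j. - \<gamma> j)"
    and "\<forall>j. (\<rho> j)\<^sup>2 = poly (freq_poly \<Gamma> \<beta>0) 0 * (2 * \<gamma> j / \<beta>0) ^ (N + 1)"
  shows "\<exists>\<Phi>. (\<forall>w. w \<noteq> 0 \<longrightarrow>
                (\<exists>F\<in>hsl_tori \<Gamma> \<beta>0. (\<forall>z. cvec (c2_apply F z) = torus_formula \<Gamma> \<beta>0 \<gamma> \<rho> w z) \<and>
                   \<Phi> (hp_class w) = hsl_class F)) \<and>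
             diffeomorphism (HP :: ((quat^'m) set, quat^'m) manifold)
                            (moduli \<Gamma> \<beta>0 :: (c2map set, quat^'m) manifold) \<Phi>"
proof -
  obtain a b a' b' where "lattice_basis a b a' b'" and \<Gamma>: "\<Gamma> = lattice_basis.lat a b"
    using lattice_basis_exists[OF assms(1)] .
  interpret lattice_basis a b a' b' by fact
  interpret hsl_data a b a' b' \<beta>0 \<gamma> \<rho>
    using assms unfolding \<Gamma> by unfold_locales (simp_all add: dual_lat_def)
  \<comment> \<open>On classes, which are sets of representatives, the induced map is just the image.\<close>
  define \<Phi> where "\<Phi> = (\<lambda>C. hsl_torus ` C)"
  interpret quotient_iso hsl_torus hsl_coeffs "- {0}" "hsl_tori lat \<beta>0" hp_class hsl_class \<Phi>
  proof (rule quotient_iso.intro)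
    show "\<Phi> (hp_class w) = hsl_class (hsl_torus w)" for w by (simp only: \<Phi>_def hsl_class_hsl_torus)
  qed (rule bounded_linear_hsl_torus bounded_linear_hsl_coeffs hsl_coeffs_hsl_torus hsl_torus_image hsl_class_hsl_torus_eq_iff)+
  have "\<exists>U \<phi>. hp_class w \<in> U \<and> (U, \<phi> :: _ \<Rightarrow> quat^'m) \<in> quotient_charts (- {0}) hp_class"
    if "w \<in> - {0}" for w :: "quat^'m"
  proof -
    obtain k where "w $ k \<noteq> 0" using \<open>w \<in> - {0}\<close> by (auto simp: vec_eq_iff)
    then have "hp_class w \<in> {hp_class w | w. w $ k \<noteq> 0}" by blast
    with affine_chart show ?thesis by (intro exI conjI)
  qed
  then have "diffeomorphism (HP :: ((quat^'m) set, quat^'m) manifold)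
      (moduli lat \<beta>0 :: (c2map set, quat^'m) manifold) \<Phi>"
    unfolding HP_def moduli_def by (rule diffeomorphism_\<Phi>)
  then show ?thesis
    unfolding \<Gamma> using hsl_torus_in_hsl_tori torus_formula_hsl_torus hsl_class_hsl_torus by (intro exI[of _ \<Phi>]) (auto simp: \<Phi>_def)
qed

end
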